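(* (i) For each graph $G$ we have $\log_3(\chi_{\rm acyc}(G)) \leq f_1(G) \leq \binom{\chi_{\rm acyc}(G)}{2}$. (ii) For any integers $k,n\geq 1$, and for each item below, there is a graph $G$ satisfying the listed conditions: (a) $a'(G) = 2$ and $f_k(G) \geq n$; (b) $f_k(G) \leq 3$ and $f_{k+1}(G) \geq n$; (c) $f_k(G) \geq n$ and $f_{k+1}(G) = 0$; (d) $G$ has an induced subgraph $H$ such that $f_k(G) = 3$ and $f_k(H) \geq k$; (e) $\operatorname{tw}(G) = 2$ and $f_k(G) \geq k$; (f) $\operatorname{td}(G) = 3$ and $f_k(G) \geq k-1$. (iii) There is a class $\mathcal{C}$ of graphs that is nowhere dense, but not $f_k$-bounded for any $k \geq 1$. (iv) There is a class $\mathcal{C}$ of graphs that is $f_k$-bounded for every $k \geq 1$, but not nowhere dense.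
   Context: All graphs are simple, finite and undirected. An induced forest in $G$ is an acyclic induced subgraph of $G$. For $k\geq 1$, a $k$-strong forest of $G$ is an induced forest in $G$ each of whose connected components has at least $k$ edges. An edge of $G$ is $k$-valid if it is contained in some $k$-strong forest of $G$. The $k$-strong induced arboricity $f_k(G)$ is the smallest number of $k$-strong forests of $G$ that together cover all $k$-valid edges of $G$ (so $f_k(G)=0$ if $G$ has no $k$-valid edges). A class $\mathcal{C}$ of graphs is $f_k$-bounded if there is a constant $c_k=c(k,\mathcal{C})$ such that $f_k(G)\leq c_k$ for each $G\in\mathcal{C}$. The acyclic chromatic number $\chi_{\rm acyc}(G)$ is the smallest number of colors in a proper vertex coloring of $G$ in which any two color classes induce a forest. The edge arboricity $a'(G)$ is the minimum number of (not necessarily induced) forests in $G$ that cover $E(G)$. $\operatorname{tw}(G)$ is the tree-width of $G$. The transitive closure of a rooted tree $T$ with root $r$ is the graph obtained from $T$ by adding every edge $uv$ such that $v$ lies on the $u$-$r$-path of $T$; a rooted tree has depth $d$ if the largest number of vertices on a path to the root is $d$; the tree-depth $\operatorname{td}(G)$ is the smallest integer $d$ such that each connected component of $G$ is a subgraph of the transitive closure of a rooted tree of depth $d$. For a graph $H$ and an integer $d\geq 0$, a graph $G$ with vertex set $\{v_1,\ldots,v_m\}$ is a $d$-shallow minor of $H$ if there are pairwise disjoint vertex subsets $B_1,\ldots,B_m$ of $H$ such that each $B_i$ induces a connected subgraph of $H$ of radius at most $d$ (some vertex is within distance $d$ of all others), and for each edge $v_iv_j$ of $G$ there is an edge of $H$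 with one endpoint in $B_i$ and the other in $B_j$. A class $\mathcal{C}$ of graphs is nowhere dense if for each integer $d\geq 0$ there is a graph that is not a $d$-shallow minor of any graph in $\mathcal{C}$. *)

theory Defs
  imports Complex_Main "HOL-Library.Extended_Nat"
begin

section \<open>Graphs\<close>

datatype 'a ugraph = Graph (verts: "'a set") (edges: "'a set set")

definition simple_graph :: "'a ugraph \<Rightarrow> bool" where
  "simple_graph G \<longleftrightarrow>
     finite (verts G) \<and> (\<forall>e \<in> edges G. e \<subseteq> verts G \<and> card e = 2)"

definition subgraph :: "'a ugraph \<Rightarrow> 'a ugraph \<Rightarrow> bool" where
  "subgraph H G \<longleftrightarrow> simple_graph H \<and> verts H \<subseteq> verts G \<and> edges H \<subseteq> edges G"

definition induce :: "'a ugraph \<Rightarrow> 'a set \<Rightarrow> 'a ugraph" where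
  "induce G S = Graph S {e \<in> edges G. e \<subseteq> S}"

definition induced_subgraph :: "'a ugraph \<Rightarrow> 'a ugraph \<Rightarrow> bool" where
  "induced_subgraph H G \<longleftrightarrow> (\<exists>S \<subseteq> verts G. H = induce G S)"

text \<open>Being a subgraph up to isomorphism, for graphs over possibly different vertex types.\<close>

definition embeds :: "'a ugraph \<Rightarrow> 'b ugraph \<Rightarrow> bool" where
  "embeds H G \<longleftrightarrow>
     (\<exists>f. inj_on f (verts H) \<and> f ` verts H \<subseteq> verts G \<and> (\<forall>e \<in> edges H. f ` e \<in> edges G))"

text \<open>Walks are given by their vertex sequences, so a walk \<open>p\<close> has \<open>length p - 1\<close> edges.\<close>

definition walk :: "'a ugraph \<Rightarrow> 'a \<Rightarrow> 'a list \<Rightarrow> 'a \<Rightarrow> bool" where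
  "walk G u p v \<longleftrightarrow>
     p \<noteq> [] \<and> hd p = u \<and> last p = v \<and> set p \<subseteq> verts G \<and>
     successively (\<lambda>x y. {x, y} \<in> edges G) p"

definition vpath :: "'a ugraph \<Rightarrow> 'a \<Rightarrow> 'a list \<Rightarrow> 'a \<Rightarrow> bool" where
  "vpath G u p v \<longleftrightarrow> walk G u p v \<and> distinct p"

definition vcycle :: "'a ugraph \<Rightarrow> 'a list \<Rightarrow> bool" where
  "vcycle G p \<longleftrightarrow>
     3 \<le> length p \<and> (\<exists>u v. vpath G u p v \<and> {v, u} \<in> edges G)"

definition acyclic_graph :: "'a ugraph \<Rightarrow> bool" where
  "acyclic_graph G \<longleftrightarrow> (\<nexists>p. vcycle G p)"

definition joined :: "'a ugraph \<Rightarrow> 'a \<Rightarrow> 'a \<Rightarrow> bool" where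
  "joined G u v \<longleftrightarrow> (\<exists>p. walk G u p v)"

definition connected_graph :: "'a ugraph \<Rightarrow> bool" where
  "connected_graph G \<longleftrightarrow> verts G \<noteq> {} \<and> (\<forall>u \<in> verts G. \<forall>v \<in> verts G. joined G u v)"

definition components :: "'a ugraph \<Rightarrow> 'a ugraph set" where
  "components G = (\<lambda>u. induce G {v. joined G u v}) ` verts G"

definition graph_dist :: "'a ugraph \<Rightarrow> 'a \<Rightarrow> 'a \<Rightarrow> enat" where
  "graph_dist G u v = (INF p \<in> {p. walk G u p v}. enat (length p - 1))"

definition radius_at_most :: "nat \<Rightarrow> 'a ugraph \<Rightarrow> bool" where
  "radius_at_most d G \<longleftrightarrow> (\<exists>c \<in> verts G. \<forall>v \<in> verts G. graph_dist G c v \<le> enat d)"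

definition tree :: "'a ugraph \<Rightarrow> bool" where
  "tree T \<longleftrightarrow> simple_graph T \<and> connected_graph T \<and> acyclic_graph T"


section \<open>Strong induced arboricity\<close>

definition induced_forest :: "'a ugraph \<Rightarrow> 'a ugraph \<Rightarrow> bool" where
  "induced_forest F G \<longleftrightarrow> induced_subgraph F G \<and> acyclic_graph F"

definition strong_forest :: "nat \<Rightarrow> 'a ugraph \<Rightarrow> 'a ugraph \<Rightarrow> bool" where
  "strong_forest k F G \<longleftrightarrow>
     induced_forest F G \<and> (\<forall>C \<in> components F. k \<le> card (edges C))"

definition valid_edge :: "nat \<Rightarrow> 'a ugraph \<Rightarrow> 'a set \<Rightarrow> bool" where
  "valid_edge k G e \<longleftrightarrow> e \<in> edges G \<and> (\<exists>F. strong_forest k F G \<and> e \<in> edges F)"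

text \<open>
  This and the other graph parameters are minima over sets of natural numbers that are
  nonempty for every simple (in particular finite) graph.
\<close>

definition strong_induced_arboricity :: "nat \<Rightarrow> 'a ugraph \<Rightarrow> nat" where
  "strong_induced_arboricity k G =
     (LEAST n. \<exists>\<F>. finite \<F> \<and> card \<F> = n \<and> (\<forall>F \<in> \<F>. strong_forest k F G) \<and>
        (\<forall>e. valid_edge k G e \<longrightarrow> (\<exists>F \<in> \<F>. e \<in> edges F)))"

definition f_bounded :: "nat \<Rightarrow> 'a ugraph set \<Rightarrow> bool" where
  "f_bounded k \<C> \<longleftrightarrow> (\<exists>c. \<forall>G \<in> \<C>. strong_induced_arboricity k G \<le> c)"


section \<open>Other graph parameters\<close>

definition acyclic_coloring :: "'a ugraph \<Rightarrow> nat \<Rightarrow> ('a \<Rightarrow> nat) \<Rightarrow> bool" where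
  "acyclic_coloring G c col \<longleftrightarrow>
     col ` verts G \<subseteq> {..<c} \<and>
     (\<forall>u v. {u, v} \<in> edges G \<longrightarrow> col u \<noteq> col v) \<and>
     (\<forall>i < c. \<forall>j < c. i \<noteq> j \<longrightarrow>
        acyclic_graph (induce G {v \<in> verts G. col v = i \<or> col v = j}))"

definition acyclic_chromatic_number :: "'a ugraph \<Rightarrow> nat" where
  "acyclic_chromatic_number G = (LEAST c. \<exists>col. acyclic_coloring G c col)"

definition edge_arboricity :: "'a ugraph \<Rightarrow> nat" where
  "edge_arboricity G =
     (LEAST n. \<exists>\<F>. finite \<F> \<and> card \<F> = n \<and>
        (\<forall>F \<in> \<F>. subgraph F G \<and> acyclic_graph F) \<and> edges G \<subseteq> (\<Union>F \<in> \<F>. edges F))"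

definition tree_decomposition :: "'a ugraph \<Rightarrow> 'b ugraph \<Rightarrow> ('b \<Rightarrow> 'a set) \<Rightarrow> bool" where
  "tree_decomposition G T X \<longleftrightarrow>
     tree T \<and>
     (\<Union>t \<in> verts T. X t) = verts G \<and>
     (\<forall>e \<in> edges G. \<exists>t \<in> verts T. e \<subseteq> X t) \<and>
     (\<forall>v \<in> verts G. connected_graph (induce T {t \<in> verts T. v \<in> X t}))"

text \<open>The width of a decomposition is the largest bag size minus one; as the value is taken in
  \<^typ>\<open>nat\<close>, the graph without vertices gets tree-width 0 instead of -1.\<close>

definition treewidth :: "'a ugraph \<Rightarrow> nat" where
  "treewidth G =
     (LEAST w. \<exists>(T :: nat ugraph) X. tree_decomposition G T X \<and>
        (\<forall>t \<in> verts T. card (X t) \<le> w + 1))"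

definition tree_closure :: "'a ugraph \<Rightarrow> 'a \<Rightarrow> 'a ugraph" where
  "tree_closure T r =
     Graph (verts T)
       (edges T \<union> {{u, v} |u v. u \<noteq> v \<and> (\<exists>p. vpath T u p r \<and> v \<in> set p)})"

definition rooted_depth :: "'a ugraph \<Rightarrow> 'a \<Rightarrow> nat" where
  "rooted_depth T r = Max {length p |p u. vpath T u p r}"

definition treedepth :: "'a ugraph \<Rightarrow> nat" where
  "treedepth G =
     (LEAST d. \<forall>C \<in> components G. \<exists>(T :: nat ugraph) r.
        tree T \<and> r \<in> verts T \<and> rooted_depth T r = d \<and> embeds C (tree_closure T r))"


section \<open>Shallow minors and nowhere dense classes\<close>

definition shallow_minor :: "nat \<Rightarrow> 'a ugraph \<Rightarrow> 'b ugraph \<Rightarrow> bool" where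
  "shallow_minor d G H \<longleftrightarrow>
     (\<exists>B :: 'a \<Rightarrow> 'b set.
        (\<forall>v \<in> verts G. B v \<subseteq> verts H \<and> connected_graph (induce H (B v)) \<and>
           radius_at_most d (induce H (B v))) \<and>
        (\<forall>u \<in> verts G. \<forall>v \<in> verts G. u \<noteq> v \<longrightarrow> B u \<inter> B v = {}) \<and>
        (\<forall>u v. {u, v} \<in> edges G \<longrightarrow> (\<exists>x \<in> B u. \<exists>y \<in> B v. {x, y} \<in> edges H)))"

text \<open>Every finite graph is isomorphic to one with vertices in \<^typ>\<open>nat\<close>, so the excluded
  shallow minor may be sought there.\<close>

definition nowhere_dense :: "'a ugraph set \<Rightarrow> bool" where
  "nowhere_dense \<C> \<longleftrightarrow>
     (\<forall>d. \<exists>G :: nat ugraph. simple_graph G \<and> (\<forall>H \<in> \<C>. \<not> shallow_minor d G H))"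

end

theory Submission
  imports Defs "HOL-Library.Nat_Bijection" "HOL-Library.FuncSet"
begin

text \<open>
  Part (i): 2-colouring each forest of an optimal cover gives every vertex a vector over 3 symbols,
  and the resulting colouring is acyclic because two colour classes joined by an edge lie in a
  common forest; conversely the pairs of colour classes, without isolated vertices, are 1-strong
  forests.

  Part (ii): in a subdivided clique with \<open>m\<close> branch vertices some \<open>m / 2 ^ f\<close> branch vertices lie in
  the same of the \<open>f\<close> covering forests, and comparing edges with vertices on the subdivided paths
  among them bounds \<open>m\<close> in terms of \<open>f\<close>. Pendant vertices control which edges are
  \<open>k\<close>-valid: one subdivision vertex per edge gives (a), two give (b). A clique joined to a
  star with \<open>k - 1\<close> leaves gives (c). For (d), (e) and (f), let \<open>k - 1\<close> vertices be adjacent to both \<open>r\<close>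
  and \<open>a\<close>; the edges at \<open>a\<close> need \<open>r\<close> to reach \<open>k\<close> edges, so a \<open>k\<close>-strong forest contains only
  one of them, while pendant vertices at \<open>a\<close> remove this restriction.

  Part (iii): take graphs of large girth and large average degree. Every edge at a vertex of degree at
  least \<open>k\<close> is \<open>k\<close>-valid and a forest has fewer edges than vertices, so many forests are needed; a
  shallow triangle minor gives a short cycle, so large cliques are not shallow minors.

  Part (iv): if every edge of a clique is replaced by a path with three inner vertices, and enough
  pendant vertices are added, two forests suffice, but every graph is a 2-shallow minor.
\<close>

section \<open>Foundations: reachability along walks\<close>

section \<open>Walks and components\<close>

text \<open>A \<open>k\<close>-strong forest is subject to a condition on every component, handled
  by two local tests. To certify it, each component is shown to contain a vertex with
  \<open>k\<close> neighbours in the forest; this is the purpose of the pendant vertices. To refute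
  it, a set closed under adjacency in the forest must not span fewer than \<open>k\<close> edges. In
  (b) and (d) to (f) the available neighbours are tuned to fall just short in the second test, so
  that an edge drags a prescribed vertex into its forest.

  Lower bounds are of two kinds: either each forest contains at most one edge of a list, or edges
  are counted against vertices. The plain count is useless for subdivided cliques, which have fewer
  than twice as many edges as vertices; hence the restriction to branch vertices of one type.

  The triangle in the graph for (d), (e) and (f) does several jobs: it yields the value 3 in (d), a
  further edge for the list of incompatible edges, a bag with three vertices and depth 3.\<close>

lemma simple_graph_edgeD:
  assumes "simple_graph G" "{x, y} \<in> edges G"
  shows "x \<in> verts G" "y \<in> verts G" "x \<noteq> y"
  using assms unfolding simple_graph_def by (auto dest!: bspec[of _ _ "{x, y}"])

lemma simple_graph_edgeE:
  assumes "simple_graph G" "e \<in> edges G"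
  obtains x y where "e = {x, y}" "x \<noteq> y" "x \<in> verts G" "y \<in> verts G"
  using assms unfolding simple_graph_def by (metis card_2_iff insert_subset)

lemma finite_verts: "simple_graph G \<Longrightarrow> finite (verts G)"
  by (simp add: simple_graph_def)

lemma finite_edges: "simple_graph G \<Longrightarrow> finite (edges G)"
  by (rule finite_subset[of _ "Pow (verts G)"]) (auto simp: simple_graph_def)

lemma induce_simps [simp]:
  "verts (induce G S) = S"
  "edges (induce G S) = {e \<in> edges G. e \<subseteq> S}"
  by (simp_all add: induce_def)

lemma simple_graph_induce:
  assumes "simple_graph G" "S \<subseteq> verts G"
  shows "simple_graph (induce G S)"
  using assms finite_subset unfolding simple_graph_def by auto

lemma simple_graph_induced_subgraph:
  "simple_graph G \<Longrightarrow> induced_subgraph F G \<Longrightarrow> simple_graph F"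
  unfolding induced_subgraph_def using simple_graph_induce by blast

lemma walk_Cons_Cons:
  "walk G u (x # y # p) v \<longleftrightarrow> u = x \<and> x \<in> verts G \<and> {x, y} \<in> edges G \<and> walk G y (y # p) v"
  by (auto simp: walk_def)

text \<open>Makes the induction rules and the symmetry of transitive closures available. The
  condition \<open>u \<in> verts G\<close> remains because the closure also relates elements outside
  the graph to themselves.\<close>

lemma joined_iff_rtrancl:
  "joined G u v \<longleftrightarrow> u \<in> verts G \<and>
     (u, v) \<in> {(x, y). x \<in> verts G \<and> y \<in> verts G \<and> {x, y} \<in> edges G}\<^sup>*"
    (is "_ \<longleftrightarrow> _ \<and> _ \<in> ?R\<^sup>*")
proof
  have "u \<in> verts G \<and> (u, v) \<in> ?R\<^sup>*" if "walk G u p v" for p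
    using that
  proof (induction p arbitrary: u)
    case Nil
    then show ?case by (simp add: walk_def)
  next
    case (Cons x p)
    show ?case
    proof (cases p)
      case Nil
      with Cons.prems show ?thesis by (auto simp: walk_def)
    next
      case (Cons y q)
      with Cons.prems have *: "u = x" "x \<in> verts G" "{x, y} \<in> edges G" "walk G y p v"
        by (auto simp: walk_Cons_Cons)
      with Cons.IH[of y] show ?thesis by (auto intro: converse_rtrancl_into_rtrancl)
    qed
  qed
  then show "joined G u v \<Longrightarrow> u \<in> verts G \<and> (u, v) \<in> ?R\<^sup>*"
    unfolding joined_def by blast
next
  assume "u \<in> verts G \<and> (u, v) \<in> ?R\<^sup>*"
  then have "(u, v) \<in> ?R\<^sup>*" "u \<in> verts G" by auto
  then have "\<exists>p. walk G u p v"
  proof (induction rule: converse_rtrancl_induct)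
    case base
    then show ?case by (intro exI[of _ "[v]"]) (auto simp: walk_def)
  next
    case (step y z)
    then obtain p where "walk G z p v" by auto
    moreover then obtain q where "p = z # q" by (cases p) (auto simp: walk_def)
    ultimately have "walk G y (y # p) v" using step by (auto simp: walk_Cons_Cons)
    then show ?case by blast
  qed
  then show "joined G u v" by (simp add: joined_def)
qed

lemma joined_refl: "u \<in> verts G \<Longrightarrow> joined G u u"
  by (simp add: joined_iff_rtrancl)

lemma joined_verts: "joined G u v \<Longrightarrow> u \<in> verts G \<and> v \<in> verts G"
  unfolding joined_def walk_def by (auto intro: list.set_sel last_in_set)

lemma joined_trans: "joined G u v \<Longrightarrow> joined G v w \<Longrightarrow> joined G u w"
  by (meson joined_iff_rtrancl rtrancl_trans)

lemma joined_edge: "{u, v} \<in> edges G \<Longrightarrow> u \<in> verts G \<Longrightarrow> v \<in> verts G \<Longrightarrow> joined G u v"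
  by (auto simp: joined_iff_rtrancl)

lemma joined_sym:
  assumes "joined G u v" shows "joined G v u"
proof -
  have "sym {(x, y). x \<in> verts G \<and> y \<in> verts G \<and> {x, y} \<in> edges G}"
    by (auto simp: sym_def insert_commute)
  then show ?thesis
    using assms joined_verts[OF assms] unfolding joined_iff_rtrancl
    by (auto dest: sym_rtrancl symD)
qed

lemma joined_closed:
  assumes "joined G u v" "u \<in> W"
    and "\<And>x y. x \<in> W \<Longrightarrow> y \<in> verts G \<Longrightarrow> {x, y} \<in> edges G \<Longrightarrow> y \<in> W"
  shows "v \<in> W"
proof -
  from assms(1) have "(u, v) \<in> {(x, y). x \<in> verts G \<and> y \<in> verts G \<and> {x, y} \<in> edges G}\<^sup>*"
    by (simp add: joined_iff_rtrancl)
  then show ?thesis by induction (use assms in auto)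
qed

lemma connected_graphI:
  assumes "r \<in> verts G" "\<And>v. v \<in> verts G \<Longrightarrow> joined G v r"
  shows "connected_graph G"
  unfolding connected_graph_def using assms(1) assms(2) by (auto intro: joined_trans[OF _ joined_sym])

lemma walk_vpath:
  assumes "walk G u p v"
  shows "\<exists>q. vpath G u q v"
  using assms
proof (induction p arbitrary: u)
  case Nil
  then show ?case by (simp add: walk_def)
next
  case (Cons x p)
  show ?case
  proof (cases p)
    case Nil
    with Cons.prems show ?thesis by (auto simp: walk_def vpath_def intro!: exI[of _ "[x]"])
  next
    case (Cons y p')
    with Cons.prems have *: "u = x" "x \<in> verts G" "{x, y} \<in> edges G" "walk G y p v"
      by (auto simp: walk_Cons_Cons)
    with Cons.IH[of y] obtain q where q: "vpath G y q v" by blast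
    then obtain q' where q': "q = y # q'" by (cases q) (auto simp: vpath_def walk_def)
    show ?thesis
    proof (cases "x \<in> set q")
      case True
      then obtain a b where ab: "q = a @ x # b" by (auto dest: split_list)
      with q have "vpath G x (x # b) v"
        by (auto simp: vpath_def walk_def successively_append_iff)
      then show ?thesis using * by blast
    next
      case False
      with q q' * have "vpath G x (x # q) v" by (auto simp: vpath_def walk_Cons_Cons)
      then show ?thesis using * by blast
    qed
  qed
qed

section \<open>Foundations: cycles, leaves, and edges counted against vertices\<close>

section \<open>Forests\<close>

text \<open>Indices modulo the length treat the closing edge like the others, so that rotating a
  cycle is an index shift.\<close>

lemma vcycle_iff_nth:
  "vcycle G p \<longleftrightarrow> 3 \<le> length p \<and> distinct p \<and> set p \<subseteq> verts G \<and>
     (\<forall>i < length p. {p ! i, p ! (Suc i mod length p)} \<in> edges G)"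
    (is "_ \<longleftrightarrow> _ \<and> _ \<and> _ \<and> ?C")
proof (cases "3 \<le> length p")
  case True
  then have ne: "p \<noteq> []" by (cases p) auto
  have "?C \<longleftrightarrow> (\<forall>i. Suc i < length p \<longrightarrow> {p ! i, p ! Suc i} \<in> edges G) \<and> {last p, hd p} \<in> edges G"
    (is "_ \<longleftrightarrow> ?A \<and> ?B")
  proof safe
    assume c: ?C
    show "{p ! i, p ! Suc i} \<in> edges G" if "Suc i < length p" for i
      using c[rule_format, of i] that by simp
    show ?B using c[rule_format, of "length p - 1"] ne by (simp add: last_conv_nth hd_conv_nth)
  next
    fix i assume a: ?A and b: ?B and i: "i < length p"
    show "{p ! i, p ! (Suc i mod length p)} \<in> edges G"
    proof (cases "Suc i < length p")
      case True
      then show ?thesis using a by simp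
    next
      case False
      then have [simp]: "i = length p - 1" using i by simp
      show ?thesis using b ne by (simp add: last_conv_nth hd_conv_nth)
    qed
  qed
  then show ?thesis using True ne
    by (auto simp: vcycle_def vpath_def walk_def successively_conv_nth)
qed (simp add: vcycle_def)

lemma vcycle_rotate1:
  assumes "vcycle G p"
  shows "vcycle G (rotate1 p)"
proof -
  have l: "3 \<le> length p" using assms by (simp add: vcycle_def)
  have "{rotate1 p ! i, rotate1 p ! (Suc i mod length p)} \<in> edges G" if "i < length p" for i
  proof -
    have "Suc i mod length p < length p" by (rule mod_less_divisor) (use l in linarith)
    then show ?thesis
      using assms that unfolding vcycle_iff_nth by (simp add: nth_rotate1)
  qed
  then show ?thesis using assms by (simp add: vcycle_iff_nth)
qed

lemma vcycle_rotate: "vcycle G p \<Longrightarrow> vcycle G (rotate n p)"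
  by (induction n) (auto simp: vcycle_rotate1)

lemma vcycle_neighbours:
  assumes "vcycle G p" "v \<in> set p"
  obtains x y where "x \<in> set p" "y \<in> set p" "x \<noteq> y" "{v, x} \<in> edges G" "{v, y} \<in> edges G"
proof -
  obtain i where i: "i < length p" "v = p ! i" using assms(2) by (auto simp: in_set_conv_nth)
  define q where "q = rotate i p"
  have q: "vcycle G q" unfolding q_def by (rule vcycle_rotate[OF assms(1)])
  have v: "v = q ! 0" using i nth_rotate[of 0 p i] by (cases p) (auto simp: q_def)
  have l: "3 \<le> length q" using q by (simp add: vcycle_def)
  then have l': "0 < length q" "Suc 0 < length q" by linarith+
  then have l'': "Suc 0 mod length q = Suc 0" by simp
  show ?thesis
  proof (rule that[of "q ! 1" "q ! (length q - 1)"])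
    show "q ! 1 \<in> set p" "q ! (length q - 1) \<in> set p"
      using l by (metis nth_mem set_rotate q_def diff_less less_le_trans zero_less_numeral zero_less_one one_less_numeral_iff semiring_norm(77))+
    show "q ! 1 \<noteq> q ! (length q - 1)"
      using q l by (auto simp: vcycle_iff_nth nth_eq_iff_index_eq)
    have 0: "{q ! i, q ! (Suc i mod length q)} \<in> edges G" if "i < length q" for i
      using q that by (simp add: vcycle_iff_nth)
    show "{v, q ! 1} \<in> edges G" using 0[OF l'(1)] v l'' by simp
    show "{v, q ! (length q - 1)} \<in> edges G" using 0[of "length q - 1"] l' v
      by (auto simp: insert_commute)
  qed
qed

text \<open>A vertex of maximal height on a cycle would have both of its cycle neighbours as parent.
  The explicit forests below are shown acyclic by such a parent map.\<close>

lemma acyclic_graph_parent: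
  fixes h :: "'a \<Rightarrow> nat"
  assumes "\<And>e. e \<in> edges G \<Longrightarrow> \<exists>x. e = {x, par x} \<and> h (par x) < h x"
  shows "acyclic_graph G"
  unfolding acyclic_graph_def
proof
  assume "\<exists>p. vcycle G p"
  then obtain p where p: "vcycle G p" by blast
  then have "set p \<noteq> {}" by (auto simp: vcycle_def)
  then have "Max (h ` set p) \<in> h ` set p" by (intro Max_in) auto
  then obtain v where v: "v \<in> set p" "h v = Max (h ` set p)" by auto
  then have max: "h w \<le> h v" if "w \<in> set p" for w using that by simp
  obtain x y where xy: "x \<in> set p" "y \<in> set p" "x \<noteq> y" "{v, x} \<in> edges G" "{v, y} \<in> edges G"
    using vcycle_neighbours[OF p v(1)] .
  have "z = par v" if "z \<in> set p" "{v, z} \<in> edges G" for z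
    using assms[OF that(2)] max[OF that(1)] by (auto simp: doubleton_eq_iff)
  with xy show False by metis
qed

lemma acyclic_graph_mono:
  assumes "acyclic_graph G" "verts H \<subseteq> verts G" "edges H \<subseteq> edges G"
  shows "acyclic_graph H"
  using assms unfolding acyclic_graph_def vcycle_iff_nth by blast

lemma vcycle_triangle:
  assumes "{x, y} \<in> edges G" "{y, z} \<in> edges G" "{x, z} \<in> edges G"
    and "x \<in> verts G" "y \<in> verts G" "z \<in> verts G" "x \<noteq> y" "y \<noteq> z" "x \<noteq> z"
  shows "vcycle G [x, y, z]"
  using assms by (auto simp: vcycle_def vpath_def walk_def insert_commute)

text \<open>An endpoint of a longest path has no further neighbour.\<close>

lemma acyclic_graph_leaf:
  assumes "simple_graph G" "acyclic_graph G" "verts G \<noteq> {}"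
  obtains v where "v \<in> verts G" "\<And>x y. {v, x} \<in> edges G \<Longrightarrow> {v, y} \<in> edges G \<Longrightarrow> x = y"
proof -
  define P where "P = {p. p \<noteq> [] \<and> distinct p \<and> set p \<subseteq> verts G \<and>
    successively (\<lambda>x y. {x, y} \<in> edges G) p}"
  have fin: "finite (verts G)" using assms finite_verts by blast
  obtain v0 where v0: "v0 \<in> verts G" using assms by blast
  then have "[v0] \<in> P" by (simp add: P_def)
  moreover have "length p \<le> card (verts G)" if "p \<in> P" for p
    using that fin by (metis (mono_tags, lifting) P_def card_mono distinct_card mem_Collect_eq)
  ultimately obtain p where p: "p \<in> P" "\<And>q. q \<in> P \<Longrightarrow> length q \<le> length p"
    using ex_has_greatest_nat[of "\<lambda>p. p \<in> P" "[v0]" length "Suc (card (verts G))"]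
    by (auto simp: less_Suc_eq_le)
  then obtain v q where vq: "p = v # q" by (cases p) (auto simp: P_def)
  show ?thesis
  proof (rule that[of v])
    show "v \<in> verts G" using p vq by (auto simp: P_def)
  next
    \<comment> \<open>A neighbour other than \<open>hd q\<close> would either extend
      \<open>p\<close> or close a cycle with an initial segment of it.\<close>
    have *: "x = hd q \<and> q \<noteq> []" if e: "{v, x} \<in> edges G" for x
    proof (rule ccontr)
      assume neg: "\<not> ?thesis"
      have xv: "x \<in> verts G" "x \<noteq> v" using simple_graph_edgeD[OF assms(1) e] by auto
      show False
      proof (cases "x \<in> set q")
        case False
        then have "x # p \<in> P" using p vq xv e by (auto simp: P_def insert_commute)
        then show False using p(2)[of "x # p"] by simp
      next
        case True
        then obtain a b where ab: "q = a @ x # b" by (auto dest: split_list)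
        then have "a \<noteq> []" using neg by auto
        then have "3 \<le> length (v # a @ [x])" by (cases a) auto
        moreover have "successively (\<lambda>x y. {x, y} \<in> edges G) ((v # a @ [x]) @ b)"
          using p vq ab by (simp add: P_def)
        then have "successively (\<lambda>x y. {x, y} \<in> edges G) (v # a @ [x])"
          unfolding successively_append_iff by blast
        ultimately have "vcycle G (v # a @ [x])"
          using p(1) vq ab e unfolding vcycle_def vpath_def walk_def P_def
          by (auto simp: insert_commute)
        then show False using assms(2) by (auto simp: acyclic_graph_def)
      qed
    qed
    show "x = y" if "{v, x} \<in> edges G" "{v, y} \<in> edges G" for x y
      using *[OF that(1)] *[OF that(2)] by simp
  qed
qed

text \<open>Deleting a leaf loses one vertex and at most one edge, down to a single vertex without
  edges.\<close>

lemma acyclic_graph_card_edges: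
  assumes "simple_graph G" "acyclic_graph G" "verts G \<noteq> {}"
  shows "card (edges G) < card (verts G)"
  using assms
proof (induction "card (verts G)" arbitrary: G rule: less_induct)
  case less
  obtain v where v: "v \<in> verts G" "\<And>x y. {v, x} \<in> edges G \<Longrightarrow> {v, y} \<in> edges G \<Longrightarrow> x = y"
    using acyclic_graph_leaf less.prems by metis
  define H where "H = induce G (verts G - {v})"
  have fin: "finite (verts G)" "finite (edges G)"
    using less.prems finite_verts finite_edges by blast+
  have H: "simple_graph H" "acyclic_graph H"
    using less.prems unfolding H_def
    by (auto intro: simple_graph_induce acyclic_graph_mono[OF less.prems(2)])
  have card: "card (verts G) = Suc (card (verts H))"
    using card_Suc_Diff1[OF fin(1) v(1)] by (simp add: H_def)
  define X where "X = edges G - edges H"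
  have X: "v \<in> e" if "e \<in> X" for e
    using that less.prems(1) unfolding X_def H_def simple_graph_def by auto
  have "e = e'" if "e \<in> X" "e' \<in> X" for e e'
  proof -
    have "\<exists>x. e = {v, x}" if "e \<in> X" for e
      using X[OF that] that simple_graph_edgeE[OF less.prems(1), of e]
      by (metis Diff_iff X_def doubleton_eq_iff insertE singletonD)
    then obtain x y where "e = {v, x}" "e' = {v, y}" using \<open>e \<in> X\<close> \<open>e' \<in> X\<close> by blast
    then show ?thesis using v(2)[of x y] that by (simp add: X_def)
  qed
  then have X1: "card X \<le> 1" by (intro card_le_Suc0_iff_eq[THEN iffD2, unfolded One_nat_def[symmetric]])
      (auto simp: X_def fin)
  have "edges G = edges H \<union> X" by (auto simp: X_def H_def)
  then have le: "card (edges G) \<le> card (edges H) + 1"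
    using X1 card_Un_le[of "edges H" X] by simp
  show ?case
  proof (cases "verts H = {}")
    case True
    then have "verts G = {v}" using v(1) by (auto simp: H_def)
    then have "e \<notin> edges G" for e
      by (auto elim: simple_graph_edgeE[OF less.prems(1)])
    then have "edges G = {}" by blast
    then show ?thesis using card by simp
  next
    case False
    then have "card (edges H) < card (verts H)" using less.hyps[of H] H card by simp
    then show ?thesis using le card by simp
  qed
qed

text \<open>A vertex set is grown from one vertex; while it is not everything, connectivity provides
  an edge leaving it, so each new vertex brings a new edge.\<close>

lemma connected_graph_card_edges:
  assumes "simple_graph G" "connected_graph G"
  shows "card (verts G) \<le> card (edges G) + 1"
proof -
  have fin: "finite (verts G)" "finite (edges G)"
    using assms finite_verts finite_edges by blast+
  obtain v where v: "v \<in> verts G" using assms by (auto simp: connected_graph_def)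
  have "n < card (verts G) \<Longrightarrow> \<exists>S \<subseteq> verts G. v \<in> S \<and> card S = Suc n \<and>
    n \<le> card {e \<in> edges G. e \<subseteq> S}" for n
  proof (induction n)
    case 0
    then show ?case using v by (intro exI[of _ "{v}"]) auto
  next
    case (Suc n)
    then obtain S where S: "S \<subseteq> verts G" "v \<in> S" "card S = Suc n" "n \<le> card {e \<in> edges G. e \<subseteq> S}"
      by auto
    then obtain w where w: "w \<in> verts G" "w \<notin> S" using Suc.prems by (metis less_irrefl subsetI subset_antisym)
    have "joined G v w" using assms v w by (auto simp: connected_graph_def)
    then obtain x y where xy: "x \<in> S" "y \<in> verts G" "y \<notin> S" "{x, y} \<in> edges G"
      using joined_closed[of G v w S] S w by blast
    have fS: "finite S" using S fin finite_subset by blast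
    have "Suc n \<le> card (insert {x, y} {e \<in> edges G. e \<subseteq> S})"
      using S fin xy by (subst card_insert_disjoint) auto
    also have "\<dots> \<le> card {e \<in> edges G. e \<subseteq> insert y S}"
      using fin xy by (intro card_mono) auto
    finally show ?case using S xy fS by (intro exI[of _ "insert y S"]) auto
  qed
  moreover have "0 < card (verts G)" using v fin by (auto simp: card_gt_0_iff)
  then have "card (verts G) - 1 < card (verts G)" by simp
  ultimately obtain S where "card (verts G) - 1 \<le> card {e \<in> edges G. e \<subseteq> S}" by blast
  also have "\<dots> \<le> card (edges G)" using fin by (intro card_mono) auto
  finally show ?thesis by simp
qed

section \<open>Foundations: certifying and refuting strong forests\<close>

section \<open>Strong forests\<close>

lemma doubleton_inj: "inj_on (\<lambda>x. {c, x}) X"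
  by (auto simp: inj_on_def doubleton_eq_iff)

lemma strong_forestD:
  assumes "strong_forest k F G" "simple_graph G"
  shows "simple_graph F" "acyclic_graph F" "verts F \<subseteq> verts G"
    and "edges F = {e \<in> edges G. e \<subseteq> verts F}"
  using assms simple_graph_induced_subgraph
  unfolding strong_forest_def induced_forest_def induced_subgraph_def by auto

text \<open>The star at \<open>c\<close> lies in the component of \<open>v\<close> and alone
  supplies the \<open>k\<close> edges demanded of it.\<close>

lemma strong_forestI:
  assumes "simple_graph G" "S \<subseteq> verts G" "acyclic_graph (induce G S)"
    and star: "\<And>v. v \<in> S \<Longrightarrow>
      \<exists>c X. joined (induce G S) v c \<and> X \<subseteq> S \<and> k \<le> card X \<and> (\<forall>x \<in> X. {c, x} \<in> edges G)"
  shows "strong_forest k (induce G S) G"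
  unfolding strong_forest_def induced_forest_def induced_subgraph_def
proof (intro conjI ballI)
  show "\<exists>S'\<subseteq>verts G. induce G S = induce G S'" "acyclic_graph (induce G S)"
    using assms by auto
  fix C assume "C \<in> components (induce G S)"
  then obtain v where v: "v \<in> S"
    "edges C = {e \<in> edges G. e \<subseteq> S \<and> e \<subseteq> {w. joined (induce G S) v w}}"
    by (auto simp: components_def)
  obtain c X where cX: "joined (induce G S) v c" "X \<subseteq> S" "k \<le> card X" "\<And>x. x \<in> X \<Longrightarrow> {c, x} \<in> edges G"
    using star[OF v(1)] by blast
  have c: "c \<in> S" using joined_verts[OF cX(1)] by simp
  have "joined (induce G S) v x" if "x \<in> X" for x
    using joined_trans[OF cX(1) joined_edge[of c x]] cX that c by auto
  then have sub: "(\<lambda>x. {c, x}) ` X \<subseteq> edges C" using cX c by (auto simp: v(2))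
  have "finite (edges C)" using finite_edges[OF assms(1)] by (simp add: v(2))
  then have "card ((\<lambda>x. {c, x}) ` X) \<le> card (edges C)" using sub by (rule card_mono)
  then show "k \<le> card (edges C)" using cX(3) by (simp add: card_image doubleton_inj)
qed

text \<open>\<open>W\<close> contains the component of \<open>v\<close>. The contrapositive is what
  matters: a closed set with too few edges contains no vertex of the forest.\<close>

lemma strong_forest_closed:
  assumes "strong_forest k F G" "simple_graph G" "v \<in> verts F" "v \<in> W"
    and closed: "\<And>x y. x \<in> W \<Longrightarrow> y \<in> verts F \<Longrightarrow> {x, y} \<in> edges F \<Longrightarrow> y \<in> W"
  shows "k \<le> card {e \<in> edges F. e \<subseteq> W}"
proof -
  have "induce F {w. joined F v w} \<in> components F" using assms(3) by (simp add: components_def)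
  then have "k \<le> card {e \<in> edges F. e \<subseteq> {w. joined F v w}}"
    using assms(1) by (force simp: strong_forest_def)
  also have "\<dots> \<le> card {e \<in> edges F. e \<subseteq> W}"
    using finite_edges[OF strong_forestD(1)[OF assms(1,2)]] joined_closed[OF _ assms(4) closed]
    by (intro card_mono) auto
  finally show ?thesis .
qed

lemma strong_forest_no_triangle:
  assumes "strong_forest k F G" "simple_graph G"
    and "x \<in> verts F" "y \<in> verts F" "z \<in> verts F"
    and "{x, y} \<in> edges G" "{y, z} \<in> edges G" "{x, z} \<in> edges G"
  shows False
  using strong_forestD[OF assms(1,2)] assms(3-) vcycle_triangle[of x y F z]
    simple_graph_edgeD(3)[OF assms(2)]
  by (auto simp: acyclic_graph_def)

lemma valid_edgeI:
  assumes "e \<in> edges G" "strong_forest k (induce G S) G" "e \<subseteq> S"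
  shows "valid_edge k G e"
  using assms by (auto simp: valid_edge_def intro!: exI[of _ "induce G S"])

lemma strong_induced_arboricity_le:
  assumes "finite \<F>" "\<And>F. F \<in> \<F> \<Longrightarrow> strong_forest k F G"
    and "\<And>e. valid_edge k G e \<Longrightarrow> \<exists>F \<in> \<F>. e \<in> edges F"
  shows "strong_induced_arboricity k G \<le> card \<F>"
  unfolding strong_induced_arboricity_def using assms by (intro Least_le) auto

text \<open>The family of all \<open>k\<close>-strong forests is finite and covers every valid edge
  by definition, so the minimum is taken over a nonempty set.\<close>

lemma strong_induced_arboricity_attained:
  assumes "simple_graph G"
  obtains \<F> where "finite \<F>" "card \<F> = strong_induced_arboricity k G"
    "\<And>F. F \<in> \<F> \<Longrightarrow> strong_forest k F G"
    "\<And>e. valid_edge k G e \<Longrightarrow> \<exists>F \<in> \<F>. e \<in> edges F"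
proof -
  let ?P = "\<lambda>n. \<exists>\<F>. finite \<F> \<and> card \<F> = n \<and> (\<forall>F \<in> \<F>. strong_forest k F G) \<and>
        (\<forall>e. valid_edge k G e \<longrightarrow> (\<exists>F \<in> \<F>. e \<in> edges F))"
  let ?\<F> = "{F. strong_forest k F G}"
  have "?\<F> \<subseteq> induce G ` Pow (verts G)"
    by (auto simp: strong_forest_def induced_forest_def induced_subgraph_def)
  then have "finite ?\<F>"
    using finite_verts[OF assms] by (meson finite_Pow_iff finite_imageI finite_subset)
  then have "?P (card ?\<F>)" by (intro exI[of _ ?\<F>]) (auto simp: valid_edge_def)
  then have "?P (strong_induced_arboricity k G)"
    unfolding strong_induced_arboricity_def by (rule LeastI)
  then show thesis using that by blast
qed

text \<open>Choosing a covering forest for each edge is injective, since no forest contains two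
  members of \<open>X\<close>.\<close>

lemma card_incompatible_edges_le:
  assumes "simple_graph G" "\<And>e. e \<in> X \<Longrightarrow> valid_edge k G e"
    and incomp: "\<And>F e e'. strong_forest k F G \<Longrightarrow> e \<in> X \<Longrightarrow> e' \<in> X \<Longrightarrow>
      e \<in> edges F \<Longrightarrow> e' \<in> edges F \<Longrightarrow> e = e'"
  shows "card X \<le> strong_induced_arboricity k G"
proof -
  obtain \<F> where \<F>: "finite \<F>" "card \<F> = strong_induced_arboricity k G"
    "\<And>F. F \<in> \<F> \<Longrightarrow> strong_forest k F G" "\<And>e. valid_edge k G e \<Longrightarrow> \<exists>F \<in> \<F>. e \<in> edges F"
    using strong_induced_arboricity_attained[OF assms(1)] by blast
  define g where "g e = (SOME F. F \<in> \<F> \<and> e \<in> edges F)" for e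
  have g: "g e \<in> \<F>" "e \<in> edges (g e)" if "e \<in> X" for e
    using someI_ex[of "\<lambda>F. F \<in> \<F> \<and> e \<in> edges F"] \<F>(4) assms(2) that unfolding g_def by blast+
  have "inj_on g X"
  proof (rule inj_onI)
    fix e e' assume "e \<in> X" "e' \<in> X" "g e = g e'"
    then show "e = e'" using incomp[of "g e" e e'] g[of e] g[of e'] \<F>(3) by simp
  qed
  then have "card X \<le> card \<F>" using g \<F>(1) by (intro card_inj_on_le[of g]) auto
  then show ?thesis using \<F>(2) by simp
qed

section \<open>Part (i): from forests to acyclic colourings and back\<close>

section \<open>Acyclic colourings\<close>

lemma acyclic_graph_two_colouring:
  assumes "simple_graph G" "acyclic_graph G"
  shows "\<exists>c :: 'a \<Rightarrow> nat. (\<forall>v. c v < 2) \<and> (\<forall>u v. {u, v} \<in> edges G \<longrightarrow> c u \<noteq> c v)"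
  using assms
proof (induction "card (verts G)" arbitrary: G rule: less_induct)
  case less
  note sD = simple_graph_edgeD[OF less.prems(1)]
  show ?case
  proof (cases "verts G = {}")
    case True
    then have "{u, v} \<notin> edges G" for u v using sD[of u v] by auto
    then show ?thesis by (intro exI[of _ "\<lambda>_. 0"]) auto
  next
    case False
    then obtain v where v: "v \<in> verts G" "\<And>x y. {v, x} \<in> edges G \<Longrightarrow> {v, y} \<in> edges G \<Longrightarrow> x = y"
      using acyclic_graph_leaf less.prems by metis
    define H where "H = induce G (verts G - {v})"
    have H: "simple_graph H" "acyclic_graph H"
      using less.prems unfolding H_def
      by (auto intro: simple_graph_induce acyclic_graph_mono[OF less.prems(2)])
    have "card (verts H) < card (verts G)"
      unfolding H_def using v(1) finite_verts[OF less.prems(1)] by (simp add: card_Diff1_less del: card_Diff_insert)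
    then obtain c where c: "\<And>v. c v < (2::nat)" "\<And>x y. {x, y} \<in> edges H \<Longrightarrow> c x \<noteq> c y"
      using less.hyps[OF _ H] by blast
    \<comment> \<open>The leaf has at most one neighbour; it receives 1 if that neighbour has colour
      0, and 0 otherwise.\<close>
    define d where "d = (\<lambda>w. if w = v then (if \<exists>x. {v, x} \<in> edges G \<and> c x = 0 then 1 else 0) else c w)"
    have 1: "d v \<noteq> d x" if "{v, x} \<in> edges G" for x
    proof -
      have "x \<noteq> v" using sD[OF that] by auto
      have "(\<exists>y. {v, y} \<in> edges G \<and> c y = 0) \<longleftrightarrow> c x = 0" using v(2) that by blast
      then show ?thesis using c(1)[of x] \<open>x \<noteq> v\<close> by (auto simp: d_def)
    qed
    have "d x \<noteq> d y" if "{x, y} \<in> edges G" for x y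
    proof (cases "x = v \<or> y = v")
      case True
      then show ?thesis using 1[of x] 1[of y] that by (auto simp: insert_commute)
    next
      case False
      then have "{x, y} \<in> edges H" using that sD[OF that] by (auto simp: H_def)
      then show ?thesis using False c(2) by (simp add: d_def)
    qed
    moreover have "d w < 2" for w using c(1) by (simp add: d_def)
    ultimately show ?thesis by blast
  qed
qed

text \<open>Allows colours of any type, so that vectors can serve as colours; a bijection with an
  initial segment renumbers them.\<close>

lemma acyclic_chromatic_number_le:
  fixes col :: "'a \<Rightarrow> 'c"
  assumes "finite C" "col ` verts G \<subseteq> C"
    and proper: "\<And>u v. {u, v} \<in> edges G \<Longrightarrow> col u \<noteq> col v"
    and acyc: "\<And>i j. i \<in> C \<Longrightarrow> j \<in> C \<Longrightarrow> i \<noteq> j \<Longrightarrow>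
      acyclic_graph (induce G {v \<in> verts G. col v = i \<or> col v = j})"
    and "simple_graph G"
  shows "acyclic_chromatic_number G \<le> card C"
proof -
  obtain h where h: "bij_betw h C {0..<card C}" using ex_bij_betw_finite_nat[OF assms(1)] by blast
  have inj: "h x = h y \<longleftrightarrow> x = y" if "x \<in> C" "y \<in> C" for x y
    using h that by (auto simp: bij_betw_def inj_on_def)
  have "acyclic_coloring G (card C) (h \<circ> col)"
    unfolding acyclic_coloring_def
  proof (intro conjI allI impI)
    show "(h \<circ> col) ` verts G \<subseteq> {..<card C}"
      using bij_betwE[OF h] assms(2) by (auto simp: image_subset_iff)
    show "(h \<circ> col) u \<noteq> (h \<circ> col) v" if "{u, v} \<in> edges G" for u v
      using proper[OF that] simple_graph_edgeD[OF assms(5) that] assms(2) inj[of "col u" "col v"] by auto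
    fix i j assume "i < card C" "j < card C" "i \<noteq> j"
    moreover from this have "i \<in> h ` C" "j \<in> h ` C" using h by (auto simp: bij_betw_def)
    ultimately obtain i' j' where ij: "i' \<in> C" "j' \<in> C" "i = h i'" "j = h j'" "i' \<noteq> j'"
      by blast
    have "{v \<in> verts G. (h \<circ> col) v = i \<or> (h \<circ> col) v = j} = {v \<in> verts G. col v = i' \<or> col v = j'}"
      using assms(2) inj ij by auto
    then show "acyclic_graph (induce G {v \<in> verts G. (h \<circ> col) v = i \<or> (h \<circ> col) v = j})"
      using acyc[of i' j'] ij by simp
  qed
  then show ?thesis unfolding acyclic_chromatic_number_def by (intro Least_le) auto
qed

lemma acyclic_graph_no_edges: "edges G = {} \<Longrightarrow> acyclic_graph G"
  by (rule acyclic_graph_parent[of _ id "\<lambda>_. 0"]) auto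

text \<open>An injective colouring is acyclic, so the minimum is attained.\<close>

lemma ex_acyclic_coloring:
  assumes "simple_graph G"
  shows "\<exists>col. acyclic_coloring G (acyclic_chromatic_number G) col"
proof -
  have fin: "finite (verts G)" using assms finite_verts by blast
  obtain h where h: "bij_betw h (verts G) {0..<card (verts G)}"
    using ex_bij_betw_finite_nat[OF fin] by blast
  have inj: "h x = h y \<longleftrightarrow> x = y" if "x \<in> verts G" "y \<in> verts G" for x y
    using h that by (auto simp: bij_betw_def inj_on_def)
  have "acyclic_coloring G (card (verts G)) h"
    unfolding acyclic_coloring_def
  proof (intro conjI allI impI)
    show "h ` verts G \<subseteq> {..<card (verts G)}" using h by (auto simp: bij_betw_def)
    show "h u \<noteq> h v" if "{u, v} \<in> edges G" for u v
      using simple_graph_edgeD[OF assms that] inj by auto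
    fix i j :: nat
    let ?S = "{v \<in> verts G. h v = i \<or> h v = j}"
    show "acyclic_graph (induce G ?S)"
    \<comment> \<open>Each of the two classes has at most one vertex; the only possible edge has the
      vertex coloured \<open>i\<close> as its parent end.\<close>
    proof (rule acyclic_graph_parent[of _ "\<lambda>_. THE v. v \<in> verts G \<and> h v = i" "\<lambda>v. if h v = i then 0 else 1"])
      fix e assume "e \<in> edges (induce G ?S)"
      then obtain x y where e: "e = {x, y}" "x \<noteq> y" "x \<in> ?S" "y \<in> ?S"
        using simple_graph_edgeE[OF simple_graph_induce[OF assms, of ?S]]
        by (metis (no_types, lifting) induce_simps(1) mem_Collect_eq subsetI)
      have the: "(THE v. v \<in> verts G \<and> h v = i) = z" if "z \<in> ?S" "h z = i" for z
        using that inj by (intro the_equality) auto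
      have "h x \<noteq> h y" using e inj by auto
      then consider "h x = i" "h y \<noteq> i" | "h y = i" "h x \<noteq> i" using e by auto
      then show "\<exists>x. e = {x, THE v. v \<in> verts G \<and> h v = i} \<and>
        (if h (THE v. v \<in> verts G \<and> h v = i) = i then 0 else 1) < (if h x = i then 0 else 1 :: nat)"
        by cases (use e the[of x] the[of y] in \<open>auto simp: insert_commute\<close>)
    qed
  qed
  then show ?thesis
    unfolding acyclic_chromatic_number_def by (intro LeastI[where P = "\<lambda>c. \<exists>col. acyclic_coloring G c col"]) blast
qed

text \<open>A single edge is itself a 1-strong forest, so for \<open>k = 1\<close> a cover must
  reach the whole graph.\<close>

lemma valid_edge_one:
  assumes "simple_graph G" "e \<in> edges G"
  shows "valid_edge 1 G e"
proof -
  obtain x y where e: "e = {x, y}" "x \<noteq> y" "x \<in> verts G" "y \<in> verts G"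
    using simple_graph_edgeE[OF assms] by blast
  have "e' = e" if "e' \<in> edges G" "e' \<subseteq> e" for e'
    using that e assms(1) by (intro card_seteq) (auto simp: simple_graph_def)
  then have ac: "acyclic_graph (induce G e)"
    by (intro acyclic_graph_parent[of _ "\<lambda>_. y" "\<lambda>v. if v = y then 0 else 1"]) (use e in auto)
  have "\<exists>c X. joined (induce G e) v c \<and> X \<subseteq> e \<and> 1 \<le> card X \<and> (\<forall>x \<in> X. {c, x} \<in> edges G)"
    if "v \<in> e" for v
    using e assms(2) that
    by (intro exI[of _ v] exI[of _ "e - {v}"]) (auto simp: joined_refl insert_commute)
  then have "strong_forest 1 (induce G e) G"
    using e by (intro strong_forestI[OF assms(1) _ ac]) auto
  then show ?thesis using assms(2) by (intro valid_edgeI[of e G 1 e]) auto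
qed

text \<open>The forests covering the edges yield colour vectors: each vertex records, for each forest,
  its colour in a proper 2-colouring of the forest, or 2 if it lies outside.\<close>

lemma acyclic_chromatic_number_le_pow:
  assumes "simple_graph G"
  shows "acyclic_chromatic_number G \<le> 3 ^ strong_induced_arboricity 1 G"
proof -
  obtain \<F> where \<F>: "finite \<F>" "card \<F> = strong_induced_arboricity 1 G"
    "\<And>F. F \<in> \<F> \<Longrightarrow> strong_forest 1 F G" "\<And>e. valid_edge 1 G e \<Longrightarrow> \<exists>F \<in> \<F>. e \<in> edges F"
    using strong_induced_arboricity_attained[OF assms] by blast
  note sf = strong_forestD[OF \<F>(3) assms]
  have "\<forall>F\<in>\<F>. \<exists>c :: 'a \<Rightarrow> nat. (\<forall>v. c v < 2) \<and> (\<forall>u v. {u, v} \<in> edges F \<longrightarrow> c u \<noteq> c v)"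
    using acyclic_graph_two_colouring[OF sf(1,2)] by blast
  then obtain c :: "'a ugraph \<Rightarrow> 'a \<Rightarrow> nat" where c: "\<And>F v. F \<in> \<F> \<Longrightarrow> c F v < 2"
    "\<And>F u v. F \<in> \<F> \<Longrightarrow> {u, v} \<in> edges F \<Longrightarrow> c F u \<noteq> c F v" by metis
  define col where "col v = restrict (\<lambda>F. if v \<in> verts F then c F v else 2) \<F>" for v
  have in_F: "v \<in> verts F \<longleftrightarrow> col v F < 2" if "F \<in> \<F>" for v F
    using c(1)[OF that] that by (simp add: col_def)
  have cover: "\<exists>F\<in>\<F>. u \<in> verts F \<and> v \<in> verts F \<and> c F u \<noteq> c F v" if "{u, v} \<in> edges G" for u v
    using \<F>(4)[OF valid_edge_one[OF assms that]] c(2) sf(1) simple_graph_edgeD by metis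
  have "acyclic_chromatic_number G \<le> card (\<F> \<rightarrow>\<^sub>E {..<3::nat})"
  proof (rule acyclic_chromatic_number_le[where col = col])
    show "finite (\<F> \<rightarrow>\<^sub>E {..<3::nat})" using \<F>(1) by (simp add: finite_PiE)
    show "col ` verts G \<subseteq> \<F> \<rightarrow>\<^sub>E {..<3}"
      using less_trans[OF c(1), of _ 3] by (auto simp: col_def)
    show "col u \<noteq> col v" if "{u, v} \<in> edges G" for u v
      using cover[OF that] by (auto simp: col_def fun_eq_iff)
    fix i j :: "'a ugraph \<Rightarrow> nat"
    assume "i \<noteq> j"
    let ?S = "{v \<in> verts G. col v = i \<or> col v = j}"
    show "acyclic_graph (induce G ?S)"
    proof (cases "edges (induce G ?S) = {}")
      case True
      then show ?thesis by (rule acyclic_graph_no_edges)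
    next
      case False
      then obtain e where "e \<in> edges G" "e \<subseteq> ?S" by auto
      moreover obtain u v where "e = {u, v}"
        using simple_graph_edgeE[OF assms \<open>e \<in> edges G\<close>] by metis
      ultimately have uv: "{u, v} \<in> edges G" "u \<in> ?S" "v \<in> ?S" by auto
      then obtain F where F: "F \<in> \<F>" "u \<in> verts F" "v \<in> verts F" "c F u \<noteq> c F v"
        using cover by blast
      then have "col u \<noteq> col v" by (auto simp: col_def fun_eq_iff)
      \<comment> \<open>Both colour vectors have an entry below 2 at \<open>F\<close>, so their
        whole classes lie in \<open>F\<close>.\<close>
      then have "?S \<subseteq> verts F" using uv F by (auto simp: in_F)
      then show ?thesis
        using sf(4)[OF F(1)] by (intro acyclic_graph_mono[OF sf(2)[OF F(1)]]) auto
    qed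
  qed fact
  then show ?thesis using \<F>(1,2) by (simp add: card_PiE)
qed

lemma strong_induced_arboricity_one_le:
  assumes "simple_graph G" "acyclic_coloring G c col"
  shows "strong_induced_arboricity 1 G \<le> c choose 2"
proof -
  let ?P = "{e. e \<subseteq> {..<c} \<and> card e = 2}"
  \<comment> \<open>The neighbour demanded here lies in \<open>S e\<close> again, with
    \<open>v\<close> as its own witness, so every component has an edge.\<close>
  define S where "S e = {v \<in> verts G. col v \<in> e \<and> (\<exists>w \<in> verts G. col w \<in> e \<and> {v, w} \<in> edges G)}" for e
  have "strong_induced_arboricity 1 G \<le> card ((\<lambda>e. induce G (S e)) ` ?P)"
  proof (rule strong_induced_arboricity_le)
    fix F assume "F \<in> (\<lambda>e. induce G (S e)) ` ?P"
    then obtain i j where ij: "i < c" "j < c" "i \<noteq> j" "F = induce G (S {i, j})"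
      by (auto simp: card_2_iff)
    have "acyclic_graph (induce G {v \<in> verts G. col v = i \<or> col v = j})"
      using assms(2) ij by (auto simp: acyclic_coloring_def)
    then have ac: "acyclic_graph (induce G (S {i, j}))"
      by (rule acyclic_graph_mono) (auto simp: S_def)
    have "\<exists>c X. joined (induce G (S {i, j})) v c \<and> X \<subseteq> S {i, j} \<and> 1 \<le> card X \<and>
       (\<forall>x \<in> X. {c, x} \<in> edges G)" if v: "v \<in> S {i, j}" for v
    proof -
      obtain w where w: "w \<in> S {i, j}" "{v, w} \<in> edges G"
        using v by (auto simp: S_def insert_commute)
      then show ?thesis using v
        by (intro exI[of _ v] exI[of _ "{w}"]) (auto simp: joined_refl)
    qed
    then show "strong_forest 1 F G"
      unfolding ij(4) by (intro strong_forestI[OF assms(1) _ ac]) (auto simp: S_def)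
  next
    fix e assume "valid_edge 1 G e"
    then have "e \<in> edges G" by (simp add: valid_edge_def)
    then obtain u v where e: "e = {u, v}" "{u, v} \<in> edges G" "u \<in> verts G" "v \<in> verts G"
      using simple_graph_edgeE[OF assms(1)] by metis
    then have "col u \<noteq> col v" "col u < c" "col v < c"
      using assms(2) unfolding acyclic_coloring_def by auto
    then have "{col u, col v} \<in> ?P" "e \<in> edges (induce G (S {col u, col v}))"
      using e by (auto simp: S_def insert_commute)
    then show "\<exists>F\<in>(\<lambda>e. induce G (S e)) ` ?P. e \<in> edges F" by blast
  qed auto
  also have "\<dots> \<le> card ?P" by (rule card_image_le) auto
  also have "\<dots> = c choose 2" by (simp add: n_subsets)
  finally show ?thesis .
qed

lemma arboricity_acyclic_chromatic_number:
  assumes "simple_graph G"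
  shows "log 3 (real (acyclic_chromatic_number G)) \<le> real (strong_induced_arboricity 1 G)"
    and "strong_induced_arboricity 1 G \<le> acyclic_chromatic_number G choose 2"
proof -
  show "log 3 (real (acyclic_chromatic_number G)) \<le> real (strong_induced_arboricity 1 G)"
  proof (cases "acyclic_chromatic_number G = 0")
    case False
    have "real (acyclic_chromatic_number G) \<le> 3 ^ strong_induced_arboricity 1 G"
      using acyclic_chromatic_number_le_pow[OF assms] by (metis of_nat_le_iff of_nat_numeral of_nat_power)
    then show ?thesis using False by (intro log_of_power_le) auto
  \<comment> \<open>The number is 0 only for the graph without vertices, where
    \<open>log 3 0\<close> evaluates to 0.\<close>
  qed (simp add: log_def)
  show "strong_induced_arboricity 1 G \<le> acyclic_chromatic_number G choose 2"
    using ex_acyclic_coloring[OF assms] strong_induced_arboricity_one_le[OF assms] by blast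
qed

section \<open>Coded vertices, arcs and star-shaped witnesses\<close>

section \<open>Graphs given by arcs on coded vertices\<close>

text \<open>With ordered pairs a construction is a union of set comprehensions, and an arc inspected
  by cases delivers its ends in a known order.\<close>

definition arc_graph :: "'a set \<Rightarrow> ('a \<times> 'a) set \<Rightarrow> 'a ugraph" where
  "arc_graph V A = Graph V ((\<lambda>(x, y). {x, y}) ` A)"

lemma verts_arc_graph [simp]: "verts (arc_graph V A) = V"
  by (simp add: arc_graph_def)

lemma edge_arc_graph_iff: "{x, y} \<in> edges (arc_graph V A) \<longleftrightarrow> (x, y) \<in> A \<or> (y, x) \<in> A"
  by (auto simp: arc_graph_def image_iff doubleton_eq_iff)

lemma arc_graph_edgeE:
  assumes "e \<in> edges (arc_graph V A)"
  obtains x y where "e = {x, y}" "(x, y) \<in> A"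
  using assms by (auto simp: arc_graph_def)

lemma simple_arc_graph:
  assumes "finite V" "A \<subseteq> V \<times> V" "\<And>x. (x, x) \<notin> A"
  shows "simple_graph (arc_graph V A)"
  using assms unfolding simple_graph_def arc_graph_def by (auto simp: card_insert_if)

lemma acyclic_induce_arc_graph:
  fixes h :: "'a \<Rightarrow> nat"
  assumes "\<And>x y. (x, y) \<in> A \<Longrightarrow> x \<in> S \<Longrightarrow> y \<in> S \<Longrightarrow>
    (par x = y \<and> h y < h x) \<or> (par y = x \<and> h x < h y)"
  shows "acyclic_graph (induce (arc_graph V A) S)"
proof (rule acyclic_graph_parent)
  fix e assume "e \<in> edges (induce (arc_graph V A) S)"
  then obtain x y where "e = {x, y}" "(x, y) \<in> A" "x \<in> S" "y \<in> S"
    by (auto elim: arc_graph_edgeE)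
  then show "\<exists>x. e = {x, par x} \<and> h (par x) < h x"
    using assms[of x y] by (auto simp: insert_commute)
qed

text \<open>A vertex is coded by a list whose head is a tag for the kind of vertex and whose tail holds the
  indices. Arcs mostly point towards the vertex that serves as parent in the forests.\<close>

definition node :: "nat list \<Rightarrow> nat" where
  "node xs = list_encode xs"

definition unnode :: "nat \<Rightarrow> nat list" where
  "unnode v = list_decode v"

lemma node_eq [simp]: "node xs = node ys \<longleftrightarrow> xs = ys"
  by (simp add: node_def list_encode_eq)

lemma unnode_node [simp]: "unnode (node xs) = xs"
  by (simp add: node_def unnode_def)

lemma strong_forest_star:
  assumes "simple_graph G" "c \<in> verts G"
    and X: "\<And>x. x \<in> X \<Longrightarrow> {c, x} \<in> edges G"
    and indep: "\<And>x y. x \<in> X \<Longrightarrow> y \<in> X \<Longrightarrow> {x, y} \<notin> edges G"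
    and "k \<le> card X"
  shows "strong_forest k (induce G (insert c X)) G"
proof (rule strong_forestI[OF assms(1)])
  note sD = simple_graph_edgeD[OF assms(1)]
  show sub: "insert c X \<subseteq> verts G" using assms(2) sD(2) X by auto
  show "acyclic_graph (induce G (insert c X))"
  proof (rule acyclic_graph_parent[of _ "\<lambda>_. c" "\<lambda>v. if v = c then 0 else 1"])
    fix e assume "e \<in> edges (induce G (insert c X))"
    then have "e \<in> edges G" "e \<subseteq> insert c X" by auto
    moreover obtain x y where "e = {x, y}" "x \<noteq> y"
      using simple_graph_edgeE[OF assms(1) \<open>e \<in> edges G\<close>] by metis
    ultimately show "\<exists>x. e = {x, c} \<and> (if c = c then 0 else 1) < (if x = c then 0 else 1 :: nat)"
      using indep[of x y] by (cases "x = c") (auto intro: exI[of _ x] exI[of _ y])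
  qed
  fix v assume "v \<in> insert c X"
  then have "joined (induce G (insert c X)) v c"
    using X by (auto intro!: joined_refl joined_sym[OF joined_edge[of c v]])
  then show "\<exists>c' Y. joined (induce G (insert c X)) v c' \<and> Y \<subseteq> insert c X \<and> k \<le> card Y \<and>
      (\<forall>x\<in>Y. {c', x} \<in> edges G)"
    using X assms(5) by blast
qed

section \<open>Items (a) and (b): subdivided cliques\<close>

section \<open>Subdivided cliques\<close>

text \<open>The square splits into the increasing pairs, their mirror images and the diagonal. The
  additive form avoids halving and subtraction.\<close>

lemma card_ordered_pairs:
  fixes M :: "nat set"
  assumes "finite M"
  shows "2 * card {(i, j). i \<in> M \<and> j \<in> M \<and> i < j} + card M = card M * card M"
proof -
  let ?P = "{(i, j). i \<in> M \<and> j \<in> M \<and> i < j}"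
  have fin: "finite ?P" by (rule finite_subset[of _ "M \<times> M"]) (auto simp: assms)
  have "M \<times> M = (?P \<union> prod.swap ` ?P) \<union> (\<lambda>i. (i, i)) ` M"
    by (auto simp: image_iff)
  then have "card (M \<times> M) = card ((?P \<union> prod.swap ` ?P) \<union> (\<lambda>i. (i, i)) ` M)" by simp
  also have "\<dots> = card (?P \<union> prod.swap ` ?P) + card ((\<lambda>i. (i, i)) ` M)"
    using fin assms by (intro card_Un_disjoint) auto
  also have "card (?P \<union> prod.swap ` ?P) = card ?P + card (prod.swap ` ?P)"
    using fin by (intro card_Un_disjoint) auto
  also have "card (prod.swap ` ?P) = card ?P" by (intro card_image) auto
  also have "card ((\<lambda>i. (i, i)) ` M) = card M" by (intro card_image) (auto simp: inj_on_def)
  finally show ?thesis by (simp add: card_cartesian_product)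
qed

text \<open>Branch vertices \<open>b i\<close> are joined by paths with \<open>p\<close> inner vertices \<open>I i j\<close> and edges \<open>D i j\<close>.
  If two branch vertices lie in the same forests, then any forest containing \<open>e i j\<close> contains the
  whole path between them; hence among the vertices of a common type each forest realises a forest.\<close>

lemma subdivided_clique_bound:
  fixes b :: "nat \<Rightarrow> 'a" and m k p :: nat
  assumes G: "simple_graph G"
    and valid: "\<And>i j. i < j \<Longrightarrow> j < m \<Longrightarrow> valid_edge k G (e i j)"
    and branch: "\<And>i j F. i < j \<Longrightarrow> j < m \<Longrightarrow> strong_forest k F G \<Longrightarrow> e i j \<in> edges F \<Longrightarrow>
      b i \<in> verts F \<or> b j \<in> verts F"
    and path: "\<And>i j F. i < j \<Longrightarrow> j < m \<Longrightarrow> strong_forest k F G \<Longrightarrow> e i j \<in> edges F \<Longrightarrow>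
      b i \<in> verts F \<Longrightarrow> b j \<in> verts F \<Longrightarrow> I i j \<subseteq> verts F"
    and I: "\<And>i j. i < j \<Longrightarrow> j < m \<Longrightarrow> finite (I i j) \<and> card (I i j) \<le> p"
    and D: "\<And>i j. i < j \<Longrightarrow> j < m \<Longrightarrow> D i j \<subseteq> edges G \<and> card (D i j) = p + 1"
    and DI: "\<And>i j d. i < j \<Longrightarrow> j < m \<Longrightarrow> d \<in> D i j \<Longrightarrow> d \<subseteq> insert (b i) (insert (b j) (I i j))"
    and disj: "\<And>i j i' j'. i < j \<Longrightarrow> j < m \<Longrightarrow> i' < j' \<Longrightarrow> j' < m \<Longrightarrow> (i, j) \<noteq> (i', j') \<Longrightarrow>
      D i j \<inter> D i' j' = {}"
  shows "m \<le> 2 ^ strong_induced_arboricity k G * (2 * strong_induced_arboricity k G + 1)"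
proof -
  obtain \<F> where \<F>: "finite \<F>" "card \<F> = strong_induced_arboricity k G"
    "\<And>F. F \<in> \<F> \<Longrightarrow> strong_forest k F G" "\<And>e. valid_edge k G e \<Longrightarrow> \<exists>F \<in> \<F>. e \<in> edges F"
    using strong_induced_arboricity_attained[OF G] by blast
  define sig where "sig i = {F \<in> \<F>. b i \<in> verts F}" for i
  \<comment> \<open>It remains to bound one type; summing over the subsets of \<open>\<F>\<close>
    gives the factor \<open>2 ^ f\<close>.\<close>
  have fibre: "card {i. i < m \<and> sig i = s} \<le> 2 * card \<F> + 1" for s
  proof -
    define M where "M = {i. i < m \<and> sig i = s}"
    have finM: "finite M" by (simp add: M_def)
    define P where "P = {(i, j). i \<in> M \<and> j \<in> M \<and> i < j}"
    have finP: "finite P" by (rule finite_subset[of _ "M \<times> M"]) (auto simp: finM P_def)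
    define Q where "Q F = {(i, j) \<in> P. e i j \<in> edges F}" for F
    have QP: "i < j" "j < m" "i \<in> M" "j \<in> M" if "(i, j) \<in> Q F" for i j F
      using that by (auto simp: Q_def P_def M_def)
    have finQ: "finite (Q F)" for F using finP by (auto simp: Q_def intro: finite_subset)
    have Qle: "card (Q F) \<le> card M" if F: "F \<in> \<F>" for F
    proof (cases "Q F = {}")
      case False
      note sF = strong_forestD[OF \<F>(3)[OF F] G]
      define S where "S = b ` M \<union> (\<Union>(i, j) \<in> Q F. I i j)"
      have IF: "I i j \<subseteq> verts F" "b i \<in> verts F" "b j \<in> verts F" if "(i, j) \<in> Q F" for i j
      proof -
        have ij: "i < j" "j < m" "e i j \<in> edges F" "sig i = s" "sig j = s"
          using that by (auto simp: Q_def P_def M_def)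
        \<comment> \<open>One end of the path lies in \<open>F\<close>; the other end has the same
          type and hence lies in \<open>F\<close> too.\<close>
        from branch[OF ij(1,2) \<F>(3)[OF F] ij(3)] have "F \<in> s" using F ij by (auto simp: sig_def)
        then show "b i \<in> verts F" "b j \<in> verts F" using ij by (auto simp: sig_def)
        then show "I i j \<subseteq> verts F" using path[OF ij(1,2) \<F>(3)[OF F] ij(3)] by simp
      qed
      have bM: "b i \<in> verts F" if "i \<in> M" for i
      proof -
        obtain i' j' where q: "(i', j') \<in> Q F" using False by auto
        then have "sig i' = sig i" using that QP(3)[OF q] by (simp add: M_def)
        then show ?thesis using IF(2)[OF q] F by (auto simp: sig_def)
      qed
      have S: "S \<subseteq> verts F" using IF bM by (auto simp: S_def)
      have "S \<noteq> {}" using False QP by (force simp: S_def)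
      then have lt: "card (edges (induce F S)) < card (verts (induce F S))"
        using S acyclic_graph_mono[OF sF(2)]
        by (intro acyclic_graph_card_edges simple_graph_induce sF(1)) auto
      have "card (\<Union>(i, j) \<in> Q F. D i j) \<le> card (edges (induce F S))"
      proof (rule card_mono)
        show "finite (edges (induce F S))" using finite_edges[OF sF(1)] by simp
        have "d \<in> edges F \<and> d \<subseteq> S" if q: "(i, j) \<in> Q F" and d: "d \<in> D i j" for i j d
        proof -
          have "d \<subseteq> S" using DI[OF QP(1,2)[OF q] d] QP(3,4)[OF q] q by (auto simp: S_def)
          then show ?thesis using S D[OF QP(1,2)[OF q]] d sF(4) by auto
        qed
        then show "(\<Union>(i, j) \<in> Q F. D i j) \<subseteq> edges (induce F S)" by auto
      qed
      moreover have "card (\<Union>(i, j) \<in> Q F. D i j) = (\<Sum>(i, j) \<in> Q F. card (D i j))"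
      proof -
        have "finite (D i j)" if "(i, j) \<in> Q F" for i j
          using D[OF QP(1,2)[OF that]] finite_edges[OF G] finite_subset by blast
        moreover have "D i j \<inter> D i' j' = {}" if "(i, j) \<in> Q F" "(i', j') \<in> Q F" "(i, j) \<noteq> (i', j')" for i j i' j'
          using disj[OF QP(1,2)[OF that(1)] QP(1,2)[OF that(2)] that(3)] .
        ultimately show ?thesis
          by (subst card_UN_disjoint[OF finQ]) (simp_all add: split_def prod_eq_iff)
      qed
      moreover have "\<dots> = card (Q F) * (p + 1)"
        using D QP by (subst sum.cong[OF refl, where h = "\<lambda>_. p + 1"]) auto
      moreover have "card S \<le> card M + card (Q F) * p"
      proof -
        have "card (\<Union>(i, j) \<in> Q F. I i j) \<le> (\<Sum>(i, j) \<in> Q F. card (I i j))"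
          using card_UN_le[OF finQ, of "\<lambda>(i, j). I i j"] by (simp add: split_def)
        also have "\<dots> \<le> card (Q F) * p"
          using sum_bounded_above[of "Q F" "\<lambda>(i, j). card (I i j)" p] I QP by auto
        finally show ?thesis
          unfolding S_def using card_Un_le[of "b ` M" "\<Union>(i, j) \<in> Q F. I i j"] card_image_le[OF finM, of b]
          by linarith
      qed
      \<comment> \<open>With \<open>q\<close> realised pairs there are \<open>q * (p + 1)\<close>
        edges on at most \<open>card M + q * p\<close> vertices, hence
        \<open>q < card M\<close>.\<close>
      ultimately show ?thesis using lt by simp
    qed simp
    have "P \<subseteq> (\<Union>F \<in> \<F>. Q F)"
      using \<F>(4)[OF valid] by (fastforce simp: P_def Q_def M_def)
    then have "card P \<le> card (\<Union>F \<in> \<F>. Q F)" using finQ \<F>(1) by (intro card_mono) auto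
    also have "\<dots> \<le> (\<Sum>F \<in> \<F>. card (Q F))" by (rule card_UN_le[OF \<F>(1)])
    also have "\<dots> \<le> card \<F> * card M" using sum_bounded_above[of \<F> "\<lambda>F. card (Q F)" "card M"] Qle by simp
    finally have "card M * card M \<le> 2 * (card \<F> * card M) + card M"
      using card_ordered_pairs[OF finM] unfolding P_def by linarith
    then have "card M * card M \<le> (2 * card \<F> + 1) * card M" by (simp add: algebra_simps)
    moreover have "(2 * card \<F> + 1) * card M < card M * card M" if "2 * card \<F> + 1 < card M"
      using that by (intro mult_strict_right_mono) auto
    ultimately show ?thesis unfolding M_def[symmetric] by linarith
  qed
  have sig: "sig i \<in> Pow \<F>" for i by (auto simp: sig_def)
  have "m = card {..<m}" by simp
  also have "\<dots> = card (\<Union>s \<in> Pow \<F>. {i. i < m \<and> sig i = s})"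
    using sig by (intro arg_cong[of _ _ card]) blast
  also have "\<dots> \<le> (\<Sum>s \<in> Pow \<F>. card {i. i < m \<and> sig i = s})" using \<F>(1) by (intro card_UN_le) simp
  also have "\<dots> \<le> card (Pow \<F>) * (2 * card \<F> + 1)"
    using sum_bounded_above[of "Pow \<F>" "\<lambda>s. card {i. i < m \<and> sig i = s}" "2 * card \<F> + 1"] fibre by simp
  finally show ?thesis using \<F>(1,2) by (simp add: card_Pow)
qed

lemma less_of_exp_bound:
  fixes m n f :: nat
  assumes "m \<le> 2 ^ f * (2 * f + 1)" "2 ^ n * (2 * n + 1) < m"
  shows "n < f"
proof (rule ccontr)
  assume "\<not> n < f"
  then have "(2::nat) ^ f * (2 * f + 1) \<le> 2 ^ n * (2 * n + 1)"
    by (intro mult_mono power_increasing) auto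
  then show False using assms by simp
qed

lemma edge_arboricity_eq_2:
  assumes "simple_graph G" "vcycle G p"
    and forests: "subgraph F1 G" "acyclic_graph F1" "subgraph F2 G" "acyclic_graph F2"
    and cover: "edges G \<subseteq> edges F1 \<union> edges F2"
  shows "edge_arboricity G = 2"
proof -
  let ?P = "\<lambda>n. \<exists>\<F>. finite \<F> \<and> card \<F> = n \<and>
        (\<forall>F \<in> \<F>. subgraph F G \<and> acyclic_graph F) \<and> edges G \<subseteq> (\<Union>F \<in> \<F>. edges F)"
  have P: "?P (card {F1, F2})" using forests cover by (intro exI[of _ "{F1, F2}"]) auto
  have "edge_arboricity G \<le> card {F1, F2}"
    unfolding edge_arboricity_def by (rule Least_le[where P = ?P, OF P])
  then have le: "edge_arboricity G \<le> 2" by (cases "F1 = F2") auto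
  have "?P (edge_arboricity G)" unfolding edge_arboricity_def by (rule LeastI[where P = ?P, OF P])
  then obtain \<F> where \<F>: "finite \<F>" "card \<F> = edge_arboricity G"
    "\<And>F. F \<in> \<F> \<Longrightarrow> subgraph F G \<and> acyclic_graph F" "edges G \<subseteq> (\<Union>F \<in> \<F>. edges F)" by blast
  have "\<not> edge_arboricity G < 2"
  proof
    assume "edge_arboricity G < 2"
    then have "card \<F> \<le> 1" using \<F>(2) by simp
    moreover have "\<F> \<noteq> {}"
    proof
      assume "\<F> = {}"
      then have "edges G = {}" using \<F>(4) by simp
      then show False using assms(2) by (auto simp: vcycle_def)
    qed
    ultimately obtain F where "\<F> = {F}"
      using \<F>(1) by (metis card_1_singletonE card_gt_0_iff le_antisym Suc_leI One_nat_def)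
    then have F: "subgraph F G" "acyclic_graph F" "edges G = edges F"
      using \<F>(3,4) by (auto simp: subgraph_def)
    \<comment> \<open>A covering subgraph may have fewer vertices than \<open>G\<close>; the
      vertices of the cycle are recovered from its edges.\<close>
    have "v \<in> verts F" if v: "v \<in> set p" for v
    proof -
      obtain x where "{v, x} \<in> edges G" using vcycle_neighbours[OF assms(2) v] by blast
      then show ?thesis using F simple_graph_edgeD(1)[of F v x] by (simp add: subgraph_def)
    qed
    then have "vcycle F p" using assms(2) F(3) by (auto simp: vcycle_iff_nth)
    then show False using F(2) by (auto simp: acyclic_graph_def)
  qed
  then show ?thesis using le by simp
qed

text \<open>Disjoint stars with centres \<open>R\<close>: every other vertex hangs on exactly one
  centre, and \<open>k\<close> rays at each centre make the components large enough.\<close>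

lemma strong_forest_depth_one:
  fixes V :: "'a set"
  assumes G: "simple_graph (arc_graph V A)" and sub: "S \<subseteq> V" "R \<subseteq> S"
    and arcs: "\<And>x y. (x, y) \<in> A \<Longrightarrow> x \<in> S \<Longrightarrow> y \<in> S \<Longrightarrow> x \<notin> R \<and> y \<in> R \<and> par x = y"
    and par: "\<And>v. v \<in> S \<Longrightarrow> v \<notin> R \<Longrightarrow> par v \<in> R \<and> (v, par v) \<in> A"
    and star: "\<And>r. r \<in> R \<Longrightarrow> \<exists>X. X \<subseteq> S \<and> k \<le> card X \<and> (\<forall>x \<in> X. (x, r) \<in> A)"
  shows "strong_forest k (induce (arc_graph V A) S) (arc_graph V A)"
proof (rule strong_forestI[OF G])
  let ?G = "arc_graph V A"
  show "S \<subseteq> verts ?G" using sub(1) by simp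
  show "acyclic_graph (induce ?G S)"
    by (rule acyclic_induce_arc_graph[where par = par and h = "\<lambda>v. if v \<in> R then 0 else 1"])
      (use arcs in auto)
  fix v assume v: "v \<in> S"
  obtain r where r: "r \<in> R" "joined (induce ?G S) v r"
  proof (cases "v \<in> R")
    case True
    then show ?thesis using that[of v] v by (simp add: joined_refl)
  next
    case False
    with par[OF v] v sub(2) have "joined (induce ?G S) v (par v)"
      by (intro joined_edge) (auto simp: edge_arc_graph_iff)
    with False show ?thesis using that[of "par v"] par[OF v] by blast
  qed
  obtain X where "X \<subseteq> S" "k \<le> card X" "\<And>x. x \<in> X \<Longrightarrow> (x, r) \<in> A" using star[OF r(1)] by blast
  then show "\<exists>c X. joined (induce ?G S) v c \<and> X \<subseteq> S \<and> k \<le> card X \<and> (\<forall>x\<in>X. {c, x} \<in> edges ?G)"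
    using r(2) by (intro exI[of _ r] exI[of _ X]) (auto simp: edge_arc_graph_iff)
qed

subsection \<open>One subdivision vertex per edge\<close>

text \<open>Tag 0 marks branch vertices, tag 1 subdivision vertices and tag 2 pendant vertices,
  \<open>k\<close> at each branch vertex so that every edge at it is \<open>k\<close>-valid.\<close>

definition sub1_arcs :: "nat \<Rightarrow> nat \<Rightarrow> (nat \<times> nat) set" where
  "sub1_arcs m k =
     {(node [1, i, j], node [0, i]) |i j. i < j \<and> j < m} \<union>
     {(node [1, i, j], node [0, j]) |i j. i < j \<and> j < m} \<union>
     {(node [2, i, l], node [0, i]) |i l. i < m \<and> l < k}"

definition sub1_verts :: "nat \<Rightarrow> nat \<Rightarrow> nat set" where
  "sub1_verts m k = (\<lambda>i. node [0, i]) ` {..<m} \<union>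
     (\<lambda>(i, j). node [1, i, j]) ` {(i, j). i < j \<and> j < m} \<union>
     (\<lambda>(i, l). node [2, i, l]) ` ({..<m} \<times> {..<k})"

abbreviation sub1_graph :: "nat \<Rightarrow> nat \<Rightarrow> nat ugraph" where
  "sub1_graph m k \<equiv> arc_graph (sub1_verts m k) (sub1_arcs m k)"

lemma finite_ordered_pairs: "finite {(i, j). i < j \<and> j < (m :: nat)}"
  by (rule finite_subset[of _ "{..<m} \<times> {..<m}"]) auto

lemma simple_sub1: "simple_graph (sub1_graph m k)"
  by (rule simple_arc_graph) (auto simp: sub1_verts_def sub1_arcs_def finite_ordered_pairs image_iff)

lemma sub1_arboricity:
  assumes "3 \<le> m"
  shows "edge_arboricity (sub1_graph m k) = 2"
proof -
  let ?G = "sub1_graph m k"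
  \<comment> \<open>Entries 1 and 2 of a tag 1 code are its two branch indices. So \<open>a\<close>
    selects the end to which all subdivision vertices point, and the two choices together cover all
    edges.\<close>
  define par where "par a v = (if hd (unnode v) = 1 then node [0, unnode v ! a] else node [0, unnode v ! 1])" for a v
  define E where "E a = {e \<in> edges ?G. \<exists>x. hd (unnode x) \<noteq> 0 \<and> e = {x, par a x}}" for a
  let ?F = "\<lambda>a. Graph (verts ?G) (E a)"
  have sub: "subgraph (?F a) ?G" for a
    using simple_sub1[of m k] unfolding subgraph_def E_def simple_graph_def by auto
  have ac: "acyclic_graph (?F a)" for a
    by (rule acyclic_graph_parent[of _ "par a" "\<lambda>v. if hd (unnode v) = 0 then 0 else 1"])
      (auto simp: E_def par_def)
  have cover: "edges ?G \<subseteq> edges (?F 1) \<union> edges (?F 2)"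
  proof
    fix e assume e: "e \<in> edges ?G"
    then obtain x y where xy: "e = {x, y}" "(x, y) \<in> sub1_arcs m k" by (rule arc_graph_edgeE)
    then have "hd (unnode x) \<noteq> 0 \<and> (y = par 1 x \<or> y = par 2 x)"
      by (auto simp: sub1_arcs_def par_def)
    then show "e \<in> edges (?F 1) \<union> edges (?F 2)" using xy e by (auto simp: E_def)
  qed
  \<comment> \<open>The subdivided triangle on the first three branch vertices.\<close>
  have cyc: "vcycle ?G [node [0, 0], node [1, 0, 1], node [0, 1], node [1, 1, 2], node [0, 2], node [1, 0, 2]]"
    using assms unfolding vcycle_def vpath_def walk_def
    by (auto simp: edge_arc_graph_iff sub1_arcs_def sub1_verts_def image_iff)
  show ?thesis
    by (rule edge_arboricity_eq_2[OF simple_sub1 cyc sub ac sub ac cover])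
qed

text \<open>The edge \<open>e i j\<close> contains a branch vertex and the only inner vertex, so a
  forest with this edge and both branch vertices has the whole path.\<close>

lemma sub1_strong_arboricity:
  "m \<le> 2 ^ strong_induced_arboricity k (sub1_graph m k) * (2 * strong_induced_arboricity k (sub1_graph m k) + 1)"
proof (rule subdivided_clique_bound[where b = "\<lambda>i. node [0, i]" and e = "\<lambda>i j. {node [1, i, j], node [0, i]}"
      and I = "\<lambda>i j. {node [1, i, j]}" and p = 1
      and D = "\<lambda>i j. {{node [1, i, j], node [0, i]}, {node [1, i, j], node [0, j]}}"])
  let ?G = "sub1_graph m k"
  fix i j :: nat assume ij: "i < j" "j < m"
  show "valid_edge k ?G {node [1, i, j], node [0, i]}"
  proof (rule valid_edgeI)
    let ?X = "insert (node [1, i, j]) ((\<lambda>l. node [2, i, l]) ` {..<k})"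
    have "card ?X = Suc k" by (subst card_insert_disjoint) (auto simp: card_image inj_on_def)
    then show "strong_forest k (induce ?G (insert (node [0, i]) ?X)) ?G"
      using ij
      by (intro strong_forest_star simple_sub1)
        (auto simp: edge_arc_graph_iff sub1_arcs_def sub1_verts_def)
  qed (use ij in \<open>auto simp: edge_arc_graph_iff sub1_arcs_def\<close>)
  fix F assume F: "strong_forest k F ?G" "{node [1, i, j], node [0, i]} \<in> edges F"
  note sF = strong_forestD[OF F(1) simple_sub1]
  show "node [0, i] \<in> verts F \<or> node [0, j] \<in> verts F" using simple_graph_edgeD[OF sF(1) F(2)] by simp
  show "{node [1, i, j]} \<subseteq> verts F" using simple_graph_edgeD[OF sF(1) F(2)] by simp
next
  show "simple_graph (sub1_graph m k)" by (rule simple_sub1)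
qed (auto simp: edge_arc_graph_iff sub1_arcs_def doubleton_eq_iff card_insert_if)

lemma ex_edge_arboricity_2:
  "\<exists>G :: nat ugraph. simple_graph G \<and> edge_arboricity G = 2 \<and> strong_induced_arboricity k G \<ge> n"
proof -
  \<comment> \<open>The first summand is the bound on \<open>m\<close> for \<open>n\<close> forests;
    the 3 exceeds it and provides the branch vertices of the cycle.\<close>
  let ?m = "2 ^ n * (2 * n + 1) + 3"
  have "n < strong_induced_arboricity k (sub1_graph ?m k)"
    by (rule less_of_exp_bound[OF sub1_strong_arboricity]) simp
  then show ?thesis using simple_sub1 sub1_arboricity[of ?m k] by (intro exI[of _ "sub1_graph ?m k"]) auto
qed

subsection \<open>Two subdivision vertices per edge\<close>

text \<open>Tags 1 and 2 are the inner vertices next to \<open>i\<close> and to \<open>j\<close>,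
  tag 3 the pendant vertices at branch vertices, tag 4 those at tag 1 vertices. With
  \<open>k - 1\<close> of the latter, a tag 1 vertex and its inner neighbour span a star with
  exactly \<open>k\<close> edges: enough for a \<open>k\<close>-strong forest, one too few for
  \<open>k + 1\<close>.\<close>

definition sub2_arcs :: "nat \<Rightarrow> nat \<Rightarrow> (nat \<times> nat) set" where
  "sub2_arcs m k =
     {(node [1, i, j], node [0, i]) |i j. i < j \<and> j < m} \<union>
     {(node [2, i, j], node [0, j]) |i j. i < j \<and> j < m} \<union>
     {(node [2, i, j], node [1, i, j]) |i j. i < j \<and> j < m} \<union>
     {(node [3, i, l], node [0, i]) |i l. i < m \<and> l < k} \<union>
     {(node [4, i, j, l], node [1, i, j]) |i j l. i < j \<and> j < m \<and> l < k - 1}"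

definition sub2_verts :: "nat \<Rightarrow> nat \<Rightarrow> nat set" where
  "sub2_verts m k = (\<lambda>i. node [0, i]) ` {..<m} \<union>
     (\<lambda>(i, j). node [1, i, j]) ` {(i, j). i < j \<and> j < m} \<union>
     (\<lambda>(i, j). node [2, i, j]) ` {(i, j). i < j \<and> j < m} \<union>
     (\<lambda>(i, l). node [3, i, l]) ` ({..<m} \<times> {..<k}) \<union>
     (\<lambda>(i, j, l). node [4, i, j, l]) ` {(i, j, l). i < j \<and> j < m \<and> l < k - 1}"

abbreviation sub2_graph :: "nat \<Rightarrow> nat \<Rightarrow> nat ugraph" where
  "sub2_graph m k \<equiv> arc_graph (sub2_verts m k) (sub2_arcs m k)"

lemma simple_sub2: "simple_graph (sub2_graph m k)"
proof (rule simple_arc_graph)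
  have "finite {(i, j, l). i < j \<and> j < m \<and> l < k - 1}"
    by (rule finite_subset[of _ "{..<m} \<times> {..<m} \<times> {..<k - 1}"]) auto
  then show "finite (sub2_verts m k)" by (simp add: sub2_verts_def finite_ordered_pairs)
qed (auto simp: sub2_verts_def sub2_arcs_def image_iff)

lemma sub2_strong_arboricity_le:
  assumes "k \<ge> 1"
  shows "strong_induced_arboricity k (sub2_graph m k) \<le> 3"
proof -
  let ?S = "\<lambda>T. {v \<in> sub2_verts m k. hd (unnode v) \<in> T}"
  let ?F = "\<lambda>T. induce (sub2_graph m k) (?S T)"
  \<comment> \<open>Each tag set induces disjoint stars, centred at the branch vertices for the
    first two and at the tag 1 vertices for the third; every kind of arc occurs in one of
    them.\<close>
  let ?T = "{{0, 1, 3}, {0, 2, 3}, {1, 2, 4}} :: nat set set"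
  note defs = sub2_verts_def sub2_arcs_def
  have pendant: "\<exists>X. X \<subseteq> ?S T \<and> k \<le> card X \<and> (\<forall>x \<in> X. (x, r) \<in> sub2_arcs m k)"
    if r: "r \<in> ?S {0}" and T: "3 \<in> T" for r T
  proof -
    obtain i where i: "r = node [0, i]" "i < m" using r by (auto simp: sub2_verts_def)
    have "card ((\<lambda>l. node [3, i, l]) ` {..<k}) = k" by (simp add: card_image inj_on_def)
    then show ?thesis using i T
      by (intro exI[of _ "(\<lambda>l. node [3, i, l]) ` {..<k}"]) (auto simp: defs)
  qed
  have F1: "strong_forest k (?F {0, 1, 3}) (sub2_graph m k)"
  proof (rule strong_forest_depth_one[OF simple_sub2, where R = "?S {0}" and par = "\<lambda>v. node [0, unnode v ! 1]"])
    show "\<exists>X. X \<subseteq> ?S {0, 1, 3} \<and> k \<le> card X \<and> (\<forall>x \<in> X. (x, r) \<in> sub2_arcs m k)"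
      if "r \<in> ?S {0}" for r by (rule pendant[OF that]) simp
    show "x \<notin> ?S {0} \<and> y \<in> ?S {0} \<and> node [0, unnode x ! 1] = y"
      if "(x, y) \<in> sub2_arcs m k" "x \<in> ?S {0, 1, 3}" "y \<in> ?S {0, 1, 3}" for x y
      using that by (auto simp: sub2_arcs_def)
    show "node [0, unnode v ! 1] \<in> ?S {0} \<and> (v, node [0, unnode v ! 1]) \<in> sub2_arcs m k"
      if "v \<in> ?S {0, 1, 3}" "v \<notin> ?S {0}" for v
      using that by (auto simp: defs)
  qed auto
  have F2: "strong_forest k (?F {0, 2, 3}) (sub2_graph m k)"
  proof (rule strong_forest_depth_one[OF simple_sub2, where R = "?S {0}" and
          par = "\<lambda>v. node [0, unnode v ! (if hd (unnode v) = 2 then 2 else 1)]"])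
    show "\<exists>X. X \<subseteq> ?S {0, 2, 3} \<and> k \<le> card X \<and> (\<forall>x \<in> X. (x, r) \<in> sub2_arcs m k)"
      if "r \<in> ?S {0}" for r by (rule pendant[OF that]) simp
    show "x \<notin> ?S {0} \<and> y \<in> ?S {0} \<and> node [0, unnode x ! (if hd (unnode x) = 2 then 2 else 1)] = y"
      if "(x, y) \<in> sub2_arcs m k" "x \<in> ?S {0, 2, 3}" "y \<in> ?S {0, 2, 3}" for x y
      using that by (auto simp: sub2_arcs_def)
    show "node [0, unnode v ! (if hd (unnode v) = 2 then 2 else 1)] \<in> ?S {0} \<and> (v, node [0, unnode v ! (if hd (unnode v) = 2 then 2 else 1)]) \<in> sub2_arcs m k"
      if "v \<in> ?S {0, 2, 3}" "v \<notin> ?S {0}" for v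
      using that by (auto simp: defs)
  qed auto
  have inner: "\<exists>X. X \<subseteq> ?S {1, 2, 4} \<and> k \<le> card X \<and> (\<forall>x \<in> X. (x, r) \<in> sub2_arcs m k)"
    if rS: "r \<in> ?S {1}" for r
  proof -
    obtain i j where r: "r = node [1, i, j]" "i < j" "j < m" using rS by (auto simp: sub2_verts_def)
    let ?X = "insert (node [2, i, j]) ((\<lambda>l. node [4, i, j, l]) ` {..<k - 1})"
    have "card ?X = Suc (k - 1)" by (subst card_insert_disjoint) (auto simp: card_image inj_on_def)
    then show ?thesis using r by (intro exI[of _ ?X]) (auto simp: defs image_iff)
  qed
  have F3: "strong_forest k (?F {1, 2, 4}) (sub2_graph m k)"
  proof (rule strong_forest_depth_one[OF simple_sub2, where R = "?S {1}" and
          par = "\<lambda>v. node [1, unnode v ! 1, unnode v ! 2]"])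
    show "\<exists>X. X \<subseteq> ?S {1, 2, 4} \<and> k \<le> card X \<and> (\<forall>x \<in> X. (x, r) \<in> sub2_arcs m k)"
      if "r \<in> ?S {1}" for r by (rule inner[OF that])
    show "x \<notin> ?S {1} \<and> y \<in> ?S {1} \<and> node [1, unnode x ! 1, unnode x ! 2] = y"
      if "(x, y) \<in> sub2_arcs m k" "x \<in> ?S {1, 2, 4}" "y \<in> ?S {1, 2, 4}" for x y
      using that by (auto simp: sub2_arcs_def)
    show "node [1, unnode v ! 1, unnode v ! 2] \<in> ?S {1} \<and> (v, node [1, unnode v ! 1, unnode v ! 2]) \<in> sub2_arcs m k"
      if "v \<in> ?S {1, 2, 4}" "v \<notin> ?S {1}" for v
      using that by (auto simp: defs)
  qed auto
  have "strong_induced_arboricity k (sub2_graph m k) \<le> card (?F ` ?T)"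
  proof (rule strong_induced_arboricity_le)
    show "strong_forest k F (sub2_graph m k)" if "F \<in> ?F ` ?T" for F
      using F1 F2 F3 that by blast
    fix e assume "valid_edge k (sub2_graph m k) e"
    then have e: "e \<in> edges (sub2_graph m k)" by (simp add: valid_edge_def)
    then obtain x y where xy: "e = {x, y}" "(x, y) \<in> sub2_arcs m k" by (rule arc_graph_edgeE)
    have V: "x \<in> sub2_verts m k" "y \<in> sub2_verts m k"
      using simple_graph_edgeD[OF simple_sub2, of x y m k] e xy by auto
    have "\<exists>T\<in>?T. hd (unnode x) \<in> T \<and> hd (unnode y) \<in> T"
      using xy(2) by (auto simp: sub2_arcs_def)
    then show "\<exists>F\<in>?F ` ?T. e \<in> edges F" using e xy V by auto
  qed auto
  also have "\<dots> \<le> card ?T" by (rule card_image_le) simp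
  also have "\<dots> \<le> 3" by (simp add: card_insert_if)
  finally show ?thesis .
qed

lemma sub2_strong_arboricity:
  assumes "k \<ge> 1"
  shows "m \<le> 2 ^ strong_induced_arboricity (k + 1) (sub2_graph m k) *
     (2 * strong_induced_arboricity (k + 1) (sub2_graph m k) + 1)"
proof (rule subdivided_clique_bound[where b = "\<lambda>i. node [0, i]" and e = "\<lambda>i j. {node [1, i, j], node [2, i, j]}"
      and I = "\<lambda>i j. {node [1, i, j], node [2, i, j]}" and p = 2
      and D = "\<lambda>i j. {{node [1, i, j], node [0, i]}, {node [1, i, j], node [2, i, j]}, {node [2, i, j], node [0, j]}}"])
  let ?G = "sub2_graph m k"
  fix i j :: nat assume ij: "i < j" "j < m"
  let ?Q = "(\<lambda>l. node [4, i, j, l]) ` {..<k - 1}"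
  have cardQ: "card ?Q = k - 1" by (simp add: card_image inj_on_def)
  show "valid_edge (k + 1) ?G {node [1, i, j], node [2, i, j]}"
  proof (rule valid_edgeI)
    \<comment> \<open>To the \<open>k - 1\<close> pendant vertices of the centre come the other
      inner vertex and the branch vertex.\<close>
    let ?X = "insert (node [0, i]) (insert (node [2, i, j]) ?Q)"
    have "card ?X = k + 1" using assms cardQ by (auto simp: card_insert_if)
    then show "strong_forest (k + 1) (induce ?G (insert (node [1, i, j]) ?X)) ?G"
      using ij
      by (intro strong_forest_star simple_sub2)
        (auto simp: edge_arc_graph_iff sub2_arcs_def sub2_verts_def)
  qed (use ij in \<open>auto simp: edge_arc_graph_iff sub2_arcs_def\<close>)
  fix F assume F: "strong_forest (k + 1) F ?G" "{node [1, i, j], node [2, i, j]} \<in> edges F"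
  note sF = strong_forestD[OF F(1) simple_sub2]
  show "{node [1, i, j], node [2, i, j]} \<subseteq> verts F" using simple_graph_edgeD[OF sF(1) F(2)] by simp
  show "node [0, i] \<in> verts F \<or> node [0, j] \<in> verts F"
  proof (rule ccontr)
    assume neg: "\<not> ?thesis"
    \<comment> \<open>With both branch vertices absent this set is closed in \<open>F\<close>, but
      it spans only a star with \<open>k\<close> edges.\<close>
    let ?W = "insert (node [1, i, j]) (insert (node [2, i, j]) ?Q)"
    have "k + 1 \<le> card {e \<in> edges F. e \<subseteq> ?W}"
      using neg simple_graph_edgeD[OF sF(1) F(2)]
      by (intro strong_forest_closed[OF F(1) simple_sub2, of "node [1, i, j]"])
        (auto simp: sF(4) edge_arc_graph_iff sub2_arcs_def)
    also have "\<dots> \<le> card ((\<lambda>x. {node [1, i, j], x}) ` insert (node [2, i, j]) ?Q)"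
    proof (rule card_mono)
      show "{e \<in> edges F. e \<subseteq> ?W} \<subseteq> (\<lambda>x. {node [1, i, j], x}) ` insert (node [2, i, j]) ?Q"
      proof
        fix e assume "e \<in> {e \<in> edges F. e \<subseteq> ?W}"
        then have "e \<in> edges ?G" "e \<subseteq> ?W" using sF(4) by auto
        moreover obtain x y where xy: "e = {x, y}" "(x, y) \<in> sub2_arcs m k"
          using \<open>e \<in> edges ?G\<close> by (rule arc_graph_edgeE)
        ultimately have W: "x \<in> ?W" "y \<in> ?W" by auto
        have W_tag: "hd (unnode z) \<in> {1, 2, 4} \<and> (hd (unnode z) = 1 \<longrightarrow> z = node [1, i, j])"
          if "z \<in> ?W" for z using that by auto
        have "hd (unnode y) = 1 \<and> hd (unnode x) \<noteq> 1"
          using W_tag[OF W(1)] W_tag[OF W(2)] xy(2) by (auto simp: sub2_arcs_def)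
        then have y: "y = node [1, i, j]" and "x \<noteq> node [1, i, j]" using W_tag[OF W(2)] by auto
        then have "x \<in> insert (node [2, i, j]) ?Q" using W(1) by blast
        then show "e \<in> (\<lambda>x. {node [1, i, j], x}) ` insert (node [2, i, j]) ?Q"
          by (rule rev_image_eqI) (use xy(1) y in auto)
      qed
    qed simp
    also have "\<dots> \<le> card (insert (node [2, i, j]) ?Q)" by (rule card_image_le) simp
    also have "\<dots> \<le> k" using assms cardQ by (auto simp: card_insert_if)
    finally show False by simp
  qed
next
  show "simple_graph (sub2_graph m k)" by (rule simple_sub2)
qed (auto simp: edge_arc_graph_iff sub2_arcs_def doubleton_eq_iff card_insert_if)

lemma ex_strong_arboricity_jump:
  assumes "k \<ge> 1"
  shows "\<exists>G :: nat ugraph. simple_graph G \<and>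
     strong_induced_arboricity k G \<le> 3 \<and> strong_induced_arboricity (k + 1) G \<ge> n"
proof -
  let ?m = "2 ^ n * (2 * n + 1) + 3"
  have "n < strong_induced_arboricity (k + 1) (sub2_graph ?m k)"
    by (rule less_of_exp_bound[OF sub2_strong_arboricity[OF assms]]) simp
  then show ?thesis using simple_sub2 sub2_strong_arboricity_le[OF assms, of ?m]
    by (intro exI[of _ "sub2_graph ?m k"]) auto
qed

section \<open>Item (c): many forests for \<open>k\<close>, no valid edge for
  \<open>k + 1\<close>\<close>

section \<open>A clique joined to the centre of a star\<close>

text \<open>\<open>Q\<close> and the centre form a clique. So a forest containing the centre meets
  \<open>Q\<close> at most once and has at most \<open>(k - 1) + 1\<close> edges, while a forest
  avoiding it has at most one edge. An edge from the centre to \<open>Q\<close> becomes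
  \<open>k\<close>-valid by adding all leaves \<open>P\<close>, and no two of these edges share a
  forest.\<close>

lemma ex_strong_arboricity_drop:
  assumes "k \<ge> 1"
  shows "\<exists>G :: nat ugraph. simple_graph G \<and>
     strong_induced_arboricity k G \<ge> n \<and> strong_induced_arboricity (k + 1) G = 0"
proof -
  let ?c = "node [0]"
  define P where "P = (\<lambda>l. node [2, l]) ` {..<k - 1}"
  define Q where "Q = (\<lambda>i. node [1, i]) ` {..<n}"
  define A where "A = {(x, ?c) |x. x \<in> P \<union> Q} \<union> {(x, y). x \<in> Q \<and> y \<in> Q \<and> x \<noteq> y}"
  define G where "G = arc_graph (insert ?c (P \<union> Q)) A"
  have edge_iff: "{x, y} \<in> edges G \<longleftrightarrow> (x, y) \<in> A \<or> (y, x) \<in> A" for x y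
    by (simp add: G_def edge_arc_graph_iff)
  have G: "simple_graph G"
    unfolding G_def by (rule simple_arc_graph) (auto simp: A_def P_def Q_def)
  have vG: "verts G = insert ?c (P \<union> Q)" by (simp add: G_def)
  have cards: "card P = k - 1" "card Q = n" "P \<inter> Q = {}" "?c \<notin> P \<union> Q" "finite P" "finite Q"
    by (auto simp: P_def Q_def card_image inj_on_def)
  have cQ: "{?c, q} \<in> edges G" if "q \<in> Q" for q using that by (auto simp: edge_iff A_def)
  have QQ: "{q, q'} \<in> edges G" if "q \<in> Q" "q' \<in> Q" "q \<noteq> q'" for q q'
    using that by (auto simp: edge_iff A_def)
  have "card ((\<lambda>q. {?c, q}) ` Q) \<le> strong_induced_arboricity k G"
  proof (rule card_incompatible_edges_le[OF G])
    fix e assume "e \<in> (\<lambda>q. {?c, q}) ` Q"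
    then obtain q where q: "q \<in> Q" "e = {?c, q}" by blast
    have "k \<le> card (insert q P)"
      using q cards assms by (subst card_insert_disjoint) auto
    then have "strong_forest k (induce G (insert ?c (insert q P))) G"
      using q cards
      by (intro strong_forest_star G) (auto simp: edge_iff A_def vG)
    then show "valid_edge k G e" using q cQ by (intro valid_edgeI[of e G k "insert ?c (insert q P)"]) auto
  next
    fix F e e' assume F: "strong_forest k F G" and e: "e \<in> edges F" "e' \<in> edges F"
      and "e \<in> (\<lambda>q. {?c, q}) ` Q" "e' \<in> (\<lambda>q. {?c, q}) ` Q"
    then obtain q q' where q: "q \<in> Q" "q' \<in> Q" "e = {?c, q}" "e' = {?c, q'}" by blast
    then have "?c \<in> verts F" "q \<in> verts F" "q' \<in> verts F"
      using e strong_forestD(4)[OF F G] by auto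
    then have "q = q'" using strong_forest_no_triangle[OF F G, of ?c q q'] q cQ QQ by blast
    then show "e = e'" using q by simp
  qed
  then have "n \<le> strong_induced_arboricity k G" using cards by (simp add: card_image doubleton_inj)
  moreover have "\<not> valid_edge (k + 1) G e" for e
  proof
    assume "valid_edge (k + 1) G e"
    then obtain F where F: "strong_forest (k + 1) F G" "e \<in> edges F" by (auto simp: valid_edge_def)
    note sF = strong_forestD[OF F(1) G]
    obtain v where v: "v \<in> verts F" using simple_graph_edgeE[OF sF(1) F(2)] by metis
    have "k + 1 \<le> card {e \<in> edges F. e \<subseteq> verts F}"
      by (rule strong_forest_closed[OF F(1) G v v])
    also have "{e \<in> edges F. e \<subseteq> verts F} = edges F" using sF(4) by auto
    finally have big: "k + 1 \<le> card (edges F)" .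
    have tri: False if "x \<in> verts F" "y \<in> verts F" "z \<in> verts F" "x \<noteq> y" "y \<noteq> z" "x \<noteq> z"
      "x \<in> insert ?c Q" "y \<in> Q" "z \<in> Q" for x y z
      using strong_forest_no_triangle[OF F(1) G that(1-3)] that cQ QQ by blast
    show False
    proof (cases "?c \<in> verts F")
      case True
      have one: "card (Q \<inter> verts F) \<le> Suc 0"
        using True tri[of ?c] cards by (subst card_le_Suc0_iff_eq) auto
      have "edges F \<subseteq> (\<lambda>x. {?c, x}) ` (P \<union> (Q \<inter> verts F))"
      proof
        fix e assume "e \<in> edges F"
        then have e: "e \<in> edges G" "e \<subseteq> verts F" using sF(4) by auto
        from e(1) obtain x y where xy: "e = {x, y}" "(x, y) \<in> A" unfolding G_def by (rule arc_graph_edgeE)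
        have "\<not> (x \<in> Q \<and> y \<in> Q \<and> x \<noteq> y)" using tri[of ?c x y] True e xy cards by auto
        then show "e \<in> (\<lambda>x. {?c, x}) ` (P \<union> (Q \<inter> verts F))" using xy e by (auto simp: A_def)
      qed
      then have "card (edges F) \<le> card ((\<lambda>x. {?c, x}) ` (P \<union> (Q \<inter> verts F)))"
        using cards by (intro card_mono) auto
      also have "\<dots> \<le> card (P \<union> (Q \<inter> verts F))" using cards by (intro card_image_le) auto
      also have "\<dots> \<le> card P + card (Q \<inter> verts F)" by (rule card_Un_le)
      finally show False using big one cards assms by simp
    next
      case False
      have QF: "\<exists>x y. e = {x, y} \<and> x \<noteq> y \<and> x \<in> Q \<and> y \<in> Q \<and> x \<in> verts F \<and> y \<in> verts F"
        if "e \<in> edges F" for e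
      proof -
        have e: "e \<in> edges G" "e \<subseteq> verts F" using sF(4) that by auto
        from e(1) obtain x y where xy: "e = {x, y}" "(x, y) \<in> A" unfolding G_def by (rule arc_graph_edgeE)
        then show ?thesis using e False by (auto simp: A_def)
      qed
      have "e = e'" if ee: "e \<in> edges F" "e' \<in> edges F" for e e'
      proof -
        obtain x y where e: "e = {x, y}" "x \<noteq> y" "x \<in> Q" "y \<in> Q" "x \<in> verts F" "y \<in> verts F"
          using QF[OF ee(1)] by blast
        have "z \<in> {x, y}" if "z \<in> Q" "z \<in> verts F" for z using tri[of x y z] e that by blast
        moreover obtain x' y' where e': "e' = {x', y'}" "x' \<noteq> y'" "x' \<in> Q" "y' \<in> Q" "x' \<in> verts F" "y' \<in> verts F"
          using QF[OF ee(2)] by blast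
        ultimately show ?thesis using e by blast
      qed
      then have "card (edges F) \<le> Suc 0"
        using finite_edges[OF sF(1)] by (subst card_le_Suc0_iff_eq) auto
      then show False using big assms by simp
    qed
  qed
  then have "strong_induced_arboricity (k + 1) G = 0"
    using strong_induced_arboricity_le[of "{}" "k + 1" G] by simp
  ultimately show ?thesis using G by (intro exI[of _ G]) auto
qed

section \<open>Item (d), and the lower bound for (e) and (f)\<close>

section \<open>Cherries over an edge and a triangle\<close>

text \<open>The vertices \<open>b i\<close>, coded by tag 4, are common neighbours of \<open>r\<close> (tag 0) and \<open>a\<close> (tag 1); the
  triangle consists of \<open>r\<close>, \<open>x\<close> (tag 2) and \<open>y\<close> (tag 3). Tag 5 marks pendant vertices.\<close>

definition cherry_core :: "nat \<Rightarrow> nat set" where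
  "cherry_core k = {node [0], node [1], node [2], node [3]} \<union> (\<lambda>i. node [4, i]) ` {..<k - 1}"

definition pendants :: "nat \<Rightarrow> nat set \<Rightarrow> nat set" where
  "pendants k R = (\<lambda>(v, l). node [5, v, l]) ` (R \<times> {..<k})"

definition cherry_core_arcs :: "nat \<Rightarrow> (nat \<times> nat) set" where
  "cherry_core_arcs k =
     {(node [2], node [0]), (node [3], node [0]), (node [3], node [2])} \<union>
     {(node [4, i], node [0]) |i. i < k - 1} \<union>
     {(node [4, i], node [1]) |i. i < k - 1}"

text \<open>\<open>R\<close> is the set of vertices that receive \<open>k\<close> pendant vertices.
  The whole core gives the graph of (d); \<open>node [0]\<close> and \<open>node [2]\<close> alone
  give its induced subgraph, in which nothing hangs on \<open>node [1]\<close>.\<close>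

definition cherry_arcs :: "nat \<Rightarrow> nat set \<Rightarrow> (nat \<times> nat) set" where
  "cherry_arcs k R = cherry_core_arcs k \<union> {(node [5, v, l], v) |v l. v \<in> R \<and> l < k}"

abbreviation cherry_graph :: "nat \<Rightarrow> nat set \<Rightarrow> nat ugraph" where
  "cherry_graph k R \<equiv> arc_graph (cherry_core k \<union> pendants k R) (cherry_arcs k R)"

lemma cherry_core_tag: "v \<in> cherry_core k \<Longrightarrow> hd (unnode v) < 5"
  by (auto simp: cherry_core_def)

lemma finite_cherry_core: "finite (cherry_core k)"
  by (simp add: cherry_core_def)

lemma simple_cherry:
  assumes "R \<subseteq> cherry_core k"
  shows "simple_graph (cherry_graph k R)"
proof (rule simple_arc_graph)
  show "finite (cherry_core k \<union> pendants k R)"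
    using finite_subset[OF assms finite_cherry_core] finite_cherry_core by (simp add: pendants_def)
  show "cherry_arcs k R \<subseteq> (cherry_core k \<union> pendants k R) \<times> (cherry_core k \<union> pendants k R)"
  proof -
    have "cherry_core_arcs k \<subseteq> cherry_core k \<times> cherry_core k"
      unfolding cherry_core_arcs_def cherry_core_def by blast
    then show ?thesis using assms by (auto simp: cherry_arcs_def pendants_def)
  qed
  show "(v, v) \<notin> cherry_arcs k R" for v
  proof
    assume "(v, v) \<in> cherry_arcs k R"
    then obtain l where l: "v = node [5, v, l]" "v \<in> R" by (auto simp: cherry_arcs_def cherry_core_arcs_def)
    \<comment> \<open>A pendant vertex has tag 5, a vertex carrying one does not. The equation is
      applied once by \<open>subst\<close> because it would loop as a rewrite rule.\<close>
    have "hd (unnode v) = 5" by (subst l(1)) simp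
    then show False using cherry_core_tag[of v k] assms l(2) by auto
  qed
qed

lemma card_three_le: "card {a, b, c} \<le> 3"
  by (simp add: card_insert_if)

lemma card_pendants: "card ((\<lambda>l. node [5, v, l]) ` {..<k}) = k"
  by (simp add: card_image inj_on_def)

text \<open>If all of \<open>S\<close> carries pendant vertices, the size of components takes care
  of itself and only acyclicity of \<open>S\<close> matters. Tags decrease along arcs and serve as
  heights.\<close>

lemma strong_forest_pendants:
  assumes "R \<subseteq> cherry_core k" "S \<subseteq> R"
    and "\<And>x y. (x, y) \<in> cherry_core_arcs k \<Longrightarrow> x \<in> S \<Longrightarrow> y \<in> S \<Longrightarrow> par x = y"
  shows "strong_forest k (induce (cherry_graph k R) (S \<union> pendants k S)) (cherry_graph k R)"
proof (rule strong_forestI[OF simple_cherry[OF assms(1)]])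
  let ?G = "cherry_graph k R" and ?S = "S \<union> pendants k S"
  show "?S \<subseteq> verts ?G" using assms by (auto simp: pendants_def)
  show "acyclic_graph (induce ?G ?S)"
  proof (rule acyclic_induce_arc_graph[where h = "\<lambda>v. hd (unnode v)" and
        par = "\<lambda>v. if hd (unnode v) = 5 then unnode v ! 1 else par v"])
    fix x y assume xy: "(x, y) \<in> cherry_arcs k R" "x \<in> ?S" "y \<in> ?S"
    show "((if hd (unnode x) = 5 then unnode x ! 1 else par x) = y \<and> hd (unnode y) < hd (unnode x)) \<or>
      ((if hd (unnode y) = 5 then unnode y ! 1 else par y) = x \<and> hd (unnode x) < hd (unnode y))"
    proof (cases "(x, y) \<in> cherry_core_arcs k")
      case True
      then have "hd (unnode y) < hd (unnode x)" "hd (unnode x) < 5"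
        by (auto simp: cherry_core_arcs_def)
      moreover from this have "x \<in> S" "y \<in> S" using xy by (auto simp: pendants_def)
      ultimately show ?thesis using assms(3)[OF True] by auto
    next
      case False
      then have "hd (unnode x) = 5" "unnode x ! 1 = y" "hd (unnode y) < 5"
        using xy(1) assms(1) cherry_core_tag by (auto simp: cherry_arcs_def)
      then show ?thesis by auto
    qed
  qed
  fix v assume v: "v \<in> ?S"
  obtain c where c: "c \<in> S" "joined (induce ?G ?S) v c"
  proof (cases "v \<in> S")
    case True
    then show ?thesis using that[of v] by (simp add: joined_refl)
  next
    case False
    then obtain c l where cl: "v = node [5, c, l]" "c \<in> S" "l < k" using v by (auto simp: pendants_def)
    then have "{v, c} \<in> edges (induce ?G ?S)"
      using assms(2) v by (auto simp: edge_arc_graph_iff cherry_arcs_def)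
    then have "joined (induce ?G ?S) v c" using v cl by (intro joined_edge) auto
    then show ?thesis using that cl by blast
  qed
  then show "\<exists>c X. joined (induce ?G ?S) v c \<and> X \<subseteq> ?S \<and> k \<le> card X \<and> (\<forall>x\<in>X. {c, x} \<in> edges ?G)"
    using assms(2) card_pendants[of c k]
    by (intro exI[of _ c] exI[of _ "(\<lambda>l. node [5, c, l]) ` {..<k}"])
      (auto simp: edge_arc_graph_iff cherry_arcs_def pendants_def)
qed

lemma cherry_strong_arboricity_eq_3:
  "strong_induced_arboricity k (cherry_graph k (cherry_core k)) = 3"
proof (rule antisym)
  let ?V = "cherry_core k"
  let ?G = "cherry_graph k ?V"
  let ?B = "(\<lambda>i. node [4, i]) ` {..<k - 1}"
  let ?F = "\<lambda>S. induce ?G (S \<union> pendants k S)"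
  \<comment> \<open>Three acyclic sets that together contain all core vertices and all core edges;
    each takes one edge of the triangle.\<close>
  let ?T = "{{node [1], node [2], node [3]} \<union> ?B, {node [0], node [2]} \<union> ?B, {node [0], node [3]}}"
  have G: "simple_graph ?G" by (rule simple_cherry) simp
  have F1: "strong_forest k (?F ({node [1], node [2], node [3]} \<union> ?B)) ?G"
    by (rule strong_forest_pendants[where par = "\<lambda>v. if hd (unnode v) = 4 then node [1] else node [2]"])
      (auto simp: cherry_core_def cherry_core_arcs_def)
  have F2: "strong_forest k (?F ({node [0], node [2]} \<union> ?B)) ?G"
    by (rule strong_forest_pendants[where par = "\<lambda>v. node [0]"])
      (auto simp: cherry_core_def cherry_core_arcs_def)
  have F3: "strong_forest k (?F {node [0], node [3]}) ?G"
    by (rule strong_forest_pendants[where par = "\<lambda>v. node [0]"])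
      (auto simp: cherry_core_def cherry_core_arcs_def)
  have "strong_induced_arboricity k ?G \<le> card (?F ` ?T)"
  proof (rule strong_induced_arboricity_le)
    show "strong_forest k F ?G" if "F \<in> ?F ` ?T" for F using that F1 F2 F3 by blast
    fix e assume "valid_edge k ?G e"
    then have e: "e \<in> edges ?G" by (simp add: valid_edge_def)
    then obtain x y where xy: "e = {x, y}" "(x, y) \<in> cherry_arcs k ?V" by (rule arc_graph_edgeE)
    have "\<exists>S \<in> ?T. x \<in> S \<union> pendants k S \<and> y \<in> S \<union> pendants k S"
    proof (cases "(x, y) \<in> cherry_core_arcs k")
      case True
      then show ?thesis by (auto simp: cherry_core_arcs_def)
    next
      case False
      then obtain l where l: "x = node [5, y, l]" "y \<in> ?V" "l < k" using xy by (auto simp: cherry_arcs_def)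
      then obtain S where "S \<in> ?T" "y \<in> S" by (auto simp: cherry_core_def)
      moreover from this have "x \<in> pendants k S" using l by (auto simp: pendants_def)
      ultimately show ?thesis by blast
    qed
    then show "\<exists>F\<in>?F ` ?T. e \<in> edges F" using e xy(1) by auto
  qed auto
  also have "\<dots> \<le> card ?T" by (rule card_image_le) simp
  also have "\<dots> \<le> 3" by (rule card_three_le)
  finally show "strong_induced_arboricity k ?G \<le> 3" .
  let ?X = "{{node [0], node [2]}, {node [0], node [3]}, {node [2], node [3]}}"
  have adj: "{node [0], node [2]} \<in> edges ?G" "{node [0], node [3]} \<in> edges ?G" "{node [2], node [3]} \<in> edges ?G"
    by (simp_all add: edge_arc_graph_iff cherry_arcs_def cherry_core_arcs_def)
  have "card ?X \<le> strong_induced_arboricity k ?G"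
  proof (rule card_incompatible_edges_le[OF G])
    have star: "strong_forest k (?F {u, v}) ?G"
      if "u \<in> {node [0], node [2]}" "v \<in> {node [2], node [3]}" for u v
      by (rule strong_forest_pendants[where par = "\<lambda>_. u"])
        (use that in \<open>auto simp: cherry_core_def cherry_core_arcs_def\<close>)
    fix e assume e: "e \<in> ?X"
    then have "strong_forest k (?F e) ?G"
      using star[of "node [0]" "node [2]"] star[of "node [0]" "node [3]"] star[of "node [2]" "node [3]"]
      by blast
    then show "valid_edge k ?G e" using e adj by (intro valid_edgeI[of e ?G k "e \<union> pendants k e"]) auto
  next
    fix F e e' assume F: "strong_forest k F ?G" and e: "e \<in> ?X" "e' \<in> ?X" "e \<in> edges F" "e' \<in> edges F"
    have "e \<subseteq> verts F" "e' \<subseteq> verts F" using e strong_forestD(4)[OF F G] by auto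
    moreover have "\<not> (node [0] \<in> verts F \<and> node [2] \<in> verts F \<and> node [3] \<in> verts F)"
      using strong_forest_no_triangle[OF F G, of "node [0]" "node [2]" "node [3]"] adj by blast
    ultimately show "e = e'" using e(1,2) by auto
  qed
  then show "3 \<le> strong_induced_arboricity k ?G" by (simp add: doubleton_eq_iff)
qed

text \<open>A \<open>k\<close>-strong forest with an edge at \<open>node [1]\<close> contains
  \<open>node [0]\<close>, since \<open>node [1]\<close> and its neighbours span only
  \<open>k - 1\<close> edges. Two such edges then close a 4-cycle, and the edge from
  \<open>node [2]\<close> to \<open>node [3]\<close> would close a triangle with
  \<open>node [0]\<close>.\<close>

lemma cherry_strong_arboricity_ge:
  assumes "k \<ge> 1"
  shows "k \<le> strong_induced_arboricity k (cherry_graph k {node [0], node [2]})"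
proof -
  let ?R = "{node [0], node [2]}"
  let ?G = "cherry_graph k ?R"
  let ?b = "\<lambda>i. node [4, i]"
  \<comment> \<open>There are only \<open>k - 1\<close> edges at \<open>node [1]\<close>; the
    triangle edge avoiding \<open>node [0]\<close> is the \<open>k\<close>-th.\<close>
  define X where "X = insert {node [2], node [3]} ((\<lambda>i. {node [1], ?b i}) ` {..<k - 1})"
  have R: "?R \<subseteq> cherry_core k" by (simp add: cherry_core_def)
  note G = simple_cherry[OF R]
  have adj: "{node [0], node [2]} \<in> edges ?G" "{node [0], node [3]} \<in> edges ?G" "{node [2], node [3]} \<in> edges ?G"
    "\<And>i. i < k - 1 \<Longrightarrow> {node [0], ?b i} \<in> edges ?G" "\<And>i. i < k - 1 \<Longrightarrow> {node [1], ?b i} \<in> edges ?G"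
    by (simp_all add: edge_arc_graph_iff cherry_arcs_def cherry_core_arcs_def)
  have "card X = k"
    unfolding X_def using assms
    by (subst card_insert_disjoint) (auto simp: card_image inj_on_def doubleton_eq_iff)
  moreover have "card X \<le> strong_induced_arboricity k ?G"
  proof (rule card_incompatible_edges_le[OF G])
    have P: "(\<lambda>l. node [5, v, l]) ` {..<k} \<subseteq> verts ?G" if "v \<in> ?R" for v
      using that by (auto simp: pendants_def)
    fix e assume "e \<in> X"
    then consider "e = {node [2], node [3]}" | i where "i < k - 1" "e = {node [1], ?b i}"
      by (auto simp: X_def)
    then show "valid_edge k ?G e"
    proof cases
      case 1
      let ?Y = "insert (node [3]) ((\<lambda>l. node [5, node [2], l]) ` {..<k})"
      have "k \<le> card ?Y" using card_pendants[of "node [2]" k] by (simp add: card_insert_if)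
      then have "strong_forest k (induce ?G (insert (node [2]) ?Y)) ?G"
        by (intro strong_forest_star G)
          (auto simp: edge_arc_graph_iff cherry_arcs_def cherry_core_arcs_def cherry_core_def)
      then show ?thesis using 1 adj by (intro valid_edgeI) auto
    next
      case 2
      let ?P = "(\<lambda>l. node [5, node [0], l]) ` {..<k}"
      \<comment> \<open>A path from \<open>node [1]\<close> over the common neighbour to
        \<open>node [0]\<close>, whose pendant vertices supply the size.\<close>
      let ?S = "{node [0], ?b i, node [1]} \<union> ?P"
      have S: "?S \<subseteq> verts ?G" using 2 by (auto simp: cherry_core_def pendants_def)
      have to_root: "joined (induce ?G ?S) v (node [0])" if "v \<in> ?S" for v
      proof -
        have b0: "joined (induce ?G ?S) (?b i) (node [0])" and "joined (induce ?G ?S) (node [1]) (?b i)"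
          using 2 adj by (auto intro!: joined_edge simp: insert_commute)
        then have "joined (induce ?G ?S) (node [1]) (node [0])" by (rule joined_trans[rotated])
        moreover have "joined (induce ?G ?S) v (node [0])" if "v \<in> ?P"
          using that by (intro joined_edge) (auto simp: edge_arc_graph_iff cherry_arcs_def)
        moreover have "joined (induce ?G ?S) (node [0]) (node [0])" by (rule joined_refl) simp
        ultimately show ?thesis using that b0 by blast
      qed
      have "strong_forest k (induce ?G ?S) ?G"
      proof (rule strong_forestI[OF G S])
        show "acyclic_graph (induce ?G ?S)"
        proof (rule acyclic_induce_arc_graph[where par = "\<lambda>v. if hd (unnode v) = 1 then ?b i else node [0]" and
                h = "\<lambda>v. if hd (unnode v) = 0 then 0 else if hd (unnode v) = 1 then 2 else 1"])
          fix x y assume xy: "(x, y) \<in> cherry_arcs k ?R" "x \<in> ?S" "y \<in> ?S"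
          have "z \<noteq> node [2]" "z \<noteq> node [3]" if "z \<in> ?S" for z using that by auto
          then consider "x = ?b i" "y = node [0]" | "x = ?b i" "y = node [1]" | l where "x = node [5, node [0], l]" "y = node [0]"
            using xy unfolding cherry_arcs_def cherry_core_arcs_def by auto
          then show "((if hd (unnode x) = 1 then ?b i else node [0]) = y \<and>
              (if hd (unnode y) = 0 then 0 else if hd (unnode y) = 1 then 2 else 1) <
              (if hd (unnode x) = 0 then 0 else if hd (unnode x) = 1 then 2 else 1 :: nat)) \<or>
            ((if hd (unnode y) = 1 then ?b i else node [0]) = x \<and>
              (if hd (unnode x) = 0 then 0 else if hd (unnode x) = 1 then 2 else 1 :: nat) <
              (if hd (unnode y) = 0 then 0 else if hd (unnode y) = 1 then 2 else 1))"
            by cases auto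
        qed
        show "\<exists>c Y. joined (induce ?G ?S) v c \<and> Y \<subseteq> ?S \<and> k \<le> card Y \<and> (\<forall>y\<in>Y. {c, y} \<in> edges ?G)"
          if "v \<in> ?S" for v
          using to_root[OF that] card_pendants[of "node [0]" k]
          by (intro exI[of _ "node [0]"] exI[of _ ?P]) (auto simp: edge_arc_graph_iff cherry_arcs_def)
      qed
      then show ?thesis using 2 adj by (intro valid_edgeI) auto
    qed
  next
    fix F e e' assume F: "strong_forest k F ?G" and e: "e \<in> X" "e' \<in> X" "e \<in> edges F" "e' \<in> edges F"
    note sF = strong_forestD[OF F G]
    have sub: "e \<subseteq> verts F" "e' \<subseteq> verts F" using e sF(4) by auto
    have root: "node [0] \<in> verts F" if i: "i < k - 1" "{node [1], ?b i} \<subseteq> verts F" for i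
    proof (rule ccontr)
      assume neg: "node [0] \<notin> verts F"
      let ?W = "insert (node [1]) (?b ` {..<k - 1})"
      have "k \<le> card {e \<in> edges F. e \<subseteq> ?W}"
        using i neg by (intro strong_forest_closed[OF F G, of "node [1]"])
          (auto simp: sF(4) edge_arc_graph_iff cherry_arcs_def cherry_core_arcs_def)
      also have "\<dots> \<le> card ((\<lambda>x. {node [1], x}) ` ?b ` {..<k - 1})"
      proof (rule card_mono)
        show "{e \<in> edges F. e \<subseteq> ?W} \<subseteq> (\<lambda>x. {node [1], x}) ` ?b ` {..<k - 1}"
        proof
          fix e assume "e \<in> {e \<in> edges F. e \<subseteq> ?W}"
          then have "e \<in> edges ?G" and W: "e \<subseteq> ?W" using sF(4) by auto
          from this(1) obtain x y where "e = {x, y}" "(x, y) \<in> cherry_arcs k ?R" by (rule arc_graph_edgeE)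
          moreover have "hd (unnode z) \<in> {1, 4}" if "z \<in> ?W" for z using that by auto
          ultimately obtain j where "j < k - 1" "e = {?b j, node [1]}"
            using W by (force simp: cherry_arcs_def cherry_core_arcs_def)
          then show "e \<in> (\<lambda>x. {node [1], x}) ` ?b ` {..<k - 1}" by (auto simp: insert_commute)
        qed
      qed simp
      also have "\<dots> \<le> card (?b ` {..<k - 1})" by (rule card_image_le) simp
      also have "\<dots> \<le> k - 1" using card_image_le[of "{..<k - 1}" ?b] by simp
      finally show False using assms by simp
    qed
    have tri: "\<not> (node [0] \<in> verts F \<and> node [2] \<in> verts F \<and> node [3] \<in> verts F)"
      using strong_forest_no_triangle[OF F G, of "node [0]" "node [2]" "node [3]"] adj by blast
    have square: "i = j" if "i < k - 1" "j < k - 1" "{node [1], ?b i} \<subseteq> verts F" "{node [1], ?b j} \<subseteq> verts F" for i j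
    proof (rule ccontr)
      assume "i \<noteq> j"
      then have "vcycle F [node [0], ?b i, node [1], ?b j]"
        using that root[OF that(1,3)] adj(4,5) sF(4)
        by (auto simp: vcycle_def vpath_def walk_def insert_commute)
      then show False using sF(2) by (auto simp: acyclic_graph_def)
    qed
    have mixed: False if "{node [2], node [3]} \<subseteq> verts F" "i < k - 1" "{node [1], ?b i} \<subseteq> verts F" for i
      using root[OF that(2,3)] tri that(1) by simp
    have cases: "e = {node [2], node [3]} \<or> (\<exists>i<k - 1. e = {node [1], ?b i})" if "e \<in> X" for e
      using that by (auto simp: X_def)
    show "e = e'"
      using cases[OF e(1)] cases[OF e(2)]
    proof (elim disjE exE conjE)
      show ?thesis if "i < k - 1" "e = {node [1], ?b i}" "j < k - 1" "e' = {node [1], ?b j}" for i j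
        using square[of i j] that sub by simp
    qed (use mixed sub in blast)+
  qed
  ultimately show ?thesis by simp
qed

lemma ex_induced_subgraph_arboricity:
  assumes "k \<ge> 1"
  shows "\<exists>G :: nat ugraph. simple_graph G \<and>
           (\<exists>H. induced_subgraph H G \<and>
              strong_induced_arboricity k G = 3 \<and> strong_induced_arboricity k H \<ge> k)"
proof -
  let ?G = "cherry_graph k (cherry_core k)" and ?H = "cherry_graph k {node [0], node [2]}"
  have R: "{node [0], node [2]} \<subseteq> cherry_core k" by (simp add: cherry_core_def)
  have "edges ?H = edges (induce ?G (verts ?H))" (is "?L = ?R")
  proof (intro set_eqI iffI)
    fix e assume e: "e \<in> edges ?H"
    then obtain x y where "e = {x, y}" "(x, y) \<in> cherry_arcs k {node [0], node [2]}" by (rule arc_graph_edgeE)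
    moreover have "e \<subseteq> verts ?H" using e simple_cherry[OF R] by (simp add: simple_graph_def)
    ultimately show "e \<in> ?R" using R by (auto simp: edge_arc_graph_iff cherry_arcs_def)
  next
    fix e assume "e \<in> ?R"
    then have e: "e \<in> edges ?G" "e \<subseteq> verts ?H" by simp_all
    from e(1) obtain x y where xy: "e = {x, y}" "(x, y) \<in> cherry_arcs k (cherry_core k)" by (rule arc_graph_edgeE)
    have "(x, y) \<in> cherry_arcs k {node [0], node [2]}"
    proof (cases "(x, y) \<in> cherry_core_arcs k")
      case False
      then obtain l where l: "x = node [5, y, l]" "l < k" using xy(2) by (auto simp: cherry_arcs_def)
      \<comment> \<open>Tag 5 excludes the core, so within the vertices of \<open>?H\<close> only
        its own pendant vertices remain.\<close>
      then have "x \<in> pendants k {node [0], node [2]}" using e(2) xy(1) cherry_core_tag[of x k] by auto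
      then show ?thesis using l by (auto simp: cherry_arcs_def pendants_def)
    qed (simp add: cherry_arcs_def)
    then show "e \<in> ?L" using xy(1) by (simp add: edge_arc_graph_iff)
  qed
  then have "?H = induce ?G (verts ?H)" by (intro ugraph.expand) simp
  moreover have "verts ?H \<subseteq> verts ?G" using R by (auto simp: pendants_def)
  ultimately have "induced_subgraph ?H ?G" unfolding induced_subgraph_def by blast
  then show ?thesis
    using cherry_strong_arboricity_eq_3 cherry_strong_arboricity_ge[OF assms] simple_cherry[of "cherry_core k" k]
    by blast
qed

section \<open>Items (e) and (f): tree-width and tree-depth of the cherry graph\<close>

section \<open>Tree-width and tree-depth\<close>

text \<open>If the three subtrees had no common vertex, inclusion-exclusion would give their union as many
  edges as vertices.\<close>

lemma subtrees_Helly: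
  assumes T: "simple_graph T" "acyclic_graph T"
    and sub: "A \<subseteq> verts T" "B \<subseteq> verts T" "C \<subseteq> verts T"
    and conn: "connected_graph (induce T A)" "connected_graph (induce T B)" "connected_graph (induce T C)"
    and meet: "A \<inter> B \<noteq> {}" "B \<inter> C \<noteq> {}" "A \<inter> C \<noteq> {}"
  shows "A \<inter> B \<inter> C \<noteq> {}"
proof
  assume empty: "A \<inter> B \<inter> C = {}"
  define E where "E S = {e \<in> edges T. e \<subseteq> S}" for S
  have finV: "finite A" "finite B" "finite C" using sub finite_verts[OF T(1)] finite_subset by blast+
  have finE: "finite (E S)" for S using finite_edges[OF T(1)] by (simp add: E_def)
  have EI: "E (S \<inter> S') = E S \<inter> E S'" for S S' by (auto simp: E_def)
  have E0: "E {} = {}" using T(1) by (auto simp: E_def simple_graph_def)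
  have tree: "card S \<le> card (E S) + 1" if "S \<subseteq> verts T" "connected_graph (induce T S)" for S
    using connected_graph_card_edges[OF simple_graph_induce[OF T(1) that(1)] that(2)] by (simp add: E_def)
  have forest: "card (E S) < card S" if "S \<subseteq> verts T" "S \<noteq> {}" for S
    using acyclic_graph_card_edges[OF simple_graph_induce[OF T(1) that(1)] acyclic_graph_mono[OF T(2)]] that
    by (simp add: E_def)
  \<comment> \<open>Inclusion-exclusion in additive form, polymorphic in order to serve for vertices
    and for edges.\<close>
  have union: "card (X \<union> Y \<union> Z) + card (X \<inter> Y) + card (Y \<inter> Z) + card (X \<inter> Z) = card X + card Y + card Z"
    if "finite X" "finite Y" "finite Z" "X \<inter> Y \<inter> Z = {}" for X Y Z :: "'x set"
  proof -
    have "card (X \<union> Y \<union> Z) + card ((X \<union> Y) \<inter> Z) = card (X \<union> Y) + card Z"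
      using card_Un_Int[of "X \<union> Y" Z] that by simp
    moreover have "card (X \<union> Y) + card (X \<inter> Y) = card X + card Y" using card_Un_Int[of X Y] that by simp
    moreover have "(X \<union> Y) \<inter> Z = (X \<inter> Z) \<union> (Y \<inter> Z)" by blast
    moreover have "card ((X \<inter> Z) \<union> (Y \<inter> Z)) = card (X \<inter> Z) + card (Y \<inter> Z)"
      using that by (intro card_Un_disjoint) auto
    ultimately show ?thesis by simp
  qed
  \<comment> \<open>Each subtree has at least its number of vertices minus one as edges, and each
    nonempty intersection has fewer edges than vertices; these three defects and three gains
    cancel.\<close>
  have "card (E A \<union> E B \<union> E C) + card (E (A \<inter> B)) + card (E (B \<inter> C)) + card (E (A \<inter> C)) =
      card (E A) + card (E B) + card (E C)"
    unfolding EI using empty E0 by (intro union finE) (simp add: EI[symmetric])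
  moreover have "card (E A \<union> E B \<union> E C) \<le> card (E (A \<union> B \<union> C))"
    by (intro card_mono finE) (auto simp: E_def)
  moreover have "card (E (A \<union> B \<union> C)) < card (A \<union> B \<union> C)"
    using sub meet by (intro forest) auto
  moreover have "card (E (A \<inter> B)) < card (A \<inter> B)" "card (E (B \<inter> C)) < card (B \<inter> C)" "card (E (A \<inter> C)) < card (A \<inter> C)"
    using sub meet by (auto intro!: forest)
  moreover note union[OF finV empty] tree[OF sub(1) conn(1)] tree[OF sub(2) conn(2)] tree[OF sub(3) conn(3)]
  ultimately show False by linarith
qed

text \<open>The subtrees belonging to the three vertices meet pairwise in the bags that contain the
  edges.\<close>

lemma triangle_bag:
  assumes "simple_graph G" "tree_decomposition G T X"
    and edges: "{x, y} \<in> edges G" "{y, z} \<in> edges G" "{x, z} \<in> edges G"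
  obtains t where "t \<in> verts T" "x \<in> X t" "y \<in> X t" "z \<in> X t"
proof -
  note sD = simple_graph_edgeD[OF assms(1)]
  have T: "simple_graph T" "acyclic_graph T"
    and conn: "\<And>v. v \<in> verts G \<Longrightarrow> connected_graph (induce T {t \<in> verts T. v \<in> X t})"
    and bag: "\<And>e. e \<in> edges G \<Longrightarrow> \<exists>t\<in>verts T. e \<subseteq> X t"
    using assms(2) by (auto simp: tree_decomposition_def tree_def)
  have "{t \<in> verts T. x \<in> X t} \<inter> {t \<in> verts T. y \<in> X t} \<inter> {t \<in> verts T. z \<in> X t} \<noteq> {}"
    using sD[OF edges(1)] sD[OF edges(2)] bag[OF edges(1)] bag[OF edges(2)] bag[OF edges(3)]
    by (intro subtrees_Helly[OF T] conn) auto
  then show thesis using that by blast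
qed

lemma treewidth_eq_2:
  fixes T :: "nat ugraph"
  assumes "simple_graph G" "tree_decomposition G T X" "\<And>t. t \<in> verts T \<Longrightarrow> card (X t) \<le> 3"
    and edges: "{x, y} \<in> edges G" "{y, z} \<in> edges G" "{x, z} \<in> edges G"
  shows "treewidth G = 2"
  unfolding treewidth_def
proof (rule Least_equality)
  show "\<exists>(T :: nat ugraph) X. tree_decomposition G T X \<and> (\<forall>t\<in>verts T. card (X t) \<le> 2 + 1)"
    using assms(2,3) by (intro exI[of _ T] exI[of _ X]) auto
  fix w assume "\<exists>(T :: nat ugraph) X. tree_decomposition G T X \<and> (\<forall>t\<in>verts T. card (X t) \<le> w + 1)"
  then obtain T :: "nat ugraph" and X where TX: "tree_decomposition G T X" "\<And>t. t \<in> verts T \<Longrightarrow> card (X t) \<le> w + 1"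
    by blast
  obtain t where t: "t \<in> verts T" "x \<in> X t" "y \<in> X t" "z \<in> X t"
    using triangle_bag[OF assms(1) TX(1) edges] .
  have "X t \<subseteq> verts G" using TX(1) t(1) by (auto simp: tree_decomposition_def)
  then have "finite (X t)" using finite_verts[OF assms(1)] finite_subset by blast
  then have "card {x, y, z} \<le> card (X t)" using t by (intro card_mono) auto
  moreover have "card {x, y, z} = 3" using edges simple_graph_edgeD(3)[OF assms(1)] by simp
  ultimately show "2 \<le> w" using TX(2)[OF t(1)] by simp
qed

definition parent_tree :: "'a set \<Rightarrow> 'a \<Rightarrow> ('a \<Rightarrow> 'a) \<Rightarrow> 'a ugraph" where
  "parent_tree V r par = arc_graph V {(v, par v) |v. v \<in> V - {r}}"

lemma verts_parent_tree [simp]: "verts (parent_tree V r par) = V"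
  by (simp add: parent_tree_def)

text \<open>\<open>h\<close> is the distance to the root; it makes the parent map well-founded and
  measures the paths to the root. The locale supplies both the decomposition tree and the tree for
  the tree-depth.\<close>

locale parent_function =
  fixes V :: "'a set" and r :: 'a and par :: "'a \<Rightarrow> 'a" and h :: "'a \<Rightarrow> nat"
  assumes finite: "finite V" and root: "r \<in> V" "h r = 0"
    and par: "\<And>v. v \<in> V \<Longrightarrow> v \<noteq> r \<Longrightarrow> par v \<in> V \<and> h v = Suc (h (par v))"
begin

abbreviation T :: "'a ugraph" where "T \<equiv> parent_tree V r par"

lemma edge_T_iff: "{x, y} \<in> edges T \<longleftrightarrow> (x \<in> V - {r} \<and> y = par x) \<or> (y \<in> V - {r} \<and> x = par y)"
  by (auto simp: parent_tree_def edge_arc_graph_iff)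

lemma simple_T: "simple_graph T"
  unfolding parent_tree_def
proof (rule simple_arc_graph)
  show "(x, x) \<notin> {(v, par v) |v. v \<in> V - {r}}" for x
  proof
    assume "(x, x) \<in> {(v, par v) |v. v \<in> V - {r}}"
    then have "x \<in> V" "x \<noteq> r" "par x = x" by auto
    then show False using par[of x] by simp
  qed
qed (use finite par in auto)

lemma joined_root: "v \<in> V \<Longrightarrow> joined T v r"
proof (induction "h v" arbitrary: v)
  case 0
  then show ?case using par[of v] by (cases "v = r") (auto intro: joined_refl)
next
  case (Suc n)
  then have "v \<noteq> r" using root by auto
  then have p: "par v \<in> V" "n = h (par v)" using par Suc by auto
  then have "joined T v (par v)" using Suc.prems \<open>v \<noteq> r\<close> by (intro joined_edge) (auto simp: edge_T_iff)
  then show ?case using Suc.hyps(1)[OF p(2,1)] by (rule joined_trans)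
qed

lemma tree_T: "tree T"
  unfolding tree_def
proof (intro conjI simple_T)
  show "connected_graph T" by (rule connected_graphI[of r]) (simp_all add: root joined_root)
  show "acyclic_graph T"
  proof (rule acyclic_graph_parent[of _ par h])
    fix e assume "e \<in> edges T"
    then obtain v where "e = {v, par v}" "v \<in> V" "v \<noteq> r" by (auto simp: parent_tree_def arc_graph_def)
    then show "\<exists>x. e = {x, par x} \<and> h (par x) < h x" using par[of v] by auto
  qed
qed

text \<open>A path to the root only climbs: after a step down to a child \<open>w\<close>, the rest
  would by induction pass through \<open>u\<close> again.\<close>

lemma vpath_root:
  "vpath T u p r \<Longrightarrow> (if u = r then p = [r] else \<exists>q. p = u # q \<and> vpath T (par u) q r)"
proof (induction p arbitrary: u)
  case Nil
  then show ?case by (simp add: vpath_def walk_def)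
next
  case (Cons v q)
  then have [simp]: "v = u" by (simp add: vpath_def walk_def)
  show ?case
  proof (cases q)
    case Nil
    then show ?thesis using Cons.prems by (auto simp: vpath_def walk_def)
  next
    case (Cons w q')
    have ur: "u \<noteq> r" using Cons.prems Cons by (auto simp: vpath_def walk_def split: if_splits)
    have wq: "vpath T w q r" "{u, w} \<in> edges T" "u \<notin> set q"
      using Cons.prems Cons by (auto simp: vpath_def walk_Cons_Cons)
    have "w = par u"
    proof (rule ccontr)
      assume "w \<noteq> par u"
      then have w: "w \<in> V" "w \<noteq> r" "u = par w" using wq(2) by (auto simp: edge_T_iff)
      then obtain q'' where "q = w # q''" "vpath T u q'' r" using Cons.IH[OF wq(1)] by auto
      then have "u \<in> set q" by (auto simp: vpath_def walk_def)
      then show False using wq(3) by simp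
    qed
    then show ?thesis using wq ur by auto
  qed
qed

lemma length_vpath_root: "vpath T u p r \<Longrightarrow> length p = Suc (h u)"
proof (induction "h u" arbitrary: u p)
  case 0
  then have "u \<in> V" by (auto simp: vpath_def walk_def)
  then have "u = r" using par[of u] 0 by auto
  then show ?case using vpath_root[OF 0(2)] root by simp
next
  case (Suc n)
  then have "u \<noteq> r" "u \<in> V" using root by (auto simp: vpath_def walk_def)
  then obtain q where "p = u # q" "vpath T (par u) q r" using vpath_root[OF Suc(3)] by auto
  then show ?case using Suc(1)[of "par u" q] Suc(2) par[OF \<open>u \<in> V\<close> \<open>u \<noteq> r\<close>] by simp
qed

lemma ex_vpath_root: "u \<in> V \<Longrightarrow> \<exists>p. vpath T u p r"
  using joined_root walk_vpath unfolding joined_def by metis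

lemma rooted_depth_T: "rooted_depth T r = Suc (Max (h ` V))"
proof -
  have "{length p |p u. vpath T u p r} = Suc ` h ` V"
  proof (intro set_eqI iffI)
    fix n assume "n \<in> {length p |p u. vpath T u p r}"
    then obtain p u where pu: "n = length p" "vpath T u p r" by blast
    moreover from this have "u \<in> V" by (auto simp: vpath_def walk_def)
    ultimately show "n \<in> Suc ` h ` V" using length_vpath_root by blast
  next
    fix n assume "n \<in> Suc ` h ` V"
    then obtain u where "u \<in> V" "n = Suc (h u)" by blast
    then show "n \<in> {length p |p u. vpath T u p r}" using ex_vpath_root[of u] length_vpath_root by force
  qed
  moreover have "V \<noteq> {}" using root by blast
  ultimately show ?thesis
    using finite mono_Max_commute[of Suc "h ` V"] unfolding rooted_depth_def by (simp add: mono_def)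
qed

lemma ancestor_in_closure:
  assumes "u \<in> V" "u \<noteq> r"
  shows "{u, par u} \<in> edges (tree_closure T r)"
    and "par u \<noteq> r \<Longrightarrow> {u, par (par u)} \<in> edges (tree_closure T r)"
proof -
  show "{u, par u} \<in> edges (tree_closure T r)" using assms by (simp add: tree_closure_def edge_T_iff)
  assume pr: "par u \<noteq> r"
  obtain p where p: "vpath T u p r" using ex_vpath_root[OF assms(1)] by blast
  then obtain q where q: "p = u # q" "vpath T (par u) q r" using vpath_root[OF p] assms by auto
  then obtain q' where q': "q = par u # q'" "vpath T (par (par u)) q' r" using vpath_root[OF q(2)] pr by auto
  then have "par (par u) \<in> set q'" unfolding vpath_def walk_def by (metis hd_in_set)
  then have "par (par u) \<in> set p" using q(1) q' by simp
  moreover have "u \<noteq> par (par u)"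
    using par[OF assms] par[of "par u"] pr by (auto dest: arg_cong[of _ _ h])
  ultimately show "{u, par (par u)} \<in> edges (tree_closure T r)" using p by (auto simp: tree_closure_def)
qed

end

text \<open>A tree of depth at most 2 is a star centred at the root, and its closure adds nothing.
  So no triangle embeds in it.\<close>

lemma shallow_closure_edge:
  assumes T: "tree T" "r \<in> verts T" "rooted_depth T r \<le> 2"
    and e: "{u, v} \<in> edges (tree_closure T r)"
  shows "u = r \<or> v = r"
proof (rule ccontr)
  assume neg: "\<not> ?thesis"
  have G: "simple_graph T" "acyclic_graph T" using T by (auto simp: tree_def)
  have "length p \<le> card (verts T)" if "vpath T w p r" for w p
    using that card_mono[OF finite_verts[OF G(1)], of "set p"]
    by (simp add: vpath_def walk_def distinct_card)
  then have "{length p |p u. vpath T u p r} \<subseteq> {..card (verts T)}" by auto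
  then have fin: "finite {length p |p u. vpath T u p r}" by (rule finite_subset) simp
  have short: "p = [w, r]" "{w, r} \<in> edges T" if p: "vpath T w p r" "w \<noteq> r" for w p
  proof -
    have "length p \<le> rooted_depth T r" unfolding rooted_depth_def using p fin by (intro Max_ge) auto
    then have "length p \<le> 2" using T by simp
    moreover from p obtain q where q: "p = w # q" by (cases p) (auto simp: vpath_def walk_def)
    moreover from p q obtain z q' where "q = z # q'" by (cases q) (auto simp: vpath_def walk_def)
    ultimately have "p = [w, z]" by simp
    then show "p = [w, r]" "{w, r} \<in> edges T" using p by (auto simp: vpath_def walk_def)
  qed
  have star: "{w, r} \<in> edges T" if w: "w \<in> verts T" "w \<noteq> r" for w
  proof -
    have "joined T w r" using T w by (auto simp: tree_def connected_graph_def)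
    then obtain p where "vpath T w p r" using walk_vpath[of T w _ r] by (auto simp: joined_def)
    then show ?thesis using short(2) w by blast
  qed
  consider "{u, v} \<in> edges T" | p where "vpath T u p r" "v \<in> set p" "u \<noteq> v"
    | p where "vpath T v p r" "u \<in> set p" "u \<noteq> v"
    using e unfolding tree_closure_def by (auto simp: doubleton_eq_iff)
  then show False
  proof cases
    case 1
    note uv = simple_graph_edgeD[OF G(1) 1]
    have "vcycle T [u, v, r]"
      using neg uv 1 star[of u] star[of v] T(2) by (intro vcycle_triangle) auto
    then show False using G(2) by (auto simp: acyclic_graph_def)
  next
    case 2
    then show False using short(1)[of u p] neg by auto
  next
    case 3
    then show False using short(1)[of v p] neg by auto
  qed
qed

text \<open>The single tree hosts every component by the identity, so its exact depth also serves
  components that would fit into a shallower tree. Below depth 3 there is no room for the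
  triangle.\<close>

lemma treedepth_eq_3:
  fixes G :: "nat ugraph"
  assumes G: "simple_graph G"
    and T: "tree T" "r \<in> verts T" "rooted_depth T r = 3"
    and sub: "verts G \<subseteq> verts T" "edges G \<subseteq> edges (tree_closure T r)"
    and tri: "{x, y} \<in> edges G" "{y, z} \<in> edges G" "{x, z} \<in> edges G"
  shows "treedepth G = 3"
  unfolding treedepth_def
proof (rule Least_equality)
  show "\<forall>C\<in>components G. \<exists>(T :: nat ugraph) r. tree T \<and> r \<in> verts T \<and> rooted_depth T r = 3 \<and> embeds C (tree_closure T r)"
  proof
    fix C assume "C \<in> components G"
    then have C: "verts C \<subseteq> verts G" "edges C \<subseteq> edges G" by (auto simp: components_def dest: joined_verts)
    have "embeds C (tree_closure T r)"
      unfolding embeds_def using C sub by (intro exI[of _ id]) (auto simp: tree_closure_def)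
    then show "\<exists>(T :: nat ugraph) r. tree T \<and> r \<in> verts T \<and> rooted_depth T r = 3 \<and> embeds C (tree_closure T r)"
      using T by blast
  qed
  fix d assume d: "\<forall>C\<in>components G. \<exists>(T :: nat ugraph) r. tree T \<and> r \<in> verts T \<and> rooted_depth T r = d \<and> embeds C (tree_closure T r)"
  note sD = simple_graph_edgeD[OF G]
  define C where "C = induce G {v. joined G x v}"
  have "C \<in> components G" using sD[OF tri(1)] by (auto simp: C_def components_def)
  then obtain T :: "nat ugraph" and r where T: "tree T" "r \<in> verts T" "rooted_depth T r = d" "embeds C (tree_closure T r)"
    using d by blast
  then obtain f where f: "inj_on f (verts C)" "\<And>e. e \<in> edges C \<Longrightarrow> f ` e \<in> edges (tree_closure T r)"
    by (auto simp: embeds_def)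
  have in_C: "x \<in> verts C" "y \<in> verts C" "z \<in> verts C"
    using sD[OF tri(1)] sD[OF tri(3)] tri by (auto simp: C_def intro: joined_refl joined_edge)
  then have "{f x, f y} \<in> edges (tree_closure T r)" "{f y, f z} \<in> edges (tree_closure T r)" "{f x, f z} \<in> edges (tree_closure T r)"
    using f(2)[of "{x, y}"] f(2)[of "{y, z}"] f(2)[of "{x, z}"] tri by (auto simp: C_def)
  moreover have "f x \<noteq> f y" "f y \<noteq> f z" "f x \<noteq> f z"
    using f(1) in_C sD(3)[OF tri(1)] sD(3)[OF tri(2)] sD(3)[OF tri(3)] by (auto simp: inj_on_def)
  ultimately have "\<not> rooted_depth T r \<le> 2"
    using shallow_closure_edge[OF T(1,2)] by metis
  then show "3 \<le> d" using T(3) by simp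
qed

lemma cherry_triangle:
  "{node [0], node [2]} \<in> edges (cherry_graph k R)"
  "{node [2], node [3]} \<in> edges (cherry_graph k R)"
  "{node [0], node [3]} \<in> edges (cherry_graph k R)"
  by (simp_all add: edge_arc_graph_iff cherry_arcs_def cherry_core_arcs_def)

lemma cherry_vertexE:
  assumes "v \<in> cherry_core k \<union> pendants k {node [0], node [2]}"
  obtains "v = node [0]" | "v = node [1]" | "v = node [2]" | "v = node [3]"
    | i where "v = node [4, i]" "i < k - 1" | l where "v = node [5, node [0], l]" "l < k"
    | l where "v = node [5, node [2], l]" "l < k"
proof -
  have "v = node [0] \<or> v = node [1] \<or> v = node [2] \<or> v = node [3] \<or> (\<exists>i<k - 1. v = node [4, i]) \<or>
      (\<exists>l<k. v = node [5, node [0], l]) \<or> (\<exists>l<k. v = node [5, node [2], l])"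
    using assms by (auto simp: cherry_core_def pendants_def)
  then show thesis using that by (elim disjE exE conjE)
qed

lemma cherry_arcE:
  assumes "(u, v) \<in> cherry_arcs k {node [0], node [2]}"
  obtains "u = node [2]" "v = node [0]" | "u = node [3]" "v = node [0]" | "u = node [3]" "v = node [2]"
    | i where "u = node [4, i]" "v = node [0]" "i < k - 1" | i where "u = node [4, i]" "v = node [1]" "i < k - 1"
    | l where "u = node [5, node [0], l]" "v = node [0]" "l < k"
    | l where "u = node [5, node [2], l]" "v = node [2]" "l < k"
proof -
  have "u = node [2] \<and> v = node [0] \<or> u = node [3] \<and> v = node [0] \<or> u = node [3] \<and> v = node [2] \<or>
      (\<exists>i<k - 1. u = node [4, i] \<and> v = node [0]) \<or> (\<exists>i<k - 1. u = node [4, i] \<and> v = node [1]) \<or>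
      (\<exists>l<k. u = node [5, node [0], l] \<and> v = node [0]) \<or> (\<exists>l<k. u = node [5, node [2], l] \<and> v = node [2])"
    using assms by (auto simp: cherry_arcs_def cherry_core_arcs_def)
  then show thesis using that by (elim disjE exE conjE)
qed

lemma cherry_vertexI:
  "node [0] \<in> cherry_core k \<union> P" "node [1] \<in> cherry_core k \<union> P"
  "node [2] \<in> cherry_core k \<union> P" "node [3] \<in> cherry_core k \<union> P"
  "i < k - 1 \<Longrightarrow> node [4, i] \<in> cherry_core k \<union> P"
  by (auto simp: cherry_core_def)

lemma cherry_treedepth: "treedepth (cherry_graph k {node [0], node [2]}) = 3"
proof -
  let ?G = "cherry_graph k {node [0], node [2]}"
  \<comment> \<open>The children of \<open>node [0]\<close> are \<open>node [1]\<close>,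
    \<open>node [2]\<close> and its own pendant vertices; the common neighbours hang on
    \<open>node [1]\<close>, while \<open>node [3]\<close> and the pendant vertices of
    \<open>node [2]\<close> hang on \<open>node [2]\<close>.\<close>
  define par where "par v =
    (if hd (unnode v) = 5 then unnode v ! 1 else if hd (unnode v) = 4 then node [1]
     else if hd (unnode v) = 3 then node [2] else node [0])" for v
  define h :: "nat \<Rightarrow> nat" where "h v =
    (if hd (unnode v) = 5 \<and> unnode v ! 1 = node [0] then 1
     else if hd (unnode v) = 0 then 0 else if hd (unnode v) < 3 then 1 else 2)" for v
  have G: "simple_graph ?G" by (rule simple_cherry) (simp add: cherry_core_def)
  interpret parent_function "cherry_core k \<union> pendants k {node [0], node [2]}" "node [0]" par h
  proof
    show "finite (cherry_core k \<union> pendants k {node [0], node [2]})" using finite_verts[OF G] by simp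
    show "node [0] \<in> cherry_core k \<union> pendants k {node [0], node [2]}" "h (node [0]) = 0"
      by (auto simp: cherry_core_def h_def)
    fix v assume "v \<in> cherry_core k \<union> pendants k {node [0], node [2]}" "v \<noteq> node [0]"
    then show "par v \<in> cherry_core k \<union> pendants k {node [0], node [2]} \<and> h v = Suc (h (par v))"
      by (cases rule: cherry_vertexE) (use \<open>v \<noteq> node [0]\<close> in \<open>simp_all add: par_def h_def cherry_vertexI del: Un_iff One_nat_def\<close>)
  qed
  have "Max (h ` verts ?G) = 2"
  proof (rule Max_eqI)
    show "finite (h ` verts ?G)" using finite by simp
    show "n \<le> 2" if "n \<in> h ` verts ?G" for n using that by (auto simp: h_def)
    have "h (node [3]) = 2" "node [3] \<in> verts ?G" by (simp_all add: h_def cherry_core_def)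
    then show "2 \<in> h ` verts ?G" by (metis imageI)
  qed
  then have depth: "rooted_depth T (node [0]) = 3" using rooted_depth_T by simp
  have "edges ?G \<subseteq> edges (tree_closure T (node [0]))"
  proof
    fix e assume e: "e \<in> edges ?G"
    then obtain u v where uv: "e = {u, v}" "(u, v) \<in> cherry_arcs k {node [0], node [2]}" by (rule arc_graph_edgeE)
    have "u \<in> verts ?G" using simple_graph_edgeD[OF G] e uv(1) by blast
    then have u: "u \<in> cherry_core k \<union> pendants k {node [0], node [2]}" by simp
    \<comment> \<open>The edges to a grandparent are those from tags 3 and 4 to
      \<open>node [0]\<close>.\<close>
    have "u \<noteq> node [0] \<and> (v = par u \<or> (par u \<noteq> node [0] \<and> v = par (par u)))"
      using uv(2) by (cases rule: cherry_arcE) (simp_all add: par_def)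
    then show "e \<in> edges (tree_closure T (node [0]))"
      using ancestor_in_closure[OF u] uv(1) by auto
  qed
  then show ?thesis
    by (intro treedepth_eq_3[OF G tree_T _ depth _ _ cherry_triangle]) (simp_all add: cherry_core_def)
qed

lemma cherry_treewidth: "treewidth (cherry_graph k {node [0], node [2]}) = 2"
proof -
  let ?G = "cherry_graph k {node [0], node [2]}"
  \<comment> \<open>Bags for a star-shaped tree centred at \<open>node [0]\<close>: tags 1 and 2
    repeat the central bag, every other vertex gets itself and the vertices to which its arcs
    point.\<close>
  define X where "X v =
    (if hd (unnode v) = 5 then {v, unnode v ! 1} else if hd (unnode v) = 4 then {v, node [0], node [1]}
     else if hd (unnode v) = 3 then {v, node [0], node [2]} else {node [0], node [1], node [2]})" for v
  have G: "simple_graph ?G" by (rule simple_cherry) (simp add: cherry_core_def)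
  interpret parent_function "cherry_core k \<union> pendants k {node [0], node [2]}" "node [0]" "\<lambda>_. node [0]" "\<lambda>v. if v = node [0] then 0 else 1"
    by standard (use finite_verts[OF G] in \<open>auto simp: cherry_core_def\<close>)
  have "tree_decomposition ?G T X"
    unfolding tree_decomposition_def
  proof (intro conjI ballI tree_T)
    have sub: "X v \<subseteq> verts ?G" if "v \<in> verts ?G" for v
      using that[unfolded verts_arc_graph]
      by (cases rule: cherry_vertexE) (use that in \<open>simp_all add: X_def cherry_vertexI del: Un_iff One_nat_def\<close>)
    have own: "v \<in> X v" if "v \<in> verts ?G" for v
      using that[unfolded verts_arc_graph] by (cases rule: cherry_vertexE) (simp_all add: X_def)
    show "(\<Union>t\<in>verts T. X t) = verts ?G" using sub own by auto
    show "\<exists>t\<in>verts T. e \<subseteq> X t" if e: "e \<in> edges ?G" for e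
    proof -
      obtain u v where uv: "e = {u, v}" "(u, v) \<in> cherry_arcs k {node [0], node [2]}"
        using e by (rule arc_graph_edgeE)
      have "u \<in> verts ?G" using simple_graph_edgeD[OF G] e uv(1) by blast
      moreover have "{u, v} \<subseteq> X u" using uv(2) by (cases rule: cherry_arcE) (simp_all add: X_def)
      ultimately show ?thesis using uv(1) by auto
    qed
    fix v assume v: "v \<in> verts ?G"
    let ?S = "{t \<in> verts T. v \<in> X t}"
    show "connected_graph (induce T ?S)"
    \<comment> \<open>A vertex of the central bag has all its bags joined to the centre; any other
      vertex occurs only in its own bag.\<close>
    proof (cases "v \<in> X (node [0])")
      case True
      show ?thesis
      proof (rule connected_graphI)
        show r: "node [0] \<in> verts (induce T ?S)" using True root by simp
        fix t assume t: "t \<in> verts (induce T ?S)"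
        show "joined (induce T ?S) t (node [0])"
        proof (cases "t = node [0]")
          case True
          then show ?thesis using t by (simp add: joined_refl)
        next
          case False
          then have "{t, node [0]} \<in> edges (induce T ?S)" using t r by (simp add: edge_T_iff)
          then show ?thesis using t r by (intro joined_edge)
        qed
      qed
    next
      case False
      have "t = v" if "t \<in> ?S" for t
      proof -
        have "t \<in> cherry_core k \<union> pendants k {node [0], node [2]}" "v \<in> X t" using that by simp_all
        then show ?thesis by (cases rule: cherry_vertexE) (use False in \<open>auto simp: X_def\<close>)
      qed
      then have "?S = {v}" using own[OF v] v by auto
      then show ?thesis by (intro connected_graphI[of v]) (auto intro: joined_refl)
    qed
  qed
  moreover have "card (X t) \<le> 3" for t by (simp add: X_def card_insert_if)
  ultimately show ?thesis by (rule treewidth_eq_2[OF G _ _ cherry_triangle])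
qed

section \<open>Part (iv): two forests suffice, yet every graph is a shallow minor\<close>

section \<open>Three subdivision vertices per edge\<close>

text \<open>Tags 1 to 3 run along the path from \<open>i\<close> to \<open>j\<close>. The number
  \<open>m\<close> of pendant vertices (tag 4) at each branch vertex grows with the graph, so for
  each \<open>k\<close> only finitely many members have too few.\<close>

definition sub3_arcs :: "nat \<Rightarrow> (nat \<times> nat) set" where
  "sub3_arcs m =
     {(node [1, i, j], node [0, i]) |i j. i < j \<and> j < m} \<union>
     {(node [2, i, j], node [1, i, j]) |i j. i < j \<and> j < m} \<union>
     {(node [2, i, j], node [3, i, j]) |i j. i < j \<and> j < m} \<union>
     {(node [3, i, j], node [0, j]) |i j. i < j \<and> j < m} \<union>
     {(node [4, i, l], node [0, i]) |i l. i < m \<and> l < m}"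

definition sub3_verts :: "nat \<Rightarrow> nat set" where
  "sub3_verts m = (\<lambda>i. node [0, i]) ` {..<m} \<union>
     (\<lambda>(c, i, j). node [c, i, j]) ` ({1, 2, 3} \<times> {(i, j). i < j \<and> j < m}) \<union>
     (\<lambda>(i, l). node [4, i, l]) ` ({..<m} \<times> {..<m})"

abbreviation sub3_graph :: "nat \<Rightarrow> nat ugraph" where
  "sub3_graph m \<equiv> arc_graph (sub3_verts m) (sub3_arcs m)"

lemma sub3_vertexE:
  assumes "v \<in> sub3_verts m"
  obtains i where "v = node [0, i]" "i < m" | i j where "v = node [1, i, j]" "i < j" "j < m"
    | i j where "v = node [2, i, j]" "i < j" "j < m" | i j where "v = node [3, i, j]" "i < j" "j < m"
    | i l where "v = node [4, i, l]" "i < m" "l < m"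
proof -
  have "(\<exists>i. v = node [0, i] \<and> i < m) \<or> (\<exists>i j. v = node [1, i, j] \<and> i < j \<and> j < m) \<or>
      (\<exists>i j. v = node [2, i, j] \<and> i < j \<and> j < m) \<or> (\<exists>i j. v = node [3, i, j] \<and> i < j \<and> j < m) \<or>
      (\<exists>i l. v = node [4, i, l] \<and> i < m \<and> l < m)"
    using assms by (auto simp: sub3_verts_def)
  then show thesis using that by (elim disjE exE conjE)
qed

lemma sub3_vertexI:
  "i < m \<Longrightarrow> node [0, i] \<in> sub3_verts m"
  "i < j \<Longrightarrow> j < m \<Longrightarrow> node [1, i, j] \<in> sub3_verts m"
  "i < j \<Longrightarrow> j < m \<Longrightarrow> node [2, i, j] \<in> sub3_verts m"
  "i < j \<Longrightarrow> j < m \<Longrightarrow> node [3, i, j] \<in> sub3_verts m"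
  "i < m \<Longrightarrow> l < m \<Longrightarrow> node [4, i, l] \<in> sub3_verts m"
  by (auto simp: sub3_verts_def image_iff)

lemma sub3_arcE:
  assumes "(x, y) \<in> sub3_arcs m"
  obtains i j where "x = node [1, i, j]" "y = node [0, i]" "i < j" "j < m"
    | i j where "x = node [2, i, j]" "y = node [1, i, j]" "i < j" "j < m"
    | i j where "x = node [2, i, j]" "y = node [3, i, j]" "i < j" "j < m"
    | i j where "x = node [3, i, j]" "y = node [0, j]" "i < j" "j < m"
    | i l where "x = node [4, i, l]" "y = node [0, i]" "i < m" "l < m"
proof -
  have "(\<exists>i j. x = node [1, i, j] \<and> y = node [0, i] \<and> i < j \<and> j < m) \<or>
    (\<exists>i j. x = node [2, i, j] \<and> y = node [1, i, j] \<and> i < j \<and> j < m) \<or>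
    (\<exists>i j. x = node [2, i, j] \<and> y = node [3, i, j] \<and> i < j \<and> j < m) \<or>
    (\<exists>i j. x = node [3, i, j] \<and> y = node [0, j] \<and> i < j \<and> j < m) \<or>
    (\<exists>i l. x = node [4, i, l] \<and> y = node [0, i] \<and> i < m \<and> l < m)"
    using assms by (simp add: sub3_arcs_def)
  then show thesis using that by (elim disjE exE conjE)
qed

lemma simple_sub3: "simple_graph (sub3_graph m)"
proof (rule simple_arc_graph)
  show "finite (sub3_verts m)" by (simp add: sub3_verts_def finite_ordered_pairs)
  have "x \<in> sub3_verts m \<and> y \<in> sub3_verts m \<and> x \<noteq> y" if "(x, y) \<in> sub3_arcs m" for x y
    using that by (cases rule: sub3_arcE) (simp_all add: sub3_vertexI del: One_nat_def)
  then show "sub3_arcs m \<subseteq> sub3_verts m \<times> sub3_verts m" "(x, x) \<notin> sub3_arcs m" for x by auto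
qed

lemma sub3_arboricity:
  assumes "k \<le> m"
  shows "strong_induced_arboricity k (sub3_graph m) \<le> 2"
proof -
  let ?G = "sub3_graph m"
  \<comment> \<open>Leaving out tag 3 (for \<open>c = 1\<close>) or tag 1 (for \<open>c = 3\<close>)
    cuts every path, and the middle vertex stays attached to one side. Every component is then a
    tree around a single branch vertex and its \<open>m\<close> pendant vertices.\<close>
  define S where "S c = {v \<in> sub3_verts m. hd (unnode v) \<in> {0, c, 2, 4}}" for c
  define par where "par c v =
    (if hd (unnode v) = 2 then node [c, unnode v ! 1, unnode v ! 2]
     else if hd (unnode v) = 3 then node [0, unnode v ! 2] else node [0, unnode v ! 1])" for c v
  define h :: "nat \<Rightarrow> nat" where "h v = (if hd (unnode v) = 0 then 0 else if hd (unnode v) = 2 then 2 else 1)" for v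
  have F: "strong_forest k (induce ?G (S c)) ?G" if c: "c = 1 \<or> c = 3" for c
  proof (rule strong_forestI[OF simple_sub3])
    show "S c \<subseteq> verts ?G" by (auto simp: S_def)
    show "acyclic_graph (induce ?G (S c))"
    proof (rule acyclic_induce_arc_graph[where par = "par c" and h = h])
      fix x y assume "(x, y) \<in> sub3_arcs m" and xy: "x \<in> S c" "y \<in> S c"
      from this(1) have "par c x = y \<and> h y < h x"
        by (cases rule: sub3_arcE) (use xy c in \<open>auto simp: S_def par_def h_def\<close>)
      then show "par c x = y \<and> h y < h x \<or> par c y = x \<and> h x < h y" ..
    qed
    fix v assume v: "v \<in> S c"
    have par_edge: "joined (induce ?G (S c)) v (par c v) \<and> par c v \<in> S c"
      if "v \<in> S c" "hd (unnode v) \<noteq> 0" for v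
    proof -
      have "v \<in> sub3_verts m" using that by (simp add: S_def)
      then have "par c v \<in> S c \<and> (v, par c v) \<in> sub3_arcs m"
        by (cases rule: sub3_vertexE)
          (use that c in \<open>auto simp: S_def par_def sub3_vertexI sub3_arcs_def simp del: One_nat_def\<close>)
      then show ?thesis using that by (auto intro!: joined_edge simp: edge_arc_graph_iff)
    qed
    have h_par: "h (par c v) < h v" if "v \<in> S c" "hd (unnode v) \<noteq> 0" for v
      using that c by (auto simp: S_def par_def h_def)
    have "\<exists>r. joined (induce ?G (S c)) v r \<and> r \<in> S c \<and> hd (unnode r) = 0"
      using v
    proof (induction "h v" arbitrary: v rule: less_induct)
      case less
      show ?case
      proof (cases "hd (unnode v) = 0")
        case True
        then show ?thesis using less by (intro exI[of _ v]) (simp add: joined_refl)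
      next
        case False
        then show ?thesis
          using less.hyps[of "par c v", OF h_par] par_edge[of v] less.prems by (blast intro: joined_trans)
      qed
    qed
    then obtain r where r: "joined (induce ?G (S c)) v r" "r \<in> S c" "hd (unnode r) = 0" by blast
    have "r \<in> sub3_verts m" using r(2) by (simp add: S_def)
    then obtain i where i: "r = node [0, i]" "i < m" using r(3) by (cases rule: sub3_vertexE) auto
    let ?X = "(\<lambda>l. node [4, i, l]) ` {..<m}"
    have "card ?X = m" by (simp add: card_image inj_on_def)
    moreover have "?X \<subseteq> S c" using i by (auto simp: S_def sub3_vertexI)
    ultimately show "\<exists>d X. joined (induce ?G (S c)) v d \<and> X \<subseteq> S c \<and> k \<le> card X \<and> (\<forall>x\<in>X. {d, x} \<in> edges ?G)"
      using r i assms by (intro exI[of _ r] exI[of _ ?X]) (auto simp: edge_arc_graph_iff sub3_arcs_def)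
  qed
  have "strong_induced_arboricity k ?G \<le> card {induce ?G (S 1), induce ?G (S 3)}"
  proof (rule strong_induced_arboricity_le)
    show "strong_forest k F' ?G" if "F' \<in> {induce ?G (S 1), induce ?G (S 3)}" for F' using that F by auto
    fix e assume "valid_edge k ?G e"
    then have e: "e \<in> edges ?G" by (simp add: valid_edge_def)
    then obtain x y where xy: "e = {x, y}" "(x, y) \<in> sub3_arcs m" by (rule arc_graph_edgeE)
    have "x \<in> sub3_verts m" "y \<in> sub3_verts m" using simple_graph_edgeD[OF simple_sub3[of m], of x y] e xy(1) by auto
    with xy(2) have "e \<subseteq> S 1 \<or> e \<subseteq> S 3" unfolding xy(1)
      by (cases rule: sub3_arcE) (auto simp: S_def)
    then show "\<exists>F\<in>{induce ?G (S 1), induce ?G (S 3)}. e \<in> edges F" using e by auto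
  qed simp
  also have "\<dots> \<le> 2" by (simp add: card_insert_if)
  finally show ?thesis .
qed

lemma radius_at_mostI:
  assumes "c \<in> verts G" "\<And>v. v \<in> verts G \<Longrightarrow> \<exists>p. walk G c p v \<and> length p \<le> Suc d"
  shows "radius_at_most d G"
  unfolding radius_at_most_def
proof (intro bexI[of _ c] ballI)
  fix v assume "v \<in> verts G"
  then obtain p where p: "walk G c p v" "length p \<le> Suc d" using assms(2) by blast
  have "graph_dist G c v \<le> enat (length p - 1)"
    unfolding graph_dist_def using p(1) by (intro INF_lower) simp
  also have "\<dots> \<le> enat d" using p(2) by simp
  finally show "graph_dist G c v \<le> enat d" .
qed (rule assms(1))

text \<open>The branch set of \<open>i\<close> takes from each path the half nearer to the branch vertex, the middle
  vertex going to the smaller end.\<close>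

lemma shallow_minor_sub3:
  fixes H :: "nat ugraph"
  assumes "simple_graph H" "verts H \<subseteq> {..<m}"
  shows "shallow_minor 2 H (sub3_graph m)"
proof -
  let ?G = "sub3_graph m"
  define B where "B i = {node [0, i]} \<union> {node [1, i, j] |j. i < j \<and> j < m} \<union>
    {node [2, i, j] |j. i < j \<and> j < m} \<union> {node [3, j, i] |j. j < i}" for i
  have edge: "{x, y} \<in> edges ?G \<longleftrightarrow> (x, y) \<in> sub3_arcs m \<or> (y, x) \<in> sub3_arcs m" for x y
    by (rule edge_arc_graph_iff)
  have sub: "B i \<subseteq> verts ?G" if "i < m" for i
    using that by (auto simp: B_def sub3_vertexI simp del: One_nat_def)
  have short: "\<exists>p. walk (induce ?G (B i)) (node [0, i]) p v \<and> length p \<le> 3" if i: "i < m" and v: "v \<in> B i" for i v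
  proof -
    let ?o = "node [0, i]"
    consider "v = ?o" | j where "v = node [1, i, j]" "i < j" "j < m" | j where "v = node [2, i, j]" "i < j" "j < m"
      | j where "v = node [3, j, i]" "j < i"
      using v by (auto simp: B_def)
    then show ?thesis
    proof cases
      case 1
      then show ?thesis by (intro exI[of _ "[?o]"]) (simp add: walk_def B_def)
    next
      case 2
      then show ?thesis by (intro exI[of _ "[?o, v]"]) (auto simp: walk_def edge_arc_graph_iff B_def sub3_arcs_def)
    next
      case 3
      then show ?thesis by (intro exI[of _ "[?o, node [1, i, j], v]"]) (auto simp: walk_def edge_arc_graph_iff B_def sub3_arcs_def)
    next
      case 4
      then show ?thesis using i by (intro exI[of _ "[?o, v]"]) (auto simp: walk_def edge_arc_graph_iff B_def sub3_arcs_def)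
    qed
  qed
  \<comment> \<open>The middle vertex, at distance 2 from the smaller end, is adjacent to the last
    inner vertex, which belongs to the larger end.\<close>
  have touch: "\<exists>x\<in>B i. \<exists>y\<in>B j. (x, y) \<in> sub3_arcs m" if "i < j" "j < m" for i j
    using that by (intro bexI[of _ "node [2, i, j]"] bexI[of _ "node [3, i, j]"]) (auto simp: B_def sub3_arcs_def)
  show ?thesis
    unfolding shallow_minor_def
  proof (intro exI[of _ B] conjI ballI allI impI)
    fix i assume "i \<in> verts H"
    then have i: "i < m" using assms(2) by auto
    show "B i \<subseteq> verts ?G" by (rule sub[OF i])
    have o: "node [0, i] \<in> B i" by (simp add: B_def)
    show "connected_graph (induce ?G (B i))"
    proof (rule connected_graphI)
      show "node [0, i] \<in> verts (induce ?G (B i))" using o by simp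
      fix v assume "v \<in> verts (induce ?G (B i))"
      then have "joined (induce ?G (B i)) (node [0, i]) v" using short[OF i, of v] by (auto simp: joined_def)
      then show "joined (induce ?G (B i)) v (node [0, i])" by (rule joined_sym)
    qed
    show "radius_at_most 2 (induce ?G (B i))"
      by (rule radius_at_mostI[of "node [0, i]"]) (use o short[OF i] in simp_all)
  next
    fix i j :: nat assume "i \<noteq> j"
    then show "B i \<inter> B j = {}" by (auto simp: B_def)
  next
    fix i j assume e: "{i, j} \<in> edges H"
    have "i \<noteq> j" "i < m" "j < m" using simple_graph_edgeD[OF assms(1) e] assms(2) by auto
    then show "\<exists>x\<in>B i. \<exists>y\<in>B j. {x, y} \<in> edges ?G"
      using touch[of i j] touch[of j i] edge by (cases i j rule: linorder_cases) blast+
  qed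
qed

lemma ex_bounded_not_nowhere_dense:
  "\<exists>\<C> :: nat ugraph set. (\<forall>G \<in> \<C>. simple_graph G) \<and> (\<forall>k \<ge> 1. f_bounded k \<C>) \<and> \<not> nowhere_dense \<C>"
proof (intro exI conjI)
  let ?C = "range sub3_graph"
  show "\<forall>G\<in>?C. simple_graph G" using simple_sub3 by auto
  show "\<forall>k\<ge>1. f_bounded k ?C"
  proof (intro allI impI)
    fix k :: nat
    \<comment> \<open>Two forests suffice from \<open>m = k\<close> on; the finitely many smaller
      members are absorbed in the maximum.\<close>
    let ?c = "Max (insert 2 ((\<lambda>m. strong_induced_arboricity k (sub3_graph m)) ` {..<k}))"
    have "strong_induced_arboricity k (sub3_graph m) \<le> ?c" for m
    proof (cases "k \<le> m")
      case True
      then have "strong_induced_arboricity k (sub3_graph m) \<le> 2" by (rule sub3_arboricity)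
      also have "2 \<le> ?c" by simp
      finally show ?thesis .
    qed (intro Max_ge; simp)
    then show "f_bounded k ?C" by (auto simp: f_bounded_def)
  qed
  have "\<exists>H\<in>?C. shallow_minor 2 G H" if "simple_graph G" for G :: "nat ugraph"
  proof -
    have "verts G \<subseteq> {..<Suc (Max (insert 0 (verts G)))}"
      using finite_verts[OF that] by (auto simp: less_Suc_eq_le)
    then show ?thesis using shallow_minor_sub3[OF that] by blast
  qed
  then show "\<not> nowhere_dense ?C" by (auto simp: nowhere_dense_def)
qed

section \<open>Part (iii): a shallow triangle minor forces a short cycle\<close>

section \<open>Short cycles from shallow minors\<close>

lemma graph_dist_walk:
  assumes "graph_dist G u v \<le> enat d"
  obtains p where "walk G u p v" "length p \<le> Suc d"
proof -
  have "\<exists>p. walk G u p v \<and> length p \<le> Suc d"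
  proof (rule ccontr)
    assume neg: "\<not> ?thesis"
    have "enat (Suc d) \<le> graph_dist G u v"
      unfolding graph_dist_def by (rule INF_greatest) (use neg in fastforce)
    also note assms
    finally show False by simp
  qed
  then show thesis using that by blast
qed

lemma walk_prefix:
  assumes "walk G u p v" "x \<in> set p"
  shows "joined G u x"
proof -
  obtain a b where "p = a @ x # b" using assms(2) by (auto dest: split_list)
  then have p: "p = (a @ [x]) @ b" by simp
  then have "successively (\<lambda>x y. {x, y} \<in> edges G) ((a @ [x]) @ b)"
    using assms(1) by (simp add: walk_def)
  then have "successively (\<lambda>x y. {x, y} \<in> edges G) (a @ [x])"
    using successively_append_iff by blast
  then have "walk G u (a @ [x]) x"
    using assms(1) p by (cases a) (auto simp: walk_def)
  then show ?thesis by (auto simp: joined_def)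
qed

lemma walk_induce_subset:
  assumes "walk (induce G B) u p v" "set p \<subseteq> S"
  shows "walk (induce G S) u p v"
proof -
  have "successively (\<lambda>x y. {x, y} \<in> edges (induce G S)) p"
    using assms unfolding walk_def successively_conv_nth by (auto simp: subset_iff)
  then show ?thesis using assms by (simp add: walk_def)
qed

text \<open>Walks from a centre to \<open>x\<close> and to \<open>y\<close> have at most
  \<open>d + 1\<close> vertices each and share the centre. Connectedness of their union is passed on
  as an edge count.\<close>

lemma connected_two_walks:
  assumes G: "simple_graph G" "B \<subseteq> verts G" and r: "radius_at_most d (induce G B)" and "x \<in> B" "y \<in> B"
  obtains S where "S \<subseteq> B" "x \<in> S" "y \<in> S" "card S \<le> 2 * d + 1"
    "card S \<le> card {e \<in> edges G. e \<subseteq> S} + 1"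
proof -
  obtain c where c: "c \<in> B" "\<And>v. v \<in> B \<Longrightarrow> graph_dist (induce G B) c v \<le> enat d"
    using r by (auto simp: radius_at_most_def)
  obtain p where p: "walk (induce G B) c p x" "length p \<le> Suc d"
    using graph_dist_walk[OF c(2)[OF assms(4)]] .
  obtain q where q: "walk (induce G B) c q y" "length q \<le> Suc d"
    using graph_dist_walk[OF c(2)[OF assms(5)]] .
  have hd: "p = c # tl p" "q = c # tl q"
    using p(1) q(1) by (cases p; cases q; auto simp: walk_def)+
  define S where "S = set p \<union> set q"
  have S: "S \<subseteq> B" using p(1) q(1) by (auto simp: walk_def S_def)
  have "S = set (c # tl p @ tl q)"
    unfolding S_def by (subst hd(1), subst hd(2)) auto
  then have "card S \<le> length (c # tl p @ tl q)" using card_length by metis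
  also have "\<dots> \<le> 2 * d + 1" using p(2) q(2) by simp
  finally have card: "card S \<le> 2 * d + 1" .
  have "connected_graph (induce G S)"
  proof (rule connected_graphI)
    have "c \<in> set p" by (subst hd(1)) simp
    then show "c \<in> verts (induce G S)" by (simp add: S_def)
    fix v assume "v \<in> verts (induce G S)"
    then have "joined (induce G S) c v"
      using walk_prefix[OF walk_induce_subset[OF p(1)], of S v] walk_prefix[OF walk_induce_subset[OF q(1)], of S v]
      by (auto simp: S_def)
    then show "joined (induce G S) v c" by (rule joined_sym)
  qed
  then have "card S \<le> card {e \<in> edges G. e \<subseteq> S} + 1"
    using connected_graph_card_edges[OF simple_graph_induce[OF G(1), of S]] S G(2) by auto
  moreover have "x \<in> S" "y \<in> S" using p(1) q(1) by (auto simp: S_def walk_def)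
  ultimately show thesis using that S card by blast
qed

text \<open>Three disjoint connected sets and three edges linking them have in total at least as
  many edges as vertices, so a cycle exists without tracing its course. Its length is at most the
  number of vertices, \<open>3 * (2 * d + 1)\<close>.\<close>

lemma shallow_minor_triangle:
  assumes H: "simple_graph H" and minor: "shallow_minor d G H"
    and tri: "{a, b} \<in> edges G" "{b, c} \<in> edges G" "{a, c} \<in> edges G"
    and abc: "a \<in> verts G" "b \<in> verts G" "c \<in> verts G" "a \<noteq> b" "b \<noteq> c" "a \<noteq> c"
  obtains p where "vcycle H p" "length p \<le> 6 * d + 3"
proof -
  obtain B where B: "\<And>v. v \<in> verts G \<Longrightarrow> B v \<subseteq> verts H \<and> radius_at_most d (induce H (B v))"
    "\<And>u v. u \<in> verts G \<Longrightarrow> v \<in> verts G \<Longrightarrow> u \<noteq> v \<Longrightarrow> B u \<inter> B v = {}"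
    "\<And>u v. {u, v} \<in> edges G \<Longrightarrow> \<exists>x\<in>B u. \<exists>y\<in>B v. {x, y} \<in> edges H"
  proof -
    obtain B where "\<forall>v\<in>verts G. B v \<subseteq> verts H \<and> connected_graph (induce H (B v)) \<and>
        radius_at_most d (induce H (B v))"
      "\<forall>u\<in>verts G. \<forall>v\<in>verts G. u \<noteq> v \<longrightarrow> B u \<inter> B v = {}"
      "\<forall>u v. {u, v} \<in> edges G \<longrightarrow> (\<exists>x\<in>B u. \<exists>y\<in>B v. {x, y} \<in> edges H)"
      using minor unfolding shallow_minor_def by (elim exE conjE) (rule that)
    then show thesis using that[of B] by simp
  qed
  obtain xab xba where ab: "xab \<in> B a" "xba \<in> B b" "{xab, xba} \<in> edges H" using B(3)[OF tri(1)] by blast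
  obtain xbc xcb where bc: "xbc \<in> B b" "xcb \<in> B c" "{xbc, xcb} \<in> edges H" using B(3)[OF tri(2)] by blast
  obtain xac xca where ac: "xac \<in> B a" "xca \<in> B c" "{xac, xca} \<in> edges H" using B(3)[OF tri(3)] by blast
  define E where "E S = {e \<in> edges H. e \<subseteq> S}" for S
  note two = connected_two_walks[OF H, folded E_def]
  have branch: "\<exists>S. S \<subseteq> B v \<and> x \<in> S \<and> y \<in> S \<and> card S \<le> 2 * d + 1 \<and> card S \<le> card (E S) + 1"
    if "v \<in> verts G" "x \<in> B v" "y \<in> B v" for v x y
    using two[of "B v" d x y] B(1)[OF that(1)] that(2,3) by metis
  obtain A where A: "A \<subseteq> B a" "xab \<in> A" "xac \<in> A" "card A \<le> 2 * d + 1" "card A \<le> card (E A) + 1"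
    using branch[OF abc(1) ab(1) ac(1)] by blast
  obtain A' where A': "A' \<subseteq> B b" "xba \<in> A'" "xbc \<in> A'" "card A' \<le> 2 * d + 1" "card A' \<le> card (E A') + 1"
    using branch[OF abc(2) ab(2) bc(1)] by blast
  obtain A'' where A'': "A'' \<subseteq> B c" "xca \<in> A''" "xcb \<in> A''" "card A'' \<le> 2 * d + 1" "card A'' \<le> card (E A'') + 1"
    using branch[OF abc(3) ac(2) bc(2)] by blast
  have disj: "A \<inter> A' = {}" "A' \<inter> A'' = {}" "A \<inter> A'' = {}"
    using A(1) A'(1) A''(1) B(2)[OF abc(1,2,4)] B(2)[OF abc(2,3,5)] B(2)[OF abc(1,3,6)] by blast+
  define S where "S = A \<union> A' \<union> A''"
  have SH: "S \<subseteq> verts H" using A(1) A'(1) A''(1) B(1) abc unfolding S_def by blast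
  then have finS: "finite S" using finite_verts[OF H] finite_subset by blast
  then have fin: "finite A" "finite A'" "finite A''" by (auto simp: S_def)
  have finE: "finite (E X)" for X using finite_edges[OF H] by (simp add: E_def)
  have cardS: "card S = card A + card A' + card A''"
    unfolding S_def using fin disj by (subst card_Un_disjoint, auto)+
  define C where "C = {{xab, xba}, {xbc, xcb}, {xac, xca}}"
  have ne: "e \<noteq> {}" if "e \<in> edges H" for e using H that by (auto simp: simple_graph_def)
  have Edisj: "E X \<inter> E Y = {}" if "X \<inter> Y = {}" for X Y using ne that by (fastforce simp: E_def)
  have "xab \<notin> {xbc, xcb}" "xab \<notin> {xca, xcb}" "xbc \<notin> {xac, xca}" "xba \<notin> {xac, xca}"
    using A(2,3) A'(2,3) A''(2,3) disj by blast+
  then have "{xab, xba} \<noteq> {xbc, xcb}" "{xbc, xcb} \<noteq> {xac, xca}" "{xab, xba} \<noteq> {xac, xca}" by blast+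
  then have C: "card C = 3" "finite C" by (simp_all add: C_def)
  have "(E A \<union> E A' \<union> E A'') \<inter> C = {}"
    using A A' A'' disj by (auto simp: E_def C_def)
  then have "card (E A \<union> E A' \<union> E A'' \<union> C) = card (E A \<union> E A' \<union> E A'') + card C"
    using finE C(2) by (intro card_Un_disjoint) auto
  also have "card (E A \<union> E A' \<union> E A'') = card (E A) + card (E A') + card (E A'')"
    using disj finE by (simp add: card_Un_disjoint Edisj Int_Un_distrib2)
  finally have "card (E A) + card (E A') + card (E A'') + 3 = card (E A \<union> E A' \<union> E A'' \<union> C)"
    using C(1) by simp
  also have "\<dots> \<le> card (E S)"
    using A A' A'' ab bc ac by (intro card_mono finE) (auto simp: E_def S_def C_def)
  finally have "card S \<le> card (E S)" using cardS A(5) A'(5) A''(5) by linarith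
  then have "\<not> acyclic_graph (induce H S)"
    using acyclic_graph_card_edges[OF simple_graph_induce[OF H SH]] A(2) by (force simp: E_def S_def)
  then obtain p where p: "vcycle (induce H S) p" by (auto simp: acyclic_graph_def)
  then have "vcycle H p" "distinct p" "set p \<subseteq> S" using SH by (auto simp: vcycle_iff_nth)
  moreover from this have "length p \<le> card S" using card_mono[OF finS] by (metis distinct_card)
  then have "length p \<le> 6 * d + 3" using cardS A(4) A'(4) A''(4) by linarith
  ultimately show thesis using that by blast
qed

text \<open>From index \<open>6 * d + 3\<close> on, the girth excludes triangles as
  \<open>d\<close>-shallow minors; the finitely many earlier members have fewer vertices than the
  excluded clique.\<close>

lemma nowhere_dense_girth:
  fixes \<G> :: "nat \<Rightarrow> 'a ugraph"
  assumes simple: "\<And>n. simple_graph (\<G> n)" and girth: "\<And>n p. vcycle (\<G> n) p \<Longrightarrow> n < length p"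
  shows "nowhere_dense (range \<G>)"
  unfolding nowhere_dense_def
proof
  fix d
  \<comment> \<open>More than the number of vertices of each early member, and at least 3 so that
    the clique contains a triangle.\<close>
  define N where "N = 3 + Max ((\<lambda>n. card (verts (\<G> n))) ` {..<6 * d + 3})"
  define K where "K = Graph {..<N} {e. e \<subseteq> {..<N} \<and> card e = 2}"
  have "simple_graph K" by (auto simp: K_def simple_graph_def)
  moreover have "\<not> shallow_minor d K (\<G> n)" for n
  proof
    assume minor: "shallow_minor d K (\<G> n)"
    show False
    proof (cases "n < 6 * d + 3")
      case True
      obtain B where B: "\<And>v. v < N \<Longrightarrow> B v \<subseteq> verts (\<G> n) \<and> B v \<noteq> {}"
        "\<And>u v. u < N \<Longrightarrow> v < N \<Longrightarrow> u \<noteq> v \<Longrightarrow> B u \<inter> B v = {}"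
      proof -
        obtain B where "\<forall>v\<in>verts K. B v \<subseteq> verts (\<G> n) \<and> connected_graph (induce (\<G> n) (B v)) \<and>
            radius_at_most d (induce (\<G> n) (B v))"
          "\<forall>u\<in>verts K. \<forall>v\<in>verts K. u \<noteq> v \<longrightarrow> B u \<inter> B v = {}"
          using minor unfolding shallow_minor_def by blast
        then show thesis using that[of B] by (simp add: K_def connected_graph_def)
      qed
      from B(1) have "\<forall>v\<in>{..<N}. \<exists>x. x \<in> B v" by blast
      then obtain f where "\<forall>v\<in>{..<N}. f v \<in> B v" by (rule bchoice[THEN exE])
      then have f: "f v \<in> B v" if "v < N" for v using that by simp
      have "inj_on f {..<N}" using f B(2) by (fastforce simp: inj_on_def)
      moreover have "f ` {..<N} \<subseteq> verts (\<G> n)" using f B(1) by blast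
      ultimately have "card {..<N} \<le> card (verts (\<G> n))"
        using finite_verts[OF simple] by (rule card_inj_on_le)
      moreover have "card (verts (\<G> n)) \<le> Max ((\<lambda>n. card (verts (\<G> n))) ` {..<6 * d + 3})"
        using True by (intro Max_ge) auto
      ultimately show False by (simp add: N_def)
    next
      case False
      obtain p where "vcycle (\<G> n) p" "length p \<le> 6 * d + 3"
        by (rule shallow_minor_triangle[OF simple minor, of 0 1 2]) (auto simp: K_def N_def)
      then show False using girth[of n p] False by simp
    qed
  qed
  ultimately show "\<exists>G :: nat ugraph. simple_graph G \<and> (\<forall>H\<in>range \<G>. \<not> shallow_minor d G H)" by blast
qed

section \<open>Part (iii): an extremal graph of large girth and large degree\<close>

section \<open>Graphs of large girth with many edges\<close>

definition nbrs :: "'a ugraph \<Rightarrow> 'a \<Rightarrow> 'a set" where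
  "nbrs G v = {w. {v, w} \<in> edges G}"

lemma finite_nbrs: "simple_graph G \<Longrightarrow> finite (nbrs G v)"
  by (rule finite_subset[OF _ finite_verts]) (auto simp: nbrs_def dest: simple_graph_edgeD)

lemma walk_rev: "walk G u p v \<Longrightarrow> walk G v (rev p) u"
  by (auto simp: walk_def hd_rev last_rev successively_rev insert_commute)

definition walk_ball :: "'a ugraph \<Rightarrow> nat \<Rightarrow> 'a \<Rightarrow> 'a set" where
  "walk_ball G i u = {v. \<exists>p. walk G u p v \<and> length p \<le> Suc i}"

text \<open>A walk that leaves \<open>u\<close> continues from a neighbour, so the bound follows
  from \<open>1 + D * (D + 1) ^ i \<le> (D + 1) ^ (i + 1)\<close>.\<close>

lemma card_walk_ball:
  assumes G: "simple_graph G" and deg: "\<And>v. card (nbrs G v) \<le> D"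
  shows "finite (walk_ball G i u) \<and> card (walk_ball G i u) \<le> (D + 1) ^ i"
proof (induction i arbitrary: u)
  case 0
  have "walk_ball G 0 u \<subseteq> {u}"
    by (auto simp: walk_ball_def walk_def le_Suc_eq length_Suc_conv)
  then show ?case using card_mono[of "{u}"] finite_subset[of _ "{u}"] by fastforce
next
  case (Suc i)
  let ?U = "\<Union>w \<in> nbrs G u. walk_ball G i w"
  have "walk_ball G (Suc i) u \<subseteq> insert u ?U"
  proof
    fix v assume "v \<in> walk_ball G (Suc i) u"
    then obtain p where p: "walk G u p v" "length p \<le> Suc (Suc i)" by (auto simp: walk_ball_def)
    then obtain q where q: "p = u # q" by (cases p) (auto simp: walk_def)
    show "v \<in> insert u ?U"
    proof (cases q)
      case Nil
      then show ?thesis using p q by (simp add: walk_def)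
    next
      case (Cons w q')
      then have "{u, w} \<in> edges G" "walk G w q v" using p(1) q by (auto simp: walk_Cons_Cons)
      then show ?thesis using p(2) q by (auto simp: nbrs_def walk_ball_def)
    qed
  qed
  moreover have finU: "finite (insert u ?U)" using finite_nbrs[OF G] Suc by auto
  ultimately have "finite (walk_ball G (Suc i) u)" "card (walk_ball G (Suc i) u) \<le> card (insert u ?U)"
    by (auto intro: finite_subset card_mono)
  moreover have "card (insert u ?U) \<le> Suc (card ?U)" by (rule card_insert_le_m1) auto
  moreover have "card ?U \<le> (\<Sum>w \<in> nbrs G u. card (walk_ball G i w))"
    by (rule card_UN_le[OF finite_nbrs[OF G]])
  moreover have "\<dots> \<le> card (nbrs G u) * (D + 1) ^ i"
    using sum_bounded_above[of "nbrs G u" "\<lambda>w. card (walk_ball G i w)" "(D + 1) ^ i"] Suc by simp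
  moreover have "\<dots> \<le> D * (D + 1) ^ i" using deg by (rule mult_right_mono) simp
  moreover have "1 \<le> (D + 1) ^ i" "(D + 1) ^ Suc i = D * (D + 1) ^ i + (D + 1) ^ i" by simp_all
  ultimately show ?case by linarith
qed

text \<open>A cycle through the new edge becomes, without this edge, a walk between \<open>u\<close>
  and \<open>w\<close> in the old graph.\<close>

lemma vcycle_insert_edge:
  assumes cyc: "vcycle (Graph (verts G) (insert {u, w} (edges G))) p"
  shows "vcycle G p \<or> w \<in> walk_ball G (length p) u"
proof (rule disjCI)
  let ?G = "Graph (verts G) (insert {u, w} (edges G))"
  assume far: "w \<notin> walk_ball G (length p) u"
  have p: "3 \<le> length p" "distinct p" "set p \<subseteq> verts G"
    "\<And>i. i < length p \<Longrightarrow> {p ! i, p ! (Suc i mod length p)} \<in> edges G \<or> {p ! i, p ! (Suc i mod length p)} = {u, w}"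
    using cyc by (auto simp: vcycle_iff_nth)
  have "{p ! i, p ! (Suc i mod length p)} \<noteq> {u, w}" if i: "i < length p" for i
  proof
    assume uw: "{p ! i, p ! (Suc i mod length p)} = {u, w}"
    \<comment> \<open>Rotated so that the new edge leads from the last entry back to the
      first.\<close>
    define q where "q = rotate (Suc i) p"
    define l where "l = length q"
    have l: "3 \<le> l" "l = length p" using p(1) by (simp_all add: q_def l_def)
    have q: "vcycle ?G q" unfolding q_def by (rule vcycle_rotate[OF cyc])
    have q0: "q ! 0 = p ! (Suc i mod length p)" using i nth_rotate[of 0 p "Suc i"] by (cases p) (auto simp: q_def)
    have "q ! (l - 1) = p ! ((Suc i + (l - 1)) mod length p)"
      using l nth_rotate[of "l - 1" p "Suc i"] by (simp add: q_def)
    also have "Suc i + (l - 1) = i + length p" using l by simp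
    finally have ql: "q ! (l - 1) = p ! i" using i by simp
    have "{q ! j, q ! Suc j} \<in> edges G" if j: "Suc j < l" for j
    proof -
      have "{q ! j, q ! Suc j} \<noteq> {q ! 0, q ! (l - 1)}"
      proof
        assume eq: "{q ! j, q ! Suc j} = {q ! 0, q ! (l - 1)}"
        have inj: "q ! a = q ! b \<longleftrightarrow> a = b" if "a < l" "b < l" for a b
          using q that by (simp add: vcycle_iff_nth nth_eq_iff_index_eq l_def)
        have "0 < l" "l - 1 < l" "j < l" using l(1) j by auto
        then have "{j, Suc j} = {0, l - 1}"
          using eq inj j unfolding doubleton_eq_iff by blast
        then show False using l(1) by (auto simp: doubleton_eq_iff)
      qed
      then have "{q ! j, q ! Suc j} \<noteq> {u, w}" unfolding q0 ql uw[symmetric] by (simp add: insert_commute)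
      moreover have "\<And>a. a < l \<Longrightarrow> {q ! a, q ! (Suc a mod l)} \<in> edges ?G"
        using q unfolding vcycle_iff_nth l_def by blast
      then have "{q ! j, q ! (Suc j mod l)} \<in> edges ?G" using j by (meson Suc_lessD)
      ultimately show ?thesis using j by simp
    qed
    moreover have "set q \<subseteq> verts G" using p(3) by (simp add: q_def)
    moreover have "q \<noteq> []" using l l_def by auto
    ultimately have walk: "walk G (q ! 0) q (q ! (l - 1))"
      by (auto simp: walk_def successively_conv_nth hd_conv_nth last_conv_nth l_def)
    from uw consider "q ! 0 = u" "q ! (l - 1) = w" | "q ! 0 = w" "q ! (l - 1) = u"
      unfolding q0[symmetric] ql[symmetric] by (auto simp: doubleton_eq_iff)
    then have "\<exists>q'. walk G u q' w \<and> length q' = length p"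
      by cases (use walk walk_rev[OF walk] l l_def in \<open>metis length_rev\<close>)+
    then show False using far by (auto simp: walk_ball_def)
  qed
  then show "vcycle G p" using p by (auto simp: vcycle_iff_nth)
qed

lemma walk_ball_mono: "i \<le> j \<Longrightarrow> walk_ball G i u \<subseteq> walk_ball G j u"
  by (fastforce simp: walk_ball_def)

text \<open>In a graph with a maximal edge set subject to the bounds on degree and girth, all vertices
  of non-maximal degree are close to each other, hence few.\<close>

lemma ex_large_girth:
  fixes D g M :: nat
  assumes "1 \<le> g"
  obtains G :: "nat ugraph" where "simple_graph G" "verts G = {..<M}" "\<And>p. vcycle G p \<Longrightarrow> g < length p"
    "\<And>v. card (nbrs G v) \<le> D" "card {v. v < M \<and> card (nbrs G v) < D} \<le> (D + 1) ^ g"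
proof -
  define \<E> where "\<E> = {E. simple_graph (Graph {..<M} E) \<and> (\<forall>p. vcycle (Graph {..<M} E) p \<longrightarrow> g < length p) \<and>
    (\<forall>v. card (nbrs (Graph {..<M} E) v) \<le> D)}"
  have "\<E> \<subseteq> Pow (Pow {..<M})" by (auto simp: \<E>_def simple_graph_def)
  then have "finite \<E>" by (rule finite_subset) simp
  moreover have "{} \<in> \<E>"
  proof -
    have "\<not> vcycle (Graph {..<M} {}) p" for p
      by (auto simp: vcycle_def)
    then show ?thesis by (auto simp: \<E>_def simple_graph_def nbrs_def)
  qed
  ultimately obtain E where E: "E \<in> \<E>" "\<And>E'. E' \<in> \<E> \<Longrightarrow> card E' \<le> card E"
    using finite_imageI[of \<E> card] Max_in[of "card ` \<E>"] Max_ge[of "card ` \<E>"] by (metis (no_types, lifting) empty_iff image_iff imageI)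
  define G where "G = Graph {..<M} E"
  have vG: "verts G = {..<M}" "edges G = E" by (simp_all add: G_def)
  have G: "simple_graph G" "\<And>p. vcycle G p \<Longrightarrow> g < length p" "\<And>v. card (nbrs G v) \<le> D"
    using E(1) by (auto simp: \<E>_def G_def)
  let ?L = "{v. v < M \<and> card (nbrs G v) < D}"
  \<comment> \<open>Otherwise the edge from \<open>u\<close> to \<open>w\<close> could be added:
    both degrees stay within \<open>D\<close>, and a new short cycle would require a short walk
    between them.\<close>
  have near: "w \<in> walk_ball G g u" if uw: "u \<in> ?L" "w \<in> ?L" for u w
  proof (rule ccontr)
    assume far: "w \<notin> walk_ball G g u"
    have "u \<noteq> w"
    proof
      assume "u = w"
      then have "walk G u [u] w" using uw by (simp add: walk_def vG)
      then show False using far by (auto simp: walk_ball_def intro!: exI[of _ "[u]"])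
    qed
    have new: "{u, w} \<notin> E"
    proof
      assume "{u, w} \<in> E"
      then have "walk G u [u, w] w" using uw by (simp add: walk_def vG)
      then show False using far assms by (auto simp: walk_ball_def intro!: exI[of _ "[u, w]"])
    qed
    let ?G = "Graph {..<M} (insert {u, w} E)"
    have "simple_graph ?G" using G(1) uw \<open>u \<noteq> w\<close> by (auto simp: simple_graph_def vG)
    moreover have "g < length p" if p: "vcycle ?G p" for p
    proof (rule ccontr)
      assume "\<not> g < length p"
      then have "w \<notin> walk_ball G (length p) u" using far walk_ball_mono[of "length p" g G u] by auto
      then have "vcycle G p" using vcycle_insert_edge[of G u w p] p by (simp add: vG)
      then show False using G(2) \<open>\<not> g < length p\<close> by blast
    qed
    moreover have "card (nbrs ?G v) \<le> D" for v
    proof -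
      have "nbrs ?G v \<subseteq> (if v = u then insert w (nbrs G v) else if v = w then insert u (nbrs G v) else nbrs G v)"
        by (auto simp: nbrs_def vG doubleton_eq_iff)
      then have "card (nbrs ?G v) \<le> card (if v = u then insert w (nbrs G v) else if v = w then insert u (nbrs G v) else nbrs G v)"
        by (rule card_mono[rotated]) (simp add: finite_nbrs[OF G(1)])
      also have "\<dots> \<le> D" using uw G(3)[of v] finite_nbrs[OF G(1)] by (auto simp: card_insert_if)
      finally show ?thesis .
    qed
    ultimately have "insert {u, w} E \<in> \<E>" by (simp add: \<E>_def)
    then have "card (insert {u, w} E) \<le> card E" by (rule E(2))
    then show False using new finite_edges[OF G(1)] by (simp add: vG)
  qed
  have "card ?L \<le> (D + 1) ^ g"
  proof (cases "?L = {}")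
    case False
    then obtain u where "u \<in> ?L" by blast
    then have "?L \<subseteq> walk_ball G g u" using near by blast
    then show ?thesis using card_walk_ball[OF G(1,3), of g u] card_mono le_trans by blast
  next
    case True
    then show ?thesis by (simp only: card.empty)
  qed
  then show thesis using that G vG by blast
qed

lemma card_valid_edges_le:
  assumes "simple_graph G" "\<And>e. e \<in> X \<Longrightarrow> valid_edge k G e"
  shows "card X \<le> strong_induced_arboricity k G * card (verts G)"
proof -
  obtain \<F> where \<F>: "finite \<F>" "card \<F> = strong_induced_arboricity k G"
    "\<And>F. F \<in> \<F> \<Longrightarrow> strong_forest k F G" "\<And>e. valid_edge k G e \<Longrightarrow> \<exists>F \<in> \<F>. e \<in> edges F"
    using strong_induced_arboricity_attained[OF assms(1)] by blast
  have F: "finite (edges F) \<and> card (edges F) \<le> card (verts G)" if "F \<in> \<F>" for F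
  proof -
    note sF = strong_forestD[OF \<F>(3)[OF that] assms(1)]
    have "card (edges F) \<le> card (verts F)"
    proof (cases "verts F = {}")
      case True
      then have "edges F = {}" using sF(1) by (auto simp: simple_graph_def)
      then show ?thesis by simp
    qed (use acyclic_graph_card_edges[OF sF(1,2)] in simp)
    also have "\<dots> \<le> card (verts G)" using sF(3) finite_verts[OF assms(1)] by (rule card_mono[rotated])
    finally show ?thesis using finite_edges[OF sF(1)] by simp
  qed
  have "X \<subseteq> (\<Union>F \<in> \<F>. edges F)" using \<F>(4) assms(2) by blast
  then have "card X \<le> card (\<Union>F \<in> \<F>. edges F)" using \<F>(1) F by (intro card_mono) auto
  also have "\<dots> \<le> (\<Sum>F \<in> \<F>. card (edges F))" by (rule card_UN_le[OF \<F>(1)])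
  also have "\<dots> \<le> card \<F> * card (verts G)"
    using sum_bounded_above[of \<F> "\<lambda>F. card (edges F)" "card (verts G)"] F by simp
  finally show ?thesis using \<F>(2) by simp
qed

lemma ex_large_girth_arboricity:
  "\<exists>G :: nat ugraph. simple_graph G \<and> (\<forall>p. vcycle G p \<longrightarrow> n < length p) \<and>
     (\<forall>k \<le> n. n \<le> strong_induced_arboricity k G)"
proof -
  \<comment> \<open>\<open>M\<close> is twice the bound on the number of vertices of degree below
    \<open>D\<close>, so at least half of the vertices have degree \<open>D\<close>. They account
    for at least \<open>(M / 2) * D / 2 = n * M\<close> edges. Girth above \<open>n + 3\<close>
    excludes triangles as well as cycles of length at most \<open>n\<close>.\<close>
  define D where "D = 4 * n"
  define g where "g = n + 3"
  define M where "M = 2 * (D + 1) ^ g"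
  obtain G :: "nat ugraph" where G: "simple_graph G" "verts G = {..<M}" "\<And>p. vcycle G p \<Longrightarrow> g < length p"
    "\<And>v. card (nbrs G v) \<le> D" "card {v. v < M \<and> card (nbrs G v) < D} \<le> (D + 1) ^ g"
    using ex_large_girth[of g M D] by (auto simp: g_def)
  define V where "V = {v. v < M \<and> card (nbrs G v) = D}"
  have "V \<union> {v. v < M \<and> card (nbrs G v) < D} = {..<M}" using G(4) by (auto simp: V_def order.order_iff_strict)
  then have "M \<le> card V + card {v. v < M \<and> card (nbrs G v) < D}"
    using card_Un_le[of V] by (metis card_lessThan)
  then have cardV: "M \<le> 2 * card V" using G(5) by (simp add: M_def)
  define X where "X = {e \<in> edges G. e \<inter> V \<noteq> {}}"
  have finX: "finite X" using finite_edges[OF G(1)] by (simp add: X_def)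
  have finV: "finite V" by (simp add: V_def)
  have "D * card V = card (SIGMA v:V. nbrs G v)"
    using finV finite_nbrs[OF G(1)] by (simp add: V_def)
  also have "\<dots> \<le> card (\<Union>e \<in> X. {(v, w). {v, w} = e})"
  proof (rule card_mono)
    have "finite {(v, w). {v, w} = e}" for e :: "nat set"
    proof (cases "\<exists>a b. e = {a, b}")
      case True
      then obtain a b where "e = {a, b}" by blast
      then have "{(v, w). {v, w} = e} \<subseteq> {(a, b), (b, a)}" by (auto simp: doubleton_eq_iff)
      then show ?thesis by (rule finite_subset) simp
    next
      case False
      then have "{(v, w). {v, w} = e} = {}" by auto
      then show ?thesis by simp
    qed
    then show "finite (\<Union>e \<in> X. {(v, w). {v, w} = e})" using finX by simp
    show "(SIGMA v:V. nbrs G v) \<subseteq> (\<Union>e \<in> X. {(v, w). {v, w} = e})" by (auto simp: X_def nbrs_def)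
  qed
  also have "\<dots> \<le> (\<Sum>e \<in> X. card {(v, w). {v, w} = e})" by (rule card_UN_le[OF finX])
  also have "\<dots> \<le> card X * 2"
  proof -
    have "card {(v, w). {v, w} = e} \<le> 2" if "e \<in> X" for e
    proof -
      have "e \<in> edges G" using that by (simp add: X_def)
      then obtain a b where "e = {a, b}" using simple_graph_edgeE[OF G(1)] by metis
      then have "{(v, w). {v, w} = e} \<subseteq> {(a, b), (b, a)}" by (auto simp: doubleton_eq_iff)
      then have "card {(v, w). {v, w} = e} \<le> card {(a, b), (b, a)}" by (rule card_mono[rotated]) simp
      also have "\<dots> \<le> length [(a, b), (b, a)]" by (rule order_trans[OF _ card_length]) simp
      finally show ?thesis by simp
    qed
    then show ?thesis using sum_bounded_above[of X "\<lambda>e. card {(v, w). {v, w} = e}" 2] by simp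
  qed
  finally have "2 * (n * card V) \<le> card X" by (simp add: D_def)
  moreover have "n * M \<le> 2 * (n * card V)" using mult_le_mono2[OF cardV, of n] by (simp add: ac_simps)
  ultimately have many: "n * M \<le> card X" by linarith
  have "n \<le> strong_induced_arboricity k G" if k: "k \<le> n" for k
  proof -
    have "valid_edge k G e" if "e \<in> X" for e
    proof -
      obtain v where v: "v \<in> e" "v \<in> V" "e \<in> edges G" using \<open>e \<in> X\<close> by (auto simp: X_def)
      obtain x y where "e = {x, y}" using simple_graph_edgeE[OF G(1) v(3)] by metis
      then have "e = {v, x} \<or> e = {v, y}" using v(1) by auto
      then obtain w where w: "e = {v, w}" by blast
      have vV: "v \<in> verts G" "k \<le> card (nbrs G v)" using v(2) k G(2) by (auto simp: V_def D_def)
      \<comment> \<open>Without triangles the neighbourhood of \<open>v\<close> is independent, and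
        its size \<open>D\<close> is at least \<open>k\<close>.\<close>
      have "strong_forest k (induce G (insert v (nbrs G v))) G"
      proof (rule strong_forest_star[OF G(1) vV(1) _ _ vV(2)])
        show "{v, x} \<in> edges G" if "x \<in> nbrs G v" for x using that by (simp add: nbrs_def)
        fix x y assume xy: "x \<in> nbrs G v" "y \<in> nbrs G v"
        show "{x, y} \<notin> edges G"
        proof
          assume e: "{x, y} \<in> edges G"
          note sD = simple_graph_edgeD[OF G(1)]
          have "vcycle G [v, x, y]"
            using xy e sD[of v x] sD[of v y] sD[OF e] by (intro vcycle_triangle) (auto simp: nbrs_def)
          then show False using G(3)[of "[v, x, y]"] by (simp add: g_def)
        qed
      qed
      then show ?thesis using v(3) w by (intro valid_edgeI) (auto simp: nbrs_def)
    qed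
    then have "card X \<le> strong_induced_arboricity k G * M"
      using card_valid_edges_le[OF G(1), of X k] G(2) by simp
    then have "n * M \<le> strong_induced_arboricity k G * M" using many by linarith
    moreover have "0 < M" by (simp add: M_def)
    ultimately show ?thesis by simp
  qed
  moreover have "n < length p" if "vcycle G p" for p using G(3)[OF that] by (simp add: g_def)
  ultimately show ?thesis using G(1) by blast
qed

lemma ex_nowhere_dense_unbounded:
  "\<exists>\<C> :: nat ugraph set. (\<forall>G \<in> \<C>. simple_graph G) \<and> nowhere_dense \<C> \<and> (\<forall>k \<ge> 1. \<not> f_bounded k \<C>)"
proof -
  obtain \<G> :: "nat \<Rightarrow> nat ugraph" where \<G>: "\<And>n. simple_graph (\<G> n)" "\<And>n p. vcycle (\<G> n) p \<Longrightarrow> n < length p"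
    "\<And>n k. k \<le> n \<Longrightarrow> n \<le> strong_induced_arboricity k (\<G> n)"
    using ex_large_girth_arboricity by metis
  have "\<not> f_bounded k (range \<G>)" for k
  proof
    assume "f_bounded k (range \<G>)"
    then obtain c where c: "\<And>n. strong_induced_arboricity k (\<G> n) \<le> c" by (auto simp: f_bounded_def)
    show False using \<G>(3)[of k "k + c + 1"] c[of "k + c + 1"] by simp
  qed
  then show ?thesis using \<G>(1) nowhere_dense_girth[OF \<G>(1,2)] by (intro exI[of _ "range \<G>"]) auto
qed

theorem theorem4:
  shows
    "(\<forall>G :: 'a ugraph. simple_graph G \<longrightarrow>
        log 3 (real (acyclic_chromatic_number G)) \<le> real (strong_induced_arboricity 1 G) \<and>
        strong_induced_arboricity 1 G \<le> acyclic_chromatic_number G choose 2)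
     \<and>
     (\<forall>k n :: nat. k \<ge> 1 \<longrightarrow> n \<ge> 1 \<longrightarrow>
        (\<exists>G :: nat ugraph. simple_graph G \<and>
           edge_arboricity G = 2 \<and> strong_induced_arboricity k G \<ge> n) \<and>
        (\<exists>G :: nat ugraph. simple_graph G \<and>
           strong_induced_arboricity k G \<le> 3 \<and> strong_induced_arboricity (k + 1) G \<ge> n) \<and>
        (\<exists>G :: nat ugraph. simple_graph G \<and>
           strong_induced_arboricity k G \<ge> n \<and> strong_induced_arboricity (k + 1) G = 0) \<and>
        (\<exists>G :: nat ugraph. simple_graph G \<and>
           (\<exists>H. induced_subgraph H G \<and>
              strong_induced_arboricity k G = 3 \<and> strong_induced_arboricity k H \<ge> k)) \<and>
        (\<exists>G :: nat ugraph. simple_graph G \<and>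
           treewidth G = 2 \<and> strong_induced_arboricity k G \<ge> k) \<and>
        (\<exists>G :: nat ugraph. simple_graph G \<and>
           treedepth G = 3 \<and> strong_induced_arboricity k G \<ge> k - 1))
     \<and>
     (\<exists>\<C> :: nat ugraph set. (\<forall>G \<in> \<C>. simple_graph G) \<and>
        nowhere_dense \<C> \<and> (\<forall>k \<ge> 1. \<not> f_bounded k \<C>))
     \<and>
     (\<exists>\<C> :: nat ugraph set. (\<forall>G \<in> \<C>. simple_graph G) \<and>
        (\<forall>k \<ge> 1. f_bounded k \<C>) \<and> \<not> nowhere_dense \<C>)"
proof (intro conjI allI impI)
  fix k n :: nat
  assume k: "k \<ge> 1"
  have R: "{node [0], node [2]} \<subseteq> cherry_core k" by (simp add: cherry_core_def)
  \<comment> \<open>One cherry graph serves for tree-width and tree-depth alike.\<close>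
  have "k - 1 \<le> strong_induced_arboricity k (cherry_graph k {node [0], node [2]})"
    using cherry_strong_arboricity_ge[OF k] by linarith
  then show "\<exists>G :: nat ugraph. simple_graph G \<and> treedepth G = 3 \<and> strong_induced_arboricity k G \<ge> k - 1"
    using simple_cherry[OF R] cherry_treedepth by blast
  show "\<exists>G :: nat ugraph. simple_graph G \<and> treewidth G = 2 \<and> strong_induced_arboricity k G \<ge> k"
    using simple_cherry[OF R] cherry_treewidth cherry_strong_arboricity_ge[OF k] by blast
qed (rule arboricity_acyclic_chromatic_number ex_edge_arboricity_2 ex_strong_arboricity_jump
    ex_strong_arboricity_drop ex_induced_subgraph_arboricity ex_nowhere_dense_unbounded
    ex_bounded_not_nowhere_dense; assumption)+

end
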